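(* Let $m,p,q\ge1$ be integers and $\sigma_1,\sigma_2,\sigma_3\in\{\pm1\}$ with $(q,\sigma_3)\ne(1,1)$, and write $\tau=\sigma_1\sigma_2\sigma_3$. The quadratic Euler $T$-sums $T_{m,p,q}^{\sigma_1,\sigma_2,\sigma_3}=\sum_{n=1}^\infty\sigma_3^{n-1}\frac{h_{n-1}^{(m)}(\sigma_1)h_{n-1}^{(p)}(\sigma_2)}{(n-1/2)^q}$ satisfy \[ \tau\,\delta_{\tau}^{m+p+q-1}\,T_{m,p,q}^{\sigma_1,\sigma_2,\sigma_3} =\mathcal{G}_1+\mathcal{G}_2+\mathcal{G}_3+\mathcal{G}_4+\mathcal{G}_5+\mathcal{G}_6, \] where \begin{align*} \mathcal{G}_1&=-\tau\Big\{(-1)^m\delta_{\sigma_2\sigma_3}^{p+q}\tilde t(m;\sigma_1)T_{p,q}^{\sigma_2,\sigma_3} +(-1)^p\delta_{\sigma_1\sigma_3}^{m+q}\tilde t(p;\sigma_2)T_{m,q}^{\sigma_1,\sigma_3} +T_{m,p+q}^{\sigma_1,\sigma_2\sigma_3}+T_{p,m+q}^{\sigma_2,\sigma_1\sigma_3}\Big\},\\ \mathcal{G}_2&=-\sigma_1(-1)^m\tilde t(m;\sigma_1)\tilde t(p+q;\sigma_2\sigma_3) -\sigma_2(-1)^p\tilde t(p;\sigma_2)\tilde t(m+q;\sigma_1\sigma_3)\\ &\quad-\sigma_1\sigma_2(-1)^{m+p}\delta_{\sigma_3}^{q-1}\tilde t(m;\sigma_1)\tilde t(p;\sigma_2)\tilde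 t(q;\sigma_3) +\tau(-1)^{m+p+q}\tilde t(m+p+q;\tau),\\ \mathcal{G}_3&=\tau(-1)^{m+p} \sum_{k=0}^{m+p-1}\binom{m+p+q-k-2}{q-1}\delta_{\tau}^k\,\tilde t(k+1;\tau)\,\zeta(m+p+q-k-1;\sigma_3),\\ \mathcal{G}_4&=(-1)^m\sum_{j=1}^m\sum_{k=0}^{m-j} \binom{p+j-2}{p-1}\binom{m+q-j-k-1}{q-1}\delta_{\tau}^k\,\tilde t(k+1;\tau)\\ &\qquad\times\Big\{\sigma_1S_{p+j-1,m+q-j-k}^{\sigma_2,\sigma_3}-\tau(-1)^{p+j}\zeta(p+j-1;\sigma_2)\zeta(m+q-j-k;\sigma_3)\Big\}\\ &\quad+(-1)^p\sum_{j=1}^p\sum_{k=0}^{p-j} \binom{m+j-2}{m-1}\binom{p+q-j-k-1}{q-1}\delta_{\tau}^k\,\tilde t(k+1;\tau)\\ &\qquad\times\Big\{\sigma_2S_{m+j-1,p+q-j-k}^{\sigma_1,\sigma_3}-\tau(-1)^{m+j}\zeta(m+j-1;\sigma_1)\zeta(p+q-j-k;\sigma_3)\Big\},\\ \mathcal{G}_5&=(-1)^m\sum_{j=1}^{p+q}\binom{m+j-2}{m-1} \delta_{\tau}^{p+q-j}\,\tilde t(p+q-j+1;\tau)\,\zeta(m+j-1;\sigma_1)\\ &\quad+(-1)^p\sum_{j=1}^{m+q}\binom{p+j-2}{p-1} \delta_{\tau}^{m+q-j}\,\tilde t(m+q-j+1;\tau)\,\zeta(p+j-1;\sigma_2),\\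 \mathcal{G}_6&=(-1)^{m+p}\sum_{j_1+j_2+j_3=q+2,\; j_1,j_2,j_3\geq 1} \binom{m+j_1-2}{m-1}\binom{p+j_2-2}{p-1}\zeta(m+j_1-1;\sigma_1)\zeta(p+j_2-1;\sigma_2)\, \delta_{\tau}^{j_3-1}\,\tilde t(j_3;\tau), \end{align*} with $\zeta(1;1):=0$ and $\tilde t(1;1):=2\ln2$ wherever they occur.
   Context: For $\sigma\in\{\pm1\}$, integers $n\ge0$, $r\ge1$: $h_n^{(r)}(\sigma)=\sum_{k=1}^n\frac{\sigma^{k-1}}{(k-1/2)^r}$ and $H_n^{(r)}(\sigma)=\sum_{k=1}^n\frac{\sigma^{k-1}}{k^r}$. Linear sums: $T_{p,q}^{\sigma_1,\sigma_2}=\sum_{n\ge1}\sigma_2^{n-1}\frac{h_{n-1}^{(p)}(\sigma_1)}{(n-1/2)^q}$ and $S_{p,q}^{\sigma_1,\sigma_2}=\sum_{n\ge1}\sigma_2^{n-1}\frac{H_n^{(p)}(\sigma_1)}{n^q}$, for $(q,\sigma_2)\ne(1,1)$. For $(s,\sigma)\ne(1,1)$: $\zeta(s;\sigma)=\sum_{n\ge1}\frac{\sigma^n}{n^s}$, $\tilde t(s;\sigma)=\sum_{n\ge1}\frac{\sigma^n}{(n-1/2)^s}$. Also $\delta_\sigma^k=1-\sigma(-1)^k$. *)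

theory Defs
  imports "HOL-Analysis.Analysis"
begin

text \<open>
  Signs are real numbers, restricted to \<open>{1, -1}\<close> in the theorem. The series may converge only
  conditionally, so they are the ordered sums \<^const>\<open>suminf\<close>; these are indexed from \<open>0\<close>, so \<open>n\<close>
  below is the usual summation index minus one.
\<close>

definition h_num :: "nat \<Rightarrow> real \<Rightarrow> nat \<Rightarrow> real" where
  "h_num r \<sigma> n = (\<Sum>k=1..n. \<sigma> ^ (k - 1) / (real k - 1/2) ^ r)"

definition H_num :: "nat \<Rightarrow> real \<Rightarrow> nat \<Rightarrow> real" where
  "H_num r \<sigma> n = (\<Sum>k=1..n. \<sigma> ^ (k - 1) / real k ^ r)"

definition T_lin :: "nat \<Rightarrow> nat \<Rightarrow> real \<Rightarrow> real \<Rightarrow> real" where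
  "T_lin p q \<sigma>\<^sub>1 \<sigma>\<^sub>2 = (\<Sum>n. \<sigma>\<^sub>2 ^ n * h_num p \<sigma>\<^sub>1 n / (real (Suc n) - 1/2) ^ q)"

definition S_lin :: "nat \<Rightarrow> nat \<Rightarrow> real \<Rightarrow> real \<Rightarrow> real" where
  "S_lin p q \<sigma>\<^sub>1 \<sigma>\<^sub>2 = (\<Sum>n. \<sigma>\<^sub>2 ^ n * H_num p \<sigma>\<^sub>1 (Suc n) / real (Suc n) ^ q)"

definition T_quad :: "nat \<Rightarrow> nat \<Rightarrow> nat \<Rightarrow> real \<Rightarrow> real \<Rightarrow> real \<Rightarrow> real" where
  "T_quad m p q \<sigma>\<^sub>1 \<sigma>\<^sub>2 \<sigma>\<^sub>3 =
     (\<Sum>n. \<sigma>\<^sub>3 ^ n * (h_num m \<sigma>\<^sub>1 n * h_num p \<sigma>\<^sub>2 n) / (real (Suc n) - 1/2) ^ q)"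

text \<open>
  The divergent case \<open>(s, \<sigma>) = (1, 1)\<close> takes the conventional values \<open>\<zeta>(1;1) = 0\<close> and
  \<open>t(1;1) = 2 ln 2\<close>.
\<close>

definition zeta_sgn :: "nat \<Rightarrow> real \<Rightarrow> real" where
  "zeta_sgn s \<sigma> = (if s = 1 \<and> \<sigma> = 1 then 0
     else (\<Sum>n. \<sigma> ^ Suc n / real (Suc n) ^ s))"

definition t_sgn :: "nat \<Rightarrow> real \<Rightarrow> real" where
  "t_sgn s \<sigma> = (if s = 1 \<and> \<sigma> = 1 then 2 * ln 2
     else (\<Sum>n. \<sigma> ^ Suc n / (real (Suc n) - 1/2) ^ s))"

definition delta :: "real \<Rightarrow> nat \<Rightarrow> real" where
  "delta \<sigma> k = 1 - \<sigma> * (-1) ^ k"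

definition G1 :: "nat \<Rightarrow> nat \<Rightarrow> nat \<Rightarrow> real \<Rightarrow> real \<Rightarrow> real \<Rightarrow> real" where
  "G1 m p q \<sigma>\<^sub>1 \<sigma>\<^sub>2 \<sigma>\<^sub>3 = (let \<tau> = \<sigma>\<^sub>1 * \<sigma>\<^sub>2 * \<sigma>\<^sub>3 in
     - \<tau> * ((-1) ^ m * delta (\<sigma>\<^sub>2 * \<sigma>\<^sub>3) (p + q) * t_sgn m \<sigma>\<^sub>1 * T_lin p q \<sigma>\<^sub>2 \<sigma>\<^sub>3
          + (-1) ^ p * delta (\<sigma>\<^sub>1 * \<sigma>\<^sub>3) (m + q) * t_sgn p \<sigma>\<^sub>2 * T_lin m q \<sigma>\<^sub>1 \<sigma>\<^sub>3
          + T_lin m (p + q) \<sigma>\<^sub>1 (\<sigma>\<^sub>2 * \<sigma>\<^sub>3)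
          + T_lin p (m + q) \<sigma>\<^sub>2 (\<sigma>\<^sub>1 * \<sigma>\<^sub>3)))"

definition G2 :: "nat \<Rightarrow> nat \<Rightarrow> nat \<Rightarrow> real \<Rightarrow> real \<Rightarrow> real \<Rightarrow> real" where
  "G2 m p q \<sigma>\<^sub>1 \<sigma>\<^sub>2 \<sigma>\<^sub>3 = (let \<tau> = \<sigma>\<^sub>1 * \<sigma>\<^sub>2 * \<sigma>\<^sub>3 in
     - \<sigma>\<^sub>1 * (-1) ^ m * t_sgn m \<sigma>\<^sub>1 * t_sgn (p + q) (\<sigma>\<^sub>2 * \<sigma>\<^sub>3)
     - \<sigma>\<^sub>2 * (-1) ^ p * t_sgn p \<sigma>\<^sub>2 * t_sgn (m + q) (\<sigma>\<^sub>1 * \<sigma>\<^sub>3)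
     - \<sigma>\<^sub>1 * \<sigma>\<^sub>2 * (-1) ^ (m + p) * delta \<sigma>\<^sub>3 (q - 1) * t_sgn m \<sigma>\<^sub>1 * t_sgn p \<sigma>\<^sub>2 * t_sgn q \<sigma>\<^sub>3
     + \<tau> * (-1) ^ (m + p + q) * t_sgn (m + p + q) \<tau>)"

definition G3 :: "nat \<Rightarrow> nat \<Rightarrow> nat \<Rightarrow> real \<Rightarrow> real \<Rightarrow> real \<Rightarrow> real" where
  "G3 m p q \<sigma>\<^sub>1 \<sigma>\<^sub>2 \<sigma>\<^sub>3 = (let \<tau> = \<sigma>\<^sub>1 * \<sigma>\<^sub>2 * \<sigma>\<^sub>3 in
     \<tau> * (-1) ^ (m + p) *
       (\<Sum>k=0..m + p - 1. real ((m + p + q - k - 2) choose (q - 1)) *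
          delta \<tau> k * t_sgn (k + 1) \<tau> * zeta_sgn (m + p + q - k - 1) \<sigma>\<^sub>3))"

definition G4 :: "nat \<Rightarrow> nat \<Rightarrow> nat \<Rightarrow> real \<Rightarrow> real \<Rightarrow> real \<Rightarrow> real" where
  "G4 m p q \<sigma>\<^sub>1 \<sigma>\<^sub>2 \<sigma>\<^sub>3 = (let \<tau> = \<sigma>\<^sub>1 * \<sigma>\<^sub>2 * \<sigma>\<^sub>3 in
     (-1) ^ m *
       (\<Sum>j=1..m. \<Sum>k=0..m - j.
          real ((p + j - 2) choose (p - 1)) * real ((m + q - j - k - 1) choose (q - 1)) *
          delta \<tau> k * t_sgn (k + 1) \<tau> *
          (\<sigma>\<^sub>1 * S_lin (p + j - 1) (m + q - j - k) \<sigma>\<^sub>2 \<sigma>\<^sub>3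
           - \<tau> * (-1) ^ (p + j) * zeta_sgn (p + j - 1) \<sigma>\<^sub>2 * zeta_sgn (m + q - j - k) \<sigma>\<^sub>3))
     + (-1) ^ p *
       (\<Sum>j=1..p. \<Sum>k=0..p - j.
          real ((m + j - 2) choose (m - 1)) * real ((p + q - j - k - 1) choose (q - 1)) *
          delta \<tau> k * t_sgn (k + 1) \<tau> *
          (\<sigma>\<^sub>2 * S_lin (m + j - 1) (p + q - j - k) \<sigma>\<^sub>1 \<sigma>\<^sub>3
           - \<tau> * (-1) ^ (m + j) * zeta_sgn (m + j - 1) \<sigma>\<^sub>1 * zeta_sgn (p + q - j - k) \<sigma>\<^sub>3)))"

definition G5 :: "nat \<Rightarrow> nat \<Rightarrow> nat \<Rightarrow> real \<Rightarrow> real \<Rightarrow> real \<Rightarrow> real" where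
  "G5 m p q \<sigma>\<^sub>1 \<sigma>\<^sub>2 \<sigma>\<^sub>3 = (let \<tau> = \<sigma>\<^sub>1 * \<sigma>\<^sub>2 * \<sigma>\<^sub>3 in
     (-1) ^ m *
       (\<Sum>j=1..p + q. real ((m + j - 2) choose (m - 1)) *
          delta \<tau> (p + q - j) * t_sgn (p + q - j + 1) \<tau> * zeta_sgn (m + j - 1) \<sigma>\<^sub>1)
     + (-1) ^ p *
       (\<Sum>j=1..m + q. real ((p + j - 2) choose (p - 1)) *
          delta \<tau> (m + q - j) * t_sgn (m + q - j + 1) \<tau> * zeta_sgn (p + j - 1) \<sigma>\<^sub>2))"

definition G6 :: "nat \<Rightarrow> nat \<Rightarrow> nat \<Rightarrow> real \<Rightarrow> real \<Rightarrow> real \<Rightarrow> real" where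
  "G6 m p q \<sigma>\<^sub>1 \<sigma>\<^sub>2 \<sigma>\<^sub>3 = (let \<tau> = \<sigma>\<^sub>1 * \<sigma>\<^sub>2 * \<sigma>\<^sub>3 in
     (-1) ^ (m + p) *
       (\<Sum>(j\<^sub>1, j\<^sub>2, j\<^sub>3) \<in> {(j\<^sub>1, j\<^sub>2, j\<^sub>3). j\<^sub>1 + j\<^sub>2 + j\<^sub>3 = q + 2 \<and> j\<^sub>1 \<ge> 1 \<and> j\<^sub>2 \<ge> 1 \<and> j\<^sub>3 \<ge> 1}.
          real ((m + j\<^sub>1 - 2) choose (m - 1)) * real ((p + j\<^sub>2 - 2) choose (p - 1)) *
          zeta_sgn (m + j\<^sub>1 - 1) \<sigma>\<^sub>1 * zeta_sgn (p + j\<^sub>2 - 1) \<sigma>\<^sub>2 *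
          delta \<tau> (j\<^sub>3 - 1) * t_sgn j\<^sub>3 \<tau>))"

end

theory Submission
  imports Defs "HOL-Complex_Analysis.Complex_Analysis"
begin

text \<open>
  The identity is the vanishing of the sum of all residues of \<open>K(s) A(s) B(s) / s\<^sup>q\<close>, where \<open>K\<close> has simple
  poles at the half-integers and \<open>A(s) = \<Sum>k\<ge>0. \<sigma>\<^sub>1\<^sup>k / (k - s)\<^sup>m\<close>, \<open>B(s) = \<Sum>k\<ge>0. \<sigma>\<^sub>2\<^sup>k / (k - s)\<^sup>p\<close> have
  poles at the natural numbers. At \<open>\<plusminus>(n - 1/2)\<close> the values of \<open>A\<close> and \<open>B\<close> are combinations of \<open>t(m;\<sigma>\<^sub>1)\<close>,
  \<open>h\<^sub>n\<close> and \<open>t(p;\<sigma>\<^sub>2)\<close>, \<open>h\<^sub>n\<close>, which produces the \<open>T\<close>-sums; the residues at \<open>n \<ge> 1\<close> produce \<open>G3\<close> and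
  \<open>G4\<close>, the residue at \<open>0\<close> produces \<open>G5\<close>, \<open>G6\<close> and a part of \<open>G2\<close>.

  Contour estimates for infinitely many poles are avoided: for \<open>A\<close> and \<open>B\<close> truncated and \<open>K\<close> replaced by
  \<open>1 / (a - s)\<close>, the function is rational and the residues sum to zero. The truncation of \<open>A\<close> and \<open>B\<close> is
  removed by dominated convergence. Then one sums over the half-integers \<open>a\<close> with \<open>|a| < N\<close> and lets
  \<open>N\<close> tend to infinity, where summation by parts copes with the conditionally convergent case \<open>q = 1\<close>.
\<close>

section \<open>Residues of truncated pole sums\<close>

text \<open>Put \<open>\<tau> = \<sigma>\<^sub>1 * \<sigma>\<^sub>2 * \<sigma>\<^sub>3\<close>. At
  \<open>j + 1/2\<close> and \<open>- (j + 1/2)\<close> the values of \<open>A\<close> and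
  \<open>B\<close> bring in \<open>(\<sigma>\<^sub>1 * \<sigma>\<^sub>2) ^ j\<close>, so the
  residues of \<open>K\<close> must have the signs \<open>\<tau> ^ j\<close>, up to constants, to
  leave \<open>\<sigma>\<^sub>3 ^ j\<close>. Such a kernel satisfies
  \<open>K (s + 1) = \<tau> * K s\<close>. Its Taylor coefficients at every integer are therefore,
  up to sign, those at \<open>0\<close>, namely
  \<open>delta \<tau> k * t_sgn (k + 1) \<tau>\<close>; hence these factors in all residues.

  The residue identity is linear in the kernel, so it is proved for a single pole \<open>a\<close>
  and then added up. For one pole all series converge absolutely, because \<open>1 / (a - n)\<close>
  supplies a further power of decay. But once \<open>\<tau> ^ n\<close> is removed, their increments
  are of order \<open>1 / \<bar>N - 1/2 - n\<bar>\<close>, and series whose tails decay like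
  \<open>1 / sqrt n\<close> can be paired with these. The square root stands in for every logarithm,
  so that one scale serves all growth and tail estimates.\<close>

definition harm_corr :: "nat \<Rightarrow> real \<Rightarrow> nat \<Rightarrow> real" where
  "harm_corr r \<sigma> M = (if r = 1 \<and> \<sigma> = 1 then harm M else 0)"

text \<open>
  Subtracting the harmonic number makes the divergent case \<open>(m, \<sigma>) = (1, 1)\<close> converge, and is the source
  of the conventions \<open>\<zeta>(1;1) = 0\<close> and \<open>t(1;1) = 2 ln 2\<close>.
\<close>

definition pole_sum :: "nat \<Rightarrow> real \<Rightarrow> nat \<Rightarrow> 'a \<Rightarrow> 'a::real_normed_field" where
  "pole_sum m \<sigma> M s = (\<Sum>k\<le>M. of_real (\<sigma> ^ k) / (of_nat k - s) ^ m) - of_real (harm_corr m \<sigma> M)"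

definition reg_sum :: "nat \<Rightarrow> real \<Rightarrow> nat \<Rightarrow> nat \<Rightarrow> real" where
  "reg_sum r \<sigma> M n = (\<Sum>k\<in>{..M} - {n}. \<sigma> ^ k / (real k - real n) ^ r) - harm_corr r \<sigma> M"

definition conv2 :: "(nat \<Rightarrow> 'a::comm_ring_1) \<Rightarrow> (nat \<Rightarrow> 'a) \<Rightarrow> nat \<Rightarrow> 'a" where
  "conv2 f g d = (\<Sum>k=0..d. f k * g (d - k))"

definition conv3 :: "(nat \<Rightarrow> 'a::comm_ring_1) \<Rightarrow> (nat \<Rightarrow> 'a) \<Rightarrow> (nat \<Rightarrow> 'a) \<Rightarrow> nat \<Rightarrow> 'a" where
  "conv3 f g h d = (\<Sum>i=0..d. f i * conv2 g h (d - i))"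

text \<open>Expanding \<open>1 / (k - n - x) ^ m\<close> raises the exponent, so the coefficients of
  the regular part at \<open>n\<close> are again values of \<open>reg_sum\<close>. The harmonic
  correction is a constant and belongs to \<open>i = 0\<close> alone; for \<open>m \<ge> 1\<close>
  this is automatic, since \<open>m + i = 1\<close> forces \<open>i = 0\<close>.\<close>

definition taylor_reg :: "nat \<Rightarrow> real \<Rightarrow> nat \<Rightarrow> nat \<Rightarrow> nat \<Rightarrow> real" where
  "taylor_reg m \<sigma> M n i = real ((m + i - 1) choose i) * reg_sum (m + i) \<sigma> M n"

definition taylor_pow :: "nat \<Rightarrow> nat \<Rightarrow> nat \<Rightarrow> real" where
  "taylor_pow q n l = (-1) ^ l * real ((q + l - 1) choose l) / real n ^ (q + l)"

definition taylor_pole :: "real \<Rightarrow> nat \<Rightarrow> nat \<Rightarrow> real" where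
  "taylor_pole a n k = 1 / (a - real n) ^ (k + 1)"

text \<open>
  The residue at \<open>n\<close> of \<open>A(s) B(s) s\<^sup>-\<^sup>q / (a - s)\<close>, where \<open>A\<close> and \<open>B\<close> are two pole sums; the summands
  correspond to the choice, for each of \<open>A\<close> and \<open>B\<close>, of the polar part or the regular part at \<open>n\<close>.
\<close>

definition residue_at :: "nat \<Rightarrow> nat \<Rightarrow> nat \<Rightarrow> real \<Rightarrow> real \<Rightarrow> real \<Rightarrow> nat \<Rightarrow> nat \<Rightarrow> real" where
  "residue_at m p q \<sigma>\<^sub>1 \<sigma>\<^sub>2 a M n =
    (let A = taylor_reg m \<sigma>\<^sub>1 M n; B = taylor_reg p \<sigma>\<^sub>2 M n; E = taylor_pole a n; S = taylor_pow q n in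
     if n = 0
     then (-1) ^ (m + p) * E (m + p + q - 1) + (-1) ^ m * conv2 B E (m + q - 1)
          + (-1) ^ p * conv2 A E (p + q - 1) + conv3 A B E (q - 1)
     else (\<sigma>\<^sub>1 * \<sigma>\<^sub>2) ^ n * (-1) ^ (m + p) * conv2 E S (m + p - 1)
          + \<sigma>\<^sub>1 ^ n * (-1) ^ m * conv3 B E S (m - 1) + \<sigma>\<^sub>2 ^ n * (-1) ^ p * conv3 A E S (p - 1))"

section \<open>Local expansions as power series\<close>

lemma fps_nth_Abs_fps_ext: "fps_nth (Abs_fps f) = f"
  by (simp add: fun_eq_iff)

lemma fps_mult_nth_conv2: "fps_nth (F * G) d = conv2 (fps_nth F) (fps_nth G) d"
  by (simp add: fps_mult_nth conv2_def)

lemma conv2_fps_mult: "conv2 f (fps_nth (G * H)) = conv3 f (fps_nth G) (fps_nth H)"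
  by (simp add: fun_eq_iff fps_mult_nth conv2_def conv3_def)

lemma conv2_of_real: "conv2 (\<lambda>k. of_real (f k)) (\<lambda>k. of_real (g k)) d = (of_real (conv2 f g d) :: complex)"
  by (simp add: conv2_def)

lemma conv3_of_real:
  "conv3 (\<lambda>k. of_real (f k)) (\<lambda>k. of_real (g k)) (\<lambda>k. of_real (h k)) d = (of_real (conv3 f g h d) :: complex)"
  by (simp add: conv3_def conv2_of_real)

text \<open>The negative binomial series of \<open>1 / (c - x) ^ r\<close>. For \<open>r = 0\<close>
  truncated subtraction leaves exactly the constant series \<open>1\<close>, which starts the
  induction on \<open>r\<close>; its step is Pascal's rule.\<close>

definition pow_fps :: "nat \<Rightarrow> 'a::field \<Rightarrow> 'a fps" where
  "pow_fps r c = Abs_fps (\<lambda>k. of_nat ((r + k - 1) choose k) / c ^ (r + k))"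

lemma pow_fps_Suc:
  fixes c :: "'a::field_char_0"
  assumes "c \<noteq> 0"
  shows "(fps_const c - fps_X) * pow_fps (Suc r) c = pow_fps r c"
proof (rule fps_ext)
  fix k
  show "fps_nth ((fps_const c - fps_X) * pow_fps (Suc r) c) k = fps_nth (pow_fps r c) k"
  proof (cases k)
    case 0
    then show ?thesis using assms by (simp add: pow_fps_def ring_distribs)
  next
    case (Suc l)
    have "(r + Suc l) choose Suc l = ((r + l) choose Suc l) + ((r + l) choose l)"
      by simp
    then have "(of_nat ((r + Suc l) choose Suc l) :: 'a)
        = of_nat ((r + l) choose Suc l) + of_nat ((r + l) choose l)"
      by (metis of_nat_add)
    then show ?thesis
      using assms by (simp add: pow_fps_def Suc field_simps del: binomial_Suc_Suc)
  qed
qed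

lemma power_times_pow_fps:
  fixes c :: "'a::field_char_0"
  assumes "c \<noteq> 0"
  shows "(fps_const c - fps_X) ^ r * pow_fps r c = 1"
proof (induction r)
  case 0
  show ?case
    by (rule fps_ext) (auto simp: pow_fps_def binomial_eq_0)
next
  case (Suc r)
  have "(fps_const c - fps_X) ^ Suc r * pow_fps (Suc r) c
      = (fps_const c - fps_X) ^ r * ((fps_const c - fps_X) * pow_fps (Suc r) c)"
    by (simp add: algebra_simps)
  then show ?case using Suc pow_fps_Suc[OF assms] by simp
qed

lemma has_fps_expansion_inverse_power_diff:
  fixes c :: complex
  assumes "c \<noteq> 0"
  shows "(\<lambda>x. 1 / (c - x) ^ r) has_fps_expansion pow_fps r c"
proof -
  have nz: "fps_nth ((fps_const c - fps_X) ^ r) 0 \<noteq> 0"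
    using assms by (simp add: fps_nth_power_0)
  have "(\<lambda>x. inverse ((c - x) ^ r)) has_fps_expansion inverse ((fps_const c - fps_X) ^ r)"
    by (intro fps_expansion_intros nz)
  moreover have "inverse ((fps_const c - fps_X) ^ r) = pow_fps r c"
    using power_times_pow_fps[OF assms, of r] nz by (metis fps_inverse_unique)
  ultimately show ?thesis by (simp add: inverse_eq_divide)
qed

lemma fls_nth_X_inv_power_times_fps:
  "fls_nth (fls_X_inv ^ r * fps_to_fls G) (-1) = (if r = 0 then 0 else fps_nth G (r - 1))"
  by (cases r) (simp_all add: fls_X_inv_power_times_conv_shift del: power_Suc)

text \<open>Residue theorem on a circle of radius \<open>R\<close> around all poles: there
  \<open>norm (f x)\<close> is at most \<open>e / R\<close>, so the integral is at most
  \<open>2 * pi * e\<close>, for every \<open>e > 0\<close>.\<close>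

lemma sum_residues_eq_0:
  fixes f :: "complex \<Rightarrow> complex"
  assumes "finite S" and hol: "f holomorphic_on (UNIV - S)"
    and lim: "((\<lambda>z. z * f z) \<longlongrightarrow> 0) at_infinity"
  shows "(\<Sum>z\<in>S. residue f z) = 0"
proof -
  obtain B where B: "\<And>z. z \<in> S \<Longrightarrow> norm z \<le> B"
    using finite_imp_bounded[OF \<open>finite S\<close>] by (auto simp: bounded_iff)
  have "norm (\<Sum>z\<in>S. residue f z) \<le> e" if "e > 0" for e
  proof -
    have "\<exists>b. \<forall>z. norm z \<ge> b \<longrightarrow> norm (z * f z) < e"
      using lim that by (simp add: Lim_at_infinity)
    then obtain b where b: "\<And>z. norm z \<ge> b \<Longrightarrow> norm (z * f z) < e"
      by blast
    define R where "R = max (max B b) 0 + 1"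
    have R: "R > 0" "R > B" "R \<ge> b" by (auto simp: R_def)
    have sph: "sphere 0 R \<inter> S = {}"
      using B R by fastforce
    have ci: "contour_integral (circlepath 0 R) f
        = 2 * pi * \<i> * (\<Sum>z\<in>S. winding_number (circlepath 0 R) z * residue f z)"
      by (rule Residue_theorem) (use assms R sph in auto)
    also have "(\<Sum>z\<in>S. winding_number (circlepath 0 R) z * residue f z) = (\<Sum>z\<in>S. residue f z)"
    proof (rule sum.cong)
      fix z assume "z \<in> S"
      then have "norm z < R" using B R by fastforce
      then show "winding_number (circlepath 0 R) z * residue f z = residue f z"
        by (simp add: winding_number_circlepath)
    qed simp
    finally have ci: "contour_integral (circlepath 0 R) f = 2 * pi * \<i> * (\<Sum>z\<in>S. residue f z)" .
    have "f contour_integrable_on (circlepath 0 R)"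
      by (intro contour_integrable_continuous_circlepath
          holomorphic_on_imp_continuous_on[OF holomorphic_on_subset[OF hol]])
        (use sph R in auto)
    then have "(f has_contour_integral (2 * pi * \<i> * (\<Sum>z\<in>S. residue f z))) (circlepath 0 R)"
      using ci has_contour_integral_integral by metis
    then have "norm (2 * pi * \<i> * (\<Sum>z\<in>S. residue f z)) \<le> (e / R) * (2 * pi * R)"
    proof (rule has_contour_integral_bound_circlepath)
      fix x :: complex assume "norm (x - 0) = R"
      then show "norm (f x) \<le> e / R"
        using b[of x] R by (simp add: norm_mult field_simps)
    qed (use that R in auto)
    then show ?thesis
      using R by (simp add: norm_mult)
  qed
  then have "norm (\<Sum>z\<in>S. residue f z) \<le> 0"
    by (metis field_le_epsilon add_0)
  then show ?thesis by simp
qed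

text \<open>Only the summand \<open>k = n\<close> is singular at \<open>n\<close>; its base is
  \<open>- x\<close>, whence the sign \<open>(-1) ^ m\<close>. The other summands and the harmonic
  correction form the power series.\<close>

lemma pole_sum_laurent:
  assumes "n \<le> M" "m \<ge> 1"
  shows "(\<lambda>x. pole_sum m \<sigma> M (of_nat n + x :: complex)) has_laurent_expansion
    fls_const (of_real (\<sigma> ^ n * (-1) ^ m)) * fls_X_inv ^ m
      + fps_to_fls (Abs_fps (\<lambda>i. of_real (taylor_reg m \<sigma> M n i)))"
proof -
  define F where "F = (\<Sum>k\<in>{..M} - {n}. fps_const (of_real (\<sigma> ^ k)) * pow_fps m (of_nat k - of_nat n))
    - fps_const (of_real (harm_corr m \<sigma> M) :: complex)"
  have F: "(\<lambda>x. (\<Sum>k\<in>{..M} - {n}. of_real (\<sigma> ^ k) * (1 / ((of_nat k - of_nat n) - x) ^ m))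
      - of_real (harm_corr m \<sigma> M)) has_fps_expansion F"
    unfolding F_def
    by (intro fps_expansion_intros has_fps_expansion_inverse_power_diff) auto
  have "F = Abs_fps (\<lambda>i. of_real (taylor_reg m \<sigma> M n i))"
  proof (rule fps_ext)
    fix i
    show "fps_nth F i = fps_nth (Abs_fps (\<lambda>i. of_real (taylor_reg m \<sigma> M n i))) i"
      using \<open>m \<ge> 1\<close>
      by (cases i) (simp_all add: F_def fps_sum_nth pow_fps_def taylor_reg_def reg_sum_def
          harm_corr_def right_diff_distrib sum_distrib_left mult.commute)
  qed
  moreover have "(\<lambda>x. of_real (\<sigma> ^ n * (-1) ^ m) * inverse x ^ m
      + ((\<Sum>k\<in>{..M} - {n}. of_real (\<sigma> ^ k) * (1 / ((of_nat k - of_nat n) - x) ^ m))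
      - of_real (harm_corr m \<sigma> M))) has_laurent_expansion
      fls_const (of_real (\<sigma> ^ n * (-1) ^ m)) * fls_X_inv ^ m + fps_to_fls F"
    by (intro laurent_expansion_intros has_laurent_expansion_fps F)
  moreover have "pole_sum m \<sigma> M (of_nat n + x) = of_real (\<sigma> ^ n * (-1) ^ m) * inverse x ^ m
      + ((\<Sum>k\<in>{..M} - {n}. of_real (\<sigma> ^ k) * (1 / ((of_nat k - of_nat n) - x) ^ m))
      - of_real (harm_corr m \<sigma> M))" for x :: complex
  proof -
    have "(\<Sum>k\<le>M. of_real (\<sigma> ^ k) / (of_nat k - (of_nat n + x)) ^ m)
      = of_real (\<sigma> ^ n) / (- x) ^ m + (\<Sum>k\<in>{..M} - {n}. of_real (\<sigma> ^ k) / (of_nat k - (of_nat n + x)) ^ m)"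
      using assms by (subst sum.remove[of _ n]) auto
    moreover have "of_real (\<sigma> ^ n) / (- x) ^ m = of_real (\<sigma> ^ n * (-1) ^ m) * inverse x ^ m"
      by (cases "even m") (simp_all add: power_inverse divide_inverse)
    ultimately show ?thesis
      by (simp add: pole_sum_def diff_diff_eq)
  qed
  ultimately show ?thesis by simp
qed

text \<open>Each of the two pole sums is a polar plus a regular part, which gives four products. At
  \<open>n = 0\<close> the factor \<open>1 / s ^ q\<close> raises every pole order by
  \<open>q\<close>, so all four contribute. At \<open>n \<ge> 1\<close> it is regular with
  coefficients \<open>taylor_pow\<close>, and the product of the two regular parts has no
  residue.\<close>

lemma residue_at_nat:
  assumes "n \<le> M" "m \<ge> 1" "p \<ge> 1" "q \<ge> 1" "a \<noteq> real n"
  shows "residue (\<lambda>s. pole_sum m \<sigma>\<^sub>1 M s * pole_sum p \<sigma>\<^sub>2 M s * (1 / s ^ q) * (1 / (of_real a - s)))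
           (of_nat n) = of_real (residue_at m p q \<sigma>\<^sub>1 \<sigma>\<^sub>2 a M n)"
proof -
  define FA FB FE FS where "FA = Abs_fps (\<lambda>i. complex_of_real (taylor_reg m \<sigma>\<^sub>1 M n i))"
    and "FB = Abs_fps (\<lambda>i. complex_of_real (taylor_reg p \<sigma>\<^sub>2 M n i))"
    and "FE = Abs_fps (\<lambda>i. complex_of_real (taylor_pole a n i))"
    and "FS = Abs_fps (\<lambda>i. complex_of_real (taylor_pow q n i))"
  let ?\<alpha> = "fls_const (complex_of_real (\<sigma>\<^sub>1 ^ n * (-1) ^ m))"
  let ?\<beta> = "fls_const (complex_of_real (\<sigma>\<^sub>2 ^ n * (-1) ^ p))"
  have E: "(\<lambda>x. 1 / (complex_of_real a - (of_nat n + x))) has_laurent_expansion fps_to_fls FE"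
  proof -
    have "pow_fps 1 (complex_of_real a - of_nat n) = FE"
      by (rule fps_ext) (simp add: pow_fps_def FE_def taylor_pole_def)
    moreover have "complex_of_real a - of_nat n \<noteq> 0"
      using assms by (metis eq_iff_diff_eq_0 of_real_eq_iff of_real_of_nat_eq)
    ultimately show ?thesis
      using has_laurent_expansion_fps[OF has_fps_expansion_inverse_power_diff,
          of "complex_of_real a - of_nat n" 1]
      by (simp add: diff_diff_eq)
  qed
  have AB: "(\<lambda>x. pole_sum m \<sigma>\<^sub>1 M (of_nat n + x) * pole_sum p \<sigma>\<^sub>2 M (of_nat n + x)) has_laurent_expansion
     (?\<alpha> * fls_X_inv ^ m + fps_to_fls FA) * (?\<beta> * fls_X_inv ^ p + fps_to_fls FB)"
    unfolding FA_def FB_def using assms by (intro laurent_expansion_intros pole_sum_laurent)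
  have split: "(\<alpha> * x + A) * (\<beta> * y + B) * S * E =
     \<alpha> * \<beta> * (x * y * S * E) + \<alpha> * (x * S * (B * E)) + \<beta> * (y * S * (A * E)) + S * (A * (B * E))"
    for \<alpha> \<beta> x y A B S E :: "complex fls"
    by (simp add: algebra_simps)
  show ?thesis
  proof (cases "n = 0")
    case True
    have "(\<lambda>x. 1 / (of_nat n + x) ^ q) has_laurent_expansion fls_X_inv ^ q"
      using has_laurent_expansion_power[OF has_laurent_expansion_fls_X_inv, of q] True
      by (simp add: inverse_eq_divide power_one_over)
    from has_laurent_expansion_residue[OF has_laurent_expansion_mult[OF has_laurent_expansion_mult[OF AB this] E]]
    have "residue (\<lambda>s. pole_sum m \<sigma>\<^sub>1 M s * pole_sum p \<sigma>\<^sub>2 M s * (1 / s ^ q) * (1 / (of_real a - s)))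
           (of_nat n) =
        fls_nth (?\<alpha> * ?\<beta> * (fls_X_inv ^ (m + p + q) * fps_to_fls FE)
          + ?\<alpha> * (fls_X_inv ^ (m + q) * fps_to_fls (FB * FE))
          + ?\<beta> * (fls_X_inv ^ (p + q) * fps_to_fls (FA * FE))
          + fls_X_inv ^ q * fps_to_fls (FA * (FB * FE))) (-1)"
      by (simp add: split power_add fls_times_fps_to_fls)
    also have "\<dots> = of_real (residue_at m p q \<sigma>\<^sub>1 \<sigma>\<^sub>2 a M n)"
      using assms True unfolding fls_const_mult_const[symmetric] mult.assoc
      by (simp add: fls_nth_X_inv_power_times_fps fls_const_mult_const conv2_fps_mult FA_def FB_def FE_def
          residue_at_def Let_def conv3_of_real fps_mult_nth_conv2 conv2_of_real power_add[of "-1"] fps_nth_Abs_fps_ext)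
    finally show ?thesis .
  next
    case False
    have "(\<lambda>x. 1 / (of_nat n + x) ^ q) has_laurent_expansion fps_to_fls FS"
    proof -
      \<comment> \<open>Change of sign to reach the form \<open>1 / (c - x) ^ q\<close> with
        \<open>c = - n\<close>.\<close>
      have "fps_const ((-1) ^ q) * pow_fps q (- of_nat n) = FS"
        by (rule fps_ext) (simp add: pow_fps_def FS_def taylor_pow_def uminus_power_if)
      moreover have "(\<lambda>x. (-1) ^ q * (1 / (- of_nat n - x) ^ q)) has_fps_expansion
          fps_const ((-1) ^ q) * pow_fps q (- of_nat n :: complex)"
        using False by (intro fps_expansion_intros has_fps_expansion_inverse_power_diff) auto
      moreover have "(-1) ^ q * (1 / (- of_nat n - x) ^ q) = 1 / (of_nat n + x :: complex) ^ q" for x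
      proof -
        have "- of_nat n - x = - (of_nat n + x)" by simp
        then show ?thesis by (simp only: power_minus[of "of_nat n + x" q]) simp
      qed
      ultimately show ?thesis
        by (simp add: has_laurent_expansion_fps)
    qed
    from has_laurent_expansion_residue[OF has_laurent_expansion_mult[OF has_laurent_expansion_mult[OF AB this] E]]
    have "residue (\<lambda>s. pole_sum m \<sigma>\<^sub>1 M s * pole_sum p \<sigma>\<^sub>2 M s * (1 / s ^ q) * (1 / (of_real a - s)))
           (of_nat n) =
        fls_nth (?\<alpha> * ?\<beta> * (fls_X_inv ^ (m + p) * fps_to_fls (FE * FS))
          + ?\<alpha> * (fls_X_inv ^ m * fps_to_fls (FB * (FE * FS)))
          + ?\<beta> * (fls_X_inv ^ p * fps_to_fls (FA * (FE * FS)))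
          + fls_X_inv ^ 0 * fps_to_fls (FS * (FA * (FB * FE)))) (-1)"
      unfolding split power_add fls_times_fps_to_fls power_0 fls_residue_def
      by (simp only: mult_ac mult_1_left)
    also have "\<dots> = of_real (residue_at m p q \<sigma>\<^sub>1 \<sigma>\<^sub>2 a M n)"
      using assms False unfolding fls_const_mult_const[symmetric] mult.assoc
      by (simp add: fls_nth_X_inv_power_times_fps fls_const_mult_const conv2_fps_mult FA_def FB_def FE_def FS_def
          residue_at_def Let_def conv3_of_real fps_mult_nth_conv2 conv2_of_real power_add[of "-1"] fps_nth_Abs_fps_ext
          power_mult_distrib)
    finally show ?thesis .
  qed
qed

section \<open>Behaviour at infinity and the vanishing sum of residues\<close>

lemma tendsto_inverse_power_diff_at_infinity:
  fixes c :: complex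
  assumes "m \<ge> 1"
  shows "((\<lambda>s. 1 / (c - s) ^ m) \<longlongrightarrow> 0) at_infinity"
proof -
  have "filterlim (\<lambda>s. c + - s) at_infinity at_infinity"
    by (intro tendsto_add_filterlim_at_infinity[OF tendsto_const])
      (simp add: filterlim_at_infinity_conv_norm_at_top filterlim_norm_at_top)
  then have "((\<lambda>s. inverse (c - s)) \<longlongrightarrow> 0) at_infinity"
    by (simp add: filterlim_compose[OF tendsto_inverse_0])
  from tendsto_power[OF this, of m] show ?thesis
    using assms by (simp add: inverse_eq_divide power_one_over power_0_left)
qed

lemma pole_sum_tendsto_at_infinity:
  assumes "m \<ge> 1"
  shows "((pole_sum m \<sigma> M :: complex \<Rightarrow> complex) \<longlongrightarrow> - of_real (harm_corr m \<sigma> M)) at_infinity"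
proof -
  have "((\<lambda>s. (\<Sum>k\<le>M. of_real (\<sigma> ^ k) * (1 / (of_nat k - s) ^ m)) - of_real (harm_corr m \<sigma> M))
     \<longlongrightarrow> (\<Sum>k\<le>M. complex_of_real (\<sigma> ^ k) * 0) - of_real (harm_corr m \<sigma> M)) at_infinity"
    by (intro tendsto_intros tendsto_inverse_power_diff_at_infinity assms)
  then show ?thesis by (simp add: pole_sum_def[abs_def])
qed

lemma pole_sum_holomorphic:
  assumes "of_nat ` {..M} \<inter> S = {}"
  shows "(pole_sum m \<sigma> M :: complex \<Rightarrow> complex) holomorphic_on S"
  unfolding pole_sum_def[abs_def] using assms by (auto intro!: holomorphic_intros)

lemma of_real_pole_sum: "pole_sum m \<sigma> M (of_real a) = (of_real (pole_sum m \<sigma> M a) :: complex)"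
  by (simp add: pole_sum_def)

text \<open>The pole sums tend at infinity to constants, possibly nonzero, so it is
  \<open>q \<ge> 1\<close> that makes \<open>z * f z\<close> vanish there. The simple pole
  \<open>a\<close> contributes minus the right-hand side, because the kernel is
  \<open>1 / (a - s)\<close>.\<close>

lemma sum_residue_at:
  fixes a :: real
  assumes mpq: "m \<ge> 1" "p \<ge> 1" "q \<ge> 1" and a: "\<And>n. a \<noteq> real n"
  shows "(\<Sum>n\<le>M. residue_at m p q \<sigma>\<^sub>1 \<sigma>\<^sub>2 a M n)
    = pole_sum m \<sigma>\<^sub>1 M a * pole_sum p \<sigma>\<^sub>2 M a / a ^ q"
proof -
  define f where "f = (\<lambda>s. pole_sum m \<sigma>\<^sub>1 M s * pole_sum p \<sigma>\<^sub>2 M s * (1 / s ^ q) * (1 / (complex_of_real a - s)))"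
  define g where "g = (\<lambda>s::complex. - (pole_sum m \<sigma>\<^sub>1 M s * pole_sum p \<sigma>\<^sub>2 M s * (1 / s ^ q)))"
  have a': "complex_of_real a \<noteq> of_nat n" for n
    using a[of n] by (metis of_real_eq_iff of_real_of_nat_eq)
  have hol: "f holomorphic_on (UNIV - insert (of_real a) (of_nat ` {..M}))"
    unfolding f_def
    by (intro holomorphic_intros pole_sum_holomorphic) (auto simp: image_iff intro: bexI[of _ 0])
  \<comment> \<open>\<open>z / (a - z)\<close> is written as \<open>a / (a - z) - 1\<close>, and
    \<open>1 / z ^ q\<close> through \<open>1 / (0 - z) ^ q\<close>, so that only inverse powers of
    differences \<open>c - z\<close> need a limit.\<close>
  have "((\<lambda>z. pole_sum m \<sigma>\<^sub>1 M z * pole_sum p \<sigma>\<^sub>2 M z * (1 / (0 - z) ^ q) * (complex_of_real a * (1 / (of_real a - z) ^ 1) - 1))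
     \<longlongrightarrow> (- of_real (harm_corr m \<sigma>\<^sub>1 M)) * (- of_real (harm_corr p \<sigma>\<^sub>2 M)) * 0 * (complex_of_real a * 0 - 1)) at_infinity"
    by (intro tendsto_intros pole_sum_tendsto_at_infinity tendsto_inverse_power_diff_at_infinity mpq) auto
  then have "((\<lambda>z. (-1) ^ q * (pole_sum m \<sigma>\<^sub>1 M z * pole_sum p \<sigma>\<^sub>2 M z * (1 / (0 - z) ^ q) * (complex_of_real a * (1 / (of_real a - z) ^ 1) - 1)))
     \<longlongrightarrow> 0) at_infinity"
    by (intro tendsto_mult_right_zero) simp
  then have "((\<lambda>z. z * f z) \<longlongrightarrow> 0) at_infinity"
  proof (rule Lim_transform_eventually[of _ 0, simplified])
    have "eventually (\<lambda>z. norm z \<ge> norm a + 1) (at_infinity :: complex filter)"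
      by (auto simp: eventually_at_infinity)
    then show "eventually (\<lambda>z. (-1) ^ q * (pole_sum m \<sigma>\<^sub>1 M z * pole_sum p \<sigma>\<^sub>2 M z * (1 / (0 - z) ^ q) * (complex_of_real a * (1 / (of_real a - z) ^ 1) - 1)) = z * f z) at_infinity"
    proof eventually_elim
      case (elim z)
      then have z: "complex_of_real a - z \<noteq> 0" by auto
      have "(-1) ^ q * (1 / (0 - z) ^ q) = 1 / z ^ q"
        using power_minus[of z q] by (simp add: field_simps)
      moreover have "complex_of_real a * (1 / (of_real a - z) ^ 1) - 1 = z * (1 / (of_real a - z))"
        using z by (simp add: field_simps)
      moreover have "e * (x * y * u * v) = x * y * (e * u) * v" for e x y u v :: complex
        by simp
      ultimately have "(-1) ^ q * (pole_sum m \<sigma>\<^sub>1 M z * pole_sum p \<sigma>\<^sub>2 M z * (1 / (0 - z) ^ q)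
          * (complex_of_real a * (1 / (of_real a - z) ^ 1) - 1))
        = pole_sum m \<sigma>\<^sub>1 M z * pole_sum p \<sigma>\<^sub>2 M z * (1 / z ^ q) * (z * (1 / (of_real a - z)))"
        by metis
      also have "\<dots> = z * f z"
        unfolding f_def by (simp only: mult_ac)
      finally show ?case .
    qed
  qed
  then have "(\<Sum>z\<in>insert (of_real a) (of_nat ` {..M}). residue f z) = 0"
    using hol by (intro sum_residues_eq_0) auto
  moreover have "(\<Sum>z\<in>insert (of_real a) (of_nat ` {..M}). residue f z)
      = residue f (of_real a) + (\<Sum>n\<le>M. residue f (of_nat n))"
    using a' by (subst sum.insert) (auto simp: sum.reindex image_iff)
  moreover have "residue f (of_real a) = g (of_real a)"
  proof -
    have "residue (\<lambda>w. g w / (w - of_real a)) (of_real a) = g (of_real a)"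
    proof (rule residue_simple[of "- (of_nat ` {..M})"])
      show "g holomorphic_on - (of_nat ` {..M})"
        unfolding g_def
        by (intro holomorphic_intros pole_sum_holomorphic) (auto simp: image_iff intro: bexI[of _ 0])
    qed (use a' in \<open>auto simp: finite_imp_closed\<close>)
    moreover have "(\<lambda>w. g w / (w - of_real a)) = f"
    proof
      fix w
      have "complex_of_real a - w = - (w - of_real a)" by simp
      then show "g w / (w - of_real a) = f w"
        unfolding f_def g_def by (simp only: divide_minus_right) simp
    qed
    ultimately show ?thesis by simp
  qed
  moreover have "g (of_real a) = - of_real (pole_sum m \<sigma>\<^sub>1 M a * pole_sum p \<sigma>\<^sub>2 M a / a ^ q)"
    by (simp add: g_def of_real_pole_sum)
  moreover have "(\<Sum>n\<le>M. residue f (of_nat n)) = of_real (\<Sum>n\<le>M. residue_at m p q \<sigma>\<^sub>1 \<sigma>\<^sub>2 a M n)"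
    unfolding f_def of_real_sum by (intro sum.cong refl residue_at_nat) (use mpq a in auto)
  ultimately have "complex_of_real (\<Sum>n\<le>M. residue_at m p q \<sigma>\<^sub>1 \<sigma>\<^sub>2 a M n)
      = of_real (pole_sum m \<sigma>\<^sub>1 M a * pole_sum p \<sigma>\<^sub>2 M a / a ^ q)"
    by (simp only: add_eq_0_iff) simp
  then show ?thesis
    by (simp only: of_real_eq_iff)
qed

section \<open>Series with controlled tails\<close>

lemma sign_simps:
  fixes \<sigma> :: real
  assumes "\<sigma> \<in> {1, -1}"
  shows "\<bar>\<sigma>\<bar> = 1" "\<sigma> * \<sigma> = 1" "\<bar>\<sigma> ^ n\<bar> = 1" "\<sigma> ^ n * \<sigma> ^ n = 1" "\<sigma> * (\<sigma> * x) = x" "\<sigma> ^ n * (\<sigma> ^ n * x) = x"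
  using assms by (auto simp: power_abs simp flip: power_mult_distrib mult.assoc)

text \<open>Cruder than a logarithmic bound, but it telescopes: harmonic numbers are at most
  \<open>2 * sqrt n\<close>.\<close>

lemma inverse_le_sqrt_diff: "1 / real (Suc n) \<le> 2 * (sqrt (real (Suc n)) - sqrt (real n))"
proof -
  define x where "x = sqrt (real (Suc n))"
  define y where "y = sqrt (real n)"
  have xy: "x ^ 2 = real n + 1" "y ^ 2 = real n" "y \<ge> 0" "x \<ge> 1" "y \<le> x"
    by (auto simp: x_def y_def)
  have "(x - y) * (x + y) = 1"
    using xy by (simp add: algebra_simps power2_eq_square)
  then have "x - y = 1 / (x + y)"
    using xy by (simp add: field_simps)
  moreover have "1 / (2 * x ^ 2) \<le> 1 / (x + y)"
  proof (rule divide_left_mono)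
    show "x + y \<le> 2 * x ^ 2"
      using xy self_le_power[of x 2] by simp
  qed (use xy in auto)
  ultimately have "1 / x ^ 2 \<le> 2 * (x - y)" by simp
  then show ?thesis by (simp add: x_def y_def)
qed

lemma sum_inverse_le_sqrt: "(\<Sum>k=1..n. 1 / real k) \<le> 2 * sqrt (real n)"
proof (induction n)
  case (Suc n)
  then show ?case using inverse_le_sqrt_diff[of n] by simp
qed simp

lemma abs_H_num_le:
  assumes "\<sigma> \<in> {1, -1}" "r \<ge> 1"
  shows "\<bar>H_num r \<sigma> n\<bar> \<le> 2 * sqrt (real n)"
proof -
  have "\<bar>H_num r \<sigma> n\<bar> \<le> (\<Sum>k=1..n. 1 / real k)"
    unfolding H_num_def
  proof (rule order_trans[OF sum_abs], rule sum_mono)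
    fix k assume "k \<in> {1..n}"
    then have "real k \<le> real k ^ r" "real k > 0"
      using assms by (auto intro!: self_le_power)
    then show "\<bar>\<sigma> ^ (k - 1) / real k ^ r\<bar> \<le> 1 / real k"
      using assms by (auto simp: sign_simps abs_divide intro!: divide_left_mono)
  qed
  then show ?thesis using sum_inverse_le_sqrt[of n] by linarith
qed

lemma inverse_le_if_le_mult: "k \<le> c * y \<Longrightarrow> 0 < y \<Longrightarrow> 0 < k \<Longrightarrow> 1 / y \<le> c * (1 / k)" for k c y :: real
  by (simp add: field_simps)

text \<open>Reduction to the harmonic numbers by \<open>k \<le> 2 * (k - 1/2)\<close> for
  \<open>k \<ge> 1\<close>, which costs \<open>2 ^ r\<close>.\<close>

lemma abs_h_num_le:
  assumes "\<sigma> \<in> {1, -1}" "r \<ge> 1"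
  shows "\<bar>h_num r \<sigma> n\<bar> \<le> 2 ^ Suc r * sqrt (real n)"
proof -
  have "\<bar>h_num r \<sigma> n\<bar> \<le> (\<Sum>k=1..n. 2 ^ r * (1 / real k))"
    unfolding h_num_def
  proof (rule order_trans[OF sum_abs], rule sum_mono)
    fix k assume "k \<in> {1..n}"
    then have k: "real k \<le> real k ^ r" "real k \<ge> 1"
      using assms by (auto intro!: self_le_power)
    then have "real k ^ r \<le> (2 * (real k - 1/2)) ^ r"
      by (intro power_mono) auto
    then have le: "real k \<le> 2 ^ r * (real k - 1/2) ^ r"
      using k by (simp only: power_mult_distrib)
    have pos: "(real k - 1/2) ^ r > 0" using k by simp
    have "\<bar>\<sigma> ^ (k - 1) / (real k - 1/2) ^ r\<bar> = 1 / (real k - 1/2) ^ r"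
      using assms pos by (simp only: sign_simps abs_divide abs_of_pos)
    also have "\<dots> \<le> 2 ^ r * (1 / real k)"
      using le k pos by (intro inverse_le_if_le_mult) auto
    finally show "\<bar>\<sigma> ^ (k - 1) / (real k - 1/2) ^ r\<bar> \<le> 2 ^ r * (1 / real k)" .
  qed
  also have "\<dots> \<le> 2 ^ r * (2 * sqrt (real n))"
    unfolding sum_distrib_left[symmetric] by (intro mult_left_mono sum_inverse_le_sqrt) auto
  finally show ?thesis by simp
qed

text \<open>
  A notion of convergence covering the conditionally convergent series (\<open>q = 1\<close>, \<open>\<sigma>\<^sub>3 = -1\<close>), yet strong
  enough to survive multiplication by the truncated kernel.
\<close>

definition tail_bounded :: "(nat \<Rightarrow> real) \<Rightarrow> bool" where
  "tail_bounded v \<longleftrightarrow> summable v \<and> (\<exists>C. \<forall>n. \<bar>\<Sum>i. v (i + n)\<bar> \<le> C / sqrt (real (Suc n)))"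

lemma tail_bounded_summable: "tail_bounded v \<Longrightarrow> summable v"
  by (simp add: tail_bounded_def)

lemma tail_bounded_add:
  assumes "tail_bounded u" "tail_bounded v"
  shows "tail_bounded (\<lambda>n. u n + v n)"
proof -
  obtain C D where CD: "\<And>n. \<bar>\<Sum>i. u (i + n)\<bar> \<le> C / sqrt (real (Suc n))"
     "\<And>n. \<bar>\<Sum>i. v (i + n)\<bar> \<le> D / sqrt (real (Suc n))"
    using assms by (auto simp: tail_bounded_def)
  have s: "summable u" "summable v" using assms by (auto simp: tail_bounded_def)
  have "\<bar>\<Sum>i. u (i + n) + v (i + n)\<bar> \<le> (C + D) / sqrt (real (Suc n))" for n
  proof -
    have "(\<Sum>i. u (i + n) + v (i + n)) = (\<Sum>i. u (i + n)) + (\<Sum>i. v (i + n))"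
      by (rule suminf_add[symmetric]) (use s in \<open>simp_all add: summable_iff_shift\<close>)
    then show ?thesis using CD[of n] by (simp add: add_divide_distrib)
  qed
  then show ?thesis using s by (auto simp: tail_bounded_def intro: summable_add)
qed

lemma tail_bounded_cmult:
  assumes "tail_bounded v"
  shows "tail_bounded (\<lambda>j. c * v j)"
proof -
  have sv: "summable v" using assms by (rule tail_bounded_summable)
  obtain D where D: "\<And>n. \<bar>\<Sum>i. v (i + n)\<bar> \<le> D / sqrt (real (Suc n))"
    using assms unfolding tail_bounded_def by blast
  have "\<bar>\<Sum>i. c * v (i + n)\<bar> \<le> (\<bar>c\<bar> * D) / sqrt (real (Suc n))" for n
  proof -
    have "(\<Sum>i. c * v (i + n)) = c * (\<Sum>i. v (i + n))"
      using sv by (intro suminf_mult) (simp add: summable_iff_shift)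
    then show ?thesis using mult_left_mono[OF D[of n], of "\<bar>c\<bar>"] by (simp add: abs_mult)
  qed
  then show ?thesis using sv by (auto simp: tail_bounded_def intro: summable_mult)
qed

text \<open>The tail that starts at \<open>n\<close> is \<open>z n\<close> itself.\<close>

lemma tail_bounded_telescope:
  assumes "\<And>n. \<bar>z n\<bar> \<le> C / sqrt (real (Suc n))"
  shows "tail_bounded (\<lambda>n. z n - z (Suc n))"
proof -
  have "(\<lambda>n. C / sqrt (real (Suc n))) \<longlonglongrightarrow> 0"
    by real_asymp
  then have z: "z \<longlonglongrightarrow> 0"
    using assms by (intro Lim_null_comparison[of z]) auto
  have "(\<lambda>i. z (i + n) - z (Suc i + n)) sums z n" for n
    using telescope_sums'[of "\<lambda>i. z (i + n)" 0] LIMSEQ_ignore_initial_segment[OF z, of n] by simp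
  then have "(\<Sum>i. z (i + n) - z (Suc (i + n))) = z n" "summable (\<lambda>i. z (i + n) - z (Suc (i + n)))" for n
    by (auto simp: sums_iff)
  from this(1) this(2)[of 0] show ?thesis using assms by (auto simp: tail_bounded_def)
qed

lemma tail_bounded_comparison:
  assumes "\<And>n. \<bar>v n\<bar> \<le> w n" "tail_bounded w"
  shows "tail_bounded v"
proof -
  have s: "summable w" "summable v"
    using assms by (auto simp: tail_bounded_def intro: summable_comparison_test'[where N = 0])
  have "\<bar>\<Sum>i. v (i + n)\<bar> \<le> \<bar>\<Sum>i. w (i + n)\<bar>" for n
  proof -
    have "summable (\<lambda>i. w (i + n))" using s by (simp add: summable_iff_shift)
    then have "norm (\<Sum>i. v (i + n)) \<le> (\<Sum>i. w (i + n))"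
      by (intro norm_suminf_le) (use assms in auto)
    then show ?thesis by simp
  qed
  then show ?thesis using assms s unfolding tail_bounded_def by (meson order_trans)
qed

text \<open>With \<open>a = sqrt x\<close> and \<open>b = sqrt (x + 1)\<close> the difference on the
  right is \<open>1 / (a * b * (a + b))\<close>. For \<open>x \<ge> 1\<close> one has
  \<open>b \<le> 3/2 * a\<close>, which already gives the constant \<open>15/4\<close>; it is
  rounded up to \<open>6\<close>.\<close>

lemma inverse_sqrt_diff_ge:
  assumes "x \<ge> (1::real)"
  shows "1 / (x * sqrt x) \<le> 6 * (1 / sqrt x - 1 / sqrt (x + 1))"
proof -
  define a where "a = sqrt x"
  define b where "b = sqrt (x + 1)"
  have ab: "a ^ 2 = x" "b ^ 2 = x + 1" "a \<ge> 1" "b \<ge> a"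
    using assms by (auto simp: a_def b_def)
  have "b \<le> sqrt (2 * x)" unfolding b_def using assms by (intro real_sqrt_le_mono) auto
  also have "\<dots> \<le> sqrt (9/4 * x)" using assms by (intro real_sqrt_le_mono) auto
  also have "\<dots> = (3/2) * a"
    unfolding a_def by (simp add: real_sqrt_mult real_sqrt_divide)
  finally have b: "b \<le> (3/2) * a" .
  have "a * b * (a + b) \<le> a * ((3/2) * a) * (a + (3/2) * a)"
    using ab b by (intro mult_mono) auto
  also have "\<dots> = 15/4 * (x * a)" using ab by (simp add: power2_eq_square algebra_simps)
  also have "\<dots> \<le> 6 * (x * a)"
    using assms ab by (intro mult_right_mono) auto
  finally have le: "a * b * (a + b) \<le> 6 * (x * a)" .
  have "(b - a) * (a + b) = 1"
    using ab by (simp add: algebra_simps power2_eq_square)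
  then have "b - a = 1 / (a + b)"
    using ab by (simp add: field_simps)
  moreover have "1 / a - 1 / b = (b - a) / (a * b)"
    using ab by (simp add: divide_simps)
  ultimately have "1 / a - 1 / b = 1 / (a * b * (a + b))"
    by simp
  moreover have "1 / (6 * (x * a)) \<le> 1 / (a * b * (a + b))"
    using le ab assms by (intro divide_left_mono) (auto intro!: mult_pos_pos)
  ultimately have "6 * (1 / (6 * (x * a))) \<le> 6 * (1 / a - 1 / b)"
    by (simp only: mult_le_cancel_left_pos zero_less_numeral)
  then show ?thesis by (simp add: a_def b_def)
qed

text \<open>Terms of order \<open>n powr (-3/2)\<close> lie below a multiple of the telescoping
  series of \<open>1 / sqrt n\<close>.\<close>

lemma tail_bounded_powr:
  assumes "\<And>n. \<bar>v n\<bar> \<le> C / (real (Suc n) * sqrt (real (Suc n)))" "C \<ge> 0"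
  shows "tail_bounded v"
proof (rule tail_bounded_comparison)
  show "tail_bounded (\<lambda>n. 6 * C / sqrt (real (Suc n)) - 6 * C / sqrt (real (Suc (Suc n))))"
    by (rule tail_bounded_telescope[where C = "6 * C"]) (use assms in auto)
  fix n
  have "C * (1 / (real (Suc n) * sqrt (real (Suc n))))
      \<le> C * (6 * (1 / sqrt (real (Suc n)) - 1 / sqrt (real (Suc n) + 1)))"
    using assms inverse_sqrt_diff_ge[of "real (Suc n)"] by (intro mult_left_mono) auto
  then show "\<bar>v n\<bar> \<le> 6 * C / sqrt (real (Suc n)) - 6 * C / sqrt (real (Suc (Suc n)))"
    using assms(1)[of n] by (simp add: algebra_simps)
qed

text \<open>Averaging of neighbours takes the place of the monotonicity in Leibniz's criterion: with
  \<open>?z n = (-1) ^ n * u n / 2\<close>, the term \<open>(-1) ^ n * u n\<close> is a telescoping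
  difference of \<open>?z\<close> plus half a difference of \<open>u\<close>, which converges
  absolutely.\<close>

lemma tail_bounded_alternating:
  assumes d: "\<And>n. \<bar>u n - u (Suc n)\<bar> \<le> C / (real (Suc n) * sqrt (real (Suc n)))"
    and u: "\<And>n. \<bar>u n\<bar> \<le> C / sqrt (real (Suc n))" and "C \<ge> 0"
  shows "tail_bounded (\<lambda>n. (-1) ^ n * u n)"
proof -
  let ?z = "\<lambda>n. (-1) ^ n * u n / 2"
  have "tail_bounded (\<lambda>n. (-1) ^ n * (u n - u (Suc n)) / 2 + (?z n - ?z (Suc n)))"
  proof (rule tail_bounded_add)
    show "tail_bounded (\<lambda>n. (-1) ^ n * (u n - u (Suc n)) / 2)"
    proof (rule tail_bounded_powr)
      fix n
      show "\<bar>(-1) ^ n * (u n - u (Suc n)) / 2\<bar> \<le> C / (real (Suc n) * sqrt (real (Suc n)))"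
      proof -
        have "0 \<le> C / (real (Suc n) * sqrt (real (Suc n)))" using \<open>C \<ge> 0\<close> by simp
        moreover have "\<bar>(-1) ^ n * (u n - u (Suc n)) / 2\<bar> \<le> \<bar>u n - u (Suc n)\<bar>"
          by (simp add: abs_mult power_abs)
        ultimately show ?thesis using d[of n] by (meson order_trans)
      qed
    qed fact
    show "tail_bounded (\<lambda>n. ?z n - ?z (Suc n))"
    proof (rule tail_bounded_telescope)
      fix n
      show "\<bar>?z n\<bar> \<le> C / sqrt (real (Suc n))"
      proof -
        have "\<bar>?z n\<bar> \<le> \<bar>u n\<bar>" by (simp add: abs_mult power_abs)
        then show ?thesis using u[of n] by (rule order_trans)
      qed
    qed
  qed
  moreover have "(-1) ^ n * (u n - u (Suc n)) / 2 + (?z n - ?z (Suc n)) = (-1) ^ n * u n" for n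
    by (simp add: field_simps)
  ultimately show ?thesis by simp
qed

text \<open>One criterion for all series that occur: \<open>c = 1/2\<close> serves the
  half-integers, \<open>c = 1\<close> the integers, and \<open>c \<ge> 1/2\<close> gives
  \<open>n + c \<ge> (n + 1) / 2\<close>. For \<open>e = 1\<close> the sign must be
  \<open>-1\<close> and the alternating criterion applies; for \<open>e \<ge> 2\<close> the terms
  are of order \<open>n powr (-3/2)\<close>.\<close>

lemma tail_bounded_sign_series:
  assumes g: "\<And>n. \<bar>g n\<bar> \<le> C * sqrt (real (Suc n))"
    and dg: "\<And>n. \<bar>g n - g (Suc n)\<bar> \<le> C / sqrt (real (Suc n))"
    and c: "c \<ge> 1/2" and e: "e \<ge> 1" and \<sigma>: "\<sigma> \<in> {1, -1}" and ne: "(e, \<sigma>) \<noteq> (1, 1)"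
  shows "tail_bounded (\<lambda>n. \<sigma> ^ n * g n / (real n + c) ^ e)"
proof -
  have C: "C \<ge> 0" using g[of 0] by simp
  have x: "real n + c \<ge> real (Suc n) / 2" for n using c by simp
  show ?thesis
  proof (cases "e = 1")
    case True
    then have \<sigma>: "\<sigma> = -1" using \<sigma> ne by auto
    define s where "s n = sqrt (real (Suc n))" for n
    have s: "s n > 0" "s n * s n = real (Suc n)" "s n ^ 2 = real (Suc n)" for n by (auto simp: s_def)
    define u where "u n = g n / (real n + c)" for n
    have "tail_bounded (\<lambda>n. (-1) ^ n * u n)"
    proof (rule tail_bounded_alternating)
      show "6 * C \<ge> 0" using C by simp
      fix n
      have "\<bar>u n\<bar> \<le> (C * s n) / (real (Suc n) / 2)"
        unfolding u_def abs_divide using g[of n] x[of n] c s[of n] by (intro frac_le) (auto simp: s_def)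
      also have "\<dots> = 2 * C / s n"
        unfolding s(2)[symmetric] using s(1)[of n] by simp
      also have "\<dots> \<le> 6 * C / s n" using C s[of n] by (intro divide_right_mono) auto
      finally show "\<bar>u n\<bar> \<le> 6 * C / sqrt (real (Suc n))" by (simp add: s_def)
      \<comment> \<open>Discrete quotient rule; its two parts contribute \<open>4 * C\<close> and
        \<open>2 * C\<close>, whence the constant \<open>6 * C\<close>.\<close>
      have eq: "u n - u (Suc n) = g n / ((real n + c) * (real n + c + 1)) + (g n - g (Suc n)) / (real n + c + 1)"
        using c by (simp add: u_def divide_simps) (simp add: algebra_simps)
      have 1: "\<bar>g n / ((real n + c) * (real n + c + 1))\<bar> \<le> (C * s n) / ((real (Suc n) / 2) * (real (Suc n) / 2))"
        unfolding abs_divide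
      proof (rule frac_le)
        have "real (Suc n) / 2 * (real (Suc n) / 2) \<le> (real n + c) * (real n + c + 1)"
          using x[of n] by (intro mult_mono) auto
        also have "\<dots> \<le> \<bar>(real n + c) * (real n + c + 1)\<bar>" by (rule abs_ge_self)
        finally show "real (Suc n) / 2 * (real (Suc n) / 2) \<le> \<bar>(real n + c) * (real n + c + 1)\<bar>" .
      qed (use g[of n] C s[of n] in \<open>auto simp: s_def\<close>)
      have 2: "\<bar>(g n - g (Suc n)) / (real n + c + 1)\<bar> \<le> (C / s n) / (real (Suc n) / 2)"
        unfolding abs_divide using dg[of n] x[of n] c s[of n] C by (intro frac_le) (auto simp: s_def)
      have 3: "(C * s n) / ((real (Suc n) / 2) * (real (Suc n) / 2)) = 4 * C / (real (Suc n) * s n)"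
        unfolding s(2)[symmetric] using s(1)[of n] by (simp add: mult.assoc mult.commute)
      have 4: "(C / s n) / (real (Suc n) / 2) = 2 * C / (real (Suc n) * s n)"
        by (simp add: mult.commute)
      have "\<bar>u n - u (Suc n)\<bar> \<le> 4 * C / (real (Suc n) * s n) + 2 * C / (real (Suc n) * s n)"
        using 1 2 unfolding eq 3 4 by linarith
      then show "\<bar>u n - u (Suc n)\<bar> \<le> 6 * C / (real (Suc n) * sqrt (real (Suc n)))"
        by (simp add: s_def add_divide_distrib[symmetric])
    qed
    then show ?thesis using True \<sigma> by (simp add: u_def)
  next
    case False
    show ?thesis
    proof (rule tail_bounded_powr)
      show "2 ^ e * C \<ge> 0" using C by simp
      fix n
      have "(real (Suc n)) ^ 2 \<le> real (Suc n) ^ e"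
        using False e by (intro power_increasing) auto
      then have "(real (Suc n)) ^ 2 / 2 ^ e \<le> (real (Suc n) / 2) ^ e"
        by (simp add: power_divide divide_right_mono)
      also have "\<dots> \<le> (real n + c) ^ e" using x[of n] by (intro power_mono) auto
      finally have le: "(real (Suc n)) ^ 2 / 2 ^ e \<le> (real n + c) ^ e" .
      have "\<bar>\<sigma> ^ n * g n / (real n + c) ^ e\<bar> = \<bar>g n\<bar> / (real n + c) ^ e"
        using c \<sigma> by (simp add: abs_mult abs_divide sign_simps)
      also have "\<dots> \<le> (C * sqrt (real (Suc n))) / ((real (Suc n)) ^ 2 / 2 ^ e)"
        using g[of n] le C by (intro frac_le) auto
      also have "\<dots> = 2 ^ e * C * (sqrt (real (Suc n)) / (real (Suc n)) ^ 2)" by simp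
      also have "sqrt (real (Suc n)) / (real (Suc n)) ^ 2 = 1 / (real (Suc n) * sqrt (real (Suc n)))"
        by (simp add: power2_eq_square divide_simps)
      finally show "\<bar>\<sigma> ^ n * g n / (real n + c) ^ e\<bar> \<le> 2 ^ e * C / (real (Suc n) * sqrt (real (Suc n)))"
        by simp
    qed
  qed
qed

lemma tail_bounded_const:
  assumes "c \<ge> 1/2" "e \<ge> 1" "\<sigma> \<in> {1, -1}" "(e, \<sigma>) \<noteq> (1, 1)"
  shows "tail_bounded (\<lambda>n. \<sigma> ^ n / (real n + c) ^ e)"
  using tail_bounded_sign_series[of "\<lambda>_. 1" 1 c e \<sigma>] assms by simp

lemma tail_bounded_h_num:
  assumes "\<sigma>\<^sub>1 \<in> {1, -1}" "p \<ge> 1" "e \<ge> 1" "\<sigma> \<in> {1, -1}" "(e, \<sigma>) \<noteq> (1, 1)"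
  shows "tail_bounded (\<lambda>n. \<sigma> ^ n * h_num p \<sigma>\<^sub>1 n / (real (Suc n) - 1/2) ^ e)"
proof -
  have "tail_bounded (\<lambda>n. \<sigma> ^ n * h_num p \<sigma>\<^sub>1 n / (real n + 1/2) ^ e)"
  proof (rule tail_bounded_sign_series)
    fix n
    have "\<bar>h_num p \<sigma>\<^sub>1 n\<bar> \<le> 2 ^ Suc p * sqrt (real n)" by (rule abs_h_num_le) fact+
    also have "\<dots> \<le> 2 ^ Suc p * sqrt (real (Suc n))" by (intro mult_left_mono) auto
    finally show "\<bar>h_num p \<sigma>\<^sub>1 n\<bar> \<le> 2 ^ Suc p * sqrt (real (Suc n))" .
    have "real (Suc n) \<le> real (Suc n) ^ p"
      using assms by (intro self_le_power) auto
    also have "\<dots> \<le> (2 * (real n + 1/2)) ^ p" by (intro power_mono) auto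
    finally have le: "real (Suc n) \<le> 2 ^ p * (real n + 1/2) ^ p"
      by (simp only: power_mult_distrib)
    have "real (Suc n) - 1/2 = real n + 1/2" by simp
    then have "h_num p \<sigma>\<^sub>1 n - h_num p \<sigma>\<^sub>1 (Suc n) = - (\<sigma>\<^sub>1 ^ n / (real n + 1/2) ^ p)"
      by (simp only: h_num_def sum.cl_ivl_Suc) simp
    then have "\<bar>h_num p \<sigma>\<^sub>1 n - h_num p \<sigma>\<^sub>1 (Suc n)\<bar> = 1 / (real n + 1/2) ^ p"
      using assms by (simp add: abs_divide sign_simps)
    also have "\<dots> \<le> 2 ^ p * (1 / real (Suc n))"
      by (rule inverse_le_if_le_mult[OF le]) auto
    also have "\<dots> = 2 ^ p / real (Suc n)" by simp
    also have "\<dots> \<le> 2 ^ Suc p / sqrt (real (Suc n))"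
      by (intro frac_le) (auto intro!: real_le_lsqrt simp: power2_eq_square)
    finally show "\<bar>h_num p \<sigma>\<^sub>1 n - h_num p \<sigma>\<^sub>1 (Suc n)\<bar> \<le> 2 ^ Suc p / sqrt (real (Suc n))" .
  qed (use assms in auto)
  moreover have "real n + 1/2 = real (Suc n) - 1/2" for n by simp
  ultimately show ?thesis by simp
qed

lemma tail_bounded_H_num:
  assumes "\<sigma>\<^sub>1 \<in> {1, -1}" "p \<ge> 1" "e \<ge> 1" "\<sigma> \<in> {1, -1}" "(e, \<sigma>) \<noteq> (1, 1)"
  shows "tail_bounded (\<lambda>n. \<sigma> ^ n * H_num p \<sigma>\<^sub>1 (Suc n) / real (Suc n) ^ e)"
proof -
  have "tail_bounded (\<lambda>n. \<sigma> ^ n * H_num p \<sigma>\<^sub>1 (Suc n) / (real n + 1) ^ e)"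
  proof (rule tail_bounded_sign_series)
    fix n
    show "\<bar>H_num p \<sigma>\<^sub>1 (Suc n)\<bar> \<le> 2 * sqrt (real (Suc n))" by (rule abs_H_num_le) fact+
    have le: "real (Suc (Suc n)) \<le> real (Suc (Suc n)) ^ p"
      using assms by (intro self_le_power) auto
    have "\<bar>H_num p \<sigma>\<^sub>1 (Suc n) - H_num p \<sigma>\<^sub>1 (Suc (Suc n))\<bar> = 1 / real (Suc (Suc n)) ^ p"
      using assms by (simp add: H_num_def abs_divide abs_mult sign_simps)
    also have "\<dots> \<le> 2 / sqrt (real (Suc n))"
      by (intro frac_le order_trans[OF _ le]) (auto intro!: real_le_lsqrt simp: power2_eq_square algebra_simps)
    finally show "\<bar>H_num p \<sigma>\<^sub>1 (Suc n) - H_num p \<sigma>\<^sub>1 (Suc (Suc n))\<bar> \<le> 2 / sqrt (real (Suc n))" .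
  qed (use assms in auto)
  then show ?thesis by (simp add: add.commute)
qed

section \<open>The truncated kernel\<close>

text \<open>The total decay has order \<open>3/2\<close>. The larger of \<open>x\<close> and
  \<open>y\<close> is at least \<open>N/2\<close> and gives up the power \<open>1/4\<close>;
  replacing what is left of it by the smaller one yields exponent \<open>5/4\<close>, which is
  summable.\<close>

lemma convolution_term_le:
  fixes x y N :: real
  assumes "x > 0" "y > 0" "N > 0" "x \<ge> N/2 \<or> y \<ge> N/2"
  shows "1 / (sqrt x * y) \<le> (N/2) powr (-1/4) * (x powr (-5/4) + y powr (-5/4))"
proof (cases "y \<le> x")
  case True
  then have "x \<ge> N/2" using assms by auto
  have "1 / (sqrt x * y) = x powr (-1/2) * y powr (-1)"
    using assms by (simp add: powr_minus powr_half_sqrt divide_simps)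
  also have "x powr (-1/2) = x powr (-1/4) * x powr (-1/4)"
    by (simp flip: powr_add)
  also have "x powr (-1/4) * x powr (-1/4) * y powr (-1) \<le> (N/2) powr (-1/4) * y powr (-1/4) * y powr (-1)"
    using assms True \<open>x \<ge> N/2\<close> by (intro mult_mono powr_mono2') auto
  also have "\<dots> = (N/2) powr (-1/4) * y powr (-5/4)"
    by (simp only: mult.assoc powr_add[symmetric]) simp
  also have "\<dots> \<le> (N/2) powr (-1/4) * (x powr (-5/4) + y powr (-5/4))"
    by (intro mult_left_mono) auto
  finally show ?thesis .
next
  case False
  then have "y \<ge> N/2" using assms by auto
  have "1 / (sqrt x * y) = x powr (-1/2) * (y powr (-1/4) * y powr (-3/4))"
    using assms by (simp add: powr_minus powr_half_sqrt divide_simps flip: powr_add)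
  also have "\<dots> \<le> x powr (-1/2) * ((N/2) powr (-1/4) * x powr (-3/4))"
    using assms False \<open>y \<ge> N/2\<close> by (intro mult_mono powr_mono2') auto
  also have "\<dots> = (N/2) powr (-1/4) * x powr (-5/4)"
    by (simp add: mult.left_commute flip: powr_add)
  also have "\<dots> \<le> (N/2) powr (-1/4) * (x powr (-5/4) + y powr (-5/4))"
    by (intro mult_left_mono) auto
  finally show ?thesis .
qed

lemma half_integer_distance: "\<bar>real N - 1/2 - real n\<bar> \<ge> 1/2"
proof (cases "N \<le> n")
  case True
  then have "real N \<le> real n" by simp
  then show ?thesis by linarith
next
  case False
  then have "real N \<ge> real n + 1" by linarith
  then show ?thesis by linarith
qed

lemma summable_shift_powr: "summable (\<lambda>i. (real i + 1/2) powr (-5/4))"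
proof (rule summable_comparison_test')
  show "summable (\<lambda>i. real i powr (-5/4))" by (simp add: summable_real_powr_iff)
  fix i :: nat assume "i \<ge> 1"
  then show "norm ((real i + 1/2) powr (-5/4)) \<le> real i powr (-5/4)"
    by (auto intro!: powr_mono2')
qed

text \<open>This is the error of the summation by parts below: tails \<open>1 / sqrt (j + 1)\<close>
  against the increments of the truncated kernel. The numbers \<open>j + 1\<close> and
  \<open>\<bar>N - 1/2 - j\<bar>\<close> cannot both be below \<open>N/2\<close>.\<close>

lemma convolution_tendsto_0:
  defines "w \<equiv> \<lambda>N j. 1 / (sqrt (real (Suc j)) * \<bar>real N - 1/2 - real j\<bar>)"
  shows "summable (w N)" and "(\<lambda>N. \<Sum>j. w N j) \<longlonglongrightarrow> 0"
proof -
  define Z where "Z = (\<Sum>i. (real i + 1/2) powr (-5/4))"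
  define y where "y N j = \<bar>real N - 1/2 - real j\<bar>" for N j
  have ypos: "y N j > 0" for N j
    using half_integer_distance[of N j] unfolding y_def by linarith
  \<comment> \<open>To the right of \<open>N - 1/2\<close> the distances run through all
    \<open>i + 1/2\<close>, to the left through the first \<open>N\<close> of them; hence the bound
    \<open>2 * Z\<close>, uniform in \<open>N\<close>.\<close>
  have y: "summable (\<lambda>j. y N j powr (-5/4)) \<and> (\<Sum>j. y N j powr (-5/4)) \<le> 2 * Z" for N
  proof -
    have eq: "y N (i + N) = real i + 1/2" for i by (simp add: y_def)
    have s: "summable (\<lambda>j. y N j powr (-5/4))"
      using summable_shift_powr by (subst summable_iff_shift[symmetric, of _ N]) (simp add: eq)
    have "(\<Sum>j<N. y N j powr (-5/4)) = (\<Sum>j<N. y N (N - Suc j) powr (-5/4))"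
      by (rule sum.nat_diff_reindex[symmetric])
    also have "\<dots> = (\<Sum>j<N. (real j + 1/2) powr (-5/4))"
    proof (rule sum.cong)
      fix j assume "j \<in> {..<N}"
      then have "y N (N - Suc j) = real j + 1/2" by (simp add: y_def of_nat_diff)
      then show "y N (N - Suc j) powr (-5/4) = (real j + 1/2) powr (-5/4)" by (simp only:)
    qed simp
    finally have "(\<Sum>j<N. y N j powr (-5/4)) \<le> Z"
      using sum_le_suminf[OF summable_shift_powr, of "{..<N}"] by (simp only: Z_def) simp
    moreover have "(\<Sum>j. y N j powr (-5/4)) = Z + (\<Sum>j<N. y N j powr (-5/4))"
      using suminf_split_initial_segment[OF s, of N] by (simp only: eq Z_def)
    ultimately show ?thesis
      using s by simp
  qed
  have x: "(\<lambda>j. real (Suc j) powr (-5/4)) sums (\<Sum>j. real (Suc j) powr (-5/4))"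
    by (rule summable_sums, subst summable_Suc_iff[of "\<lambda>j. real j powr (-5/4)"]) (simp add: summable_real_powr_iff)
  define X where "X = (\<Sum>j. real (Suc j) powr (-5/4))"
  have bound: "\<bar>w N j\<bar> \<le> (real N/2) powr (-1/4) * (real (Suc j) powr (-5/4) + y N j powr (-5/4))" if "N \<ge> 1" for N j
  proof -
    have "1 / (sqrt (real (Suc j)) * y N j) \<le> (real N/2) powr (-1/4) * (real (Suc j) powr (-5/4) + y N j powr (-5/4))"
    proof (rule convolution_term_le)
      show "real (Suc j) \<ge> real N / 2 \<or> y N j \<ge> real N / 2"
        unfolding y_def by linarith
    qed (use ypos that in auto)
    moreover have "w N j \<ge> 0" by (simp add: w_def)
    ultimately show ?thesis by (simp add: w_def y_def)
  qed
  have dom: "(\<lambda>j. (real N/2) powr (-1/4) * (real (Suc j) powr (-5/4) + y N j powr (-5/4)))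
      sums ((real N/2) powr (-1/4) * (X + (\<Sum>j. y N j powr (-5/4))))" for N
    using x y[of N] unfolding X_def by (intro sums_mult sums_add) (auto simp: summable_sums)
  show sw: "summable (w N)" for N
  proof (cases "N = 0")
    case False
    then show ?thesis
      using bound by (intro summable_comparison_test'[OF sums_summable[OF dom[of N]]]) auto
  next
    \<comment> \<open>The estimate assumes \<open>N \<ge> 1\<close>; for \<open>N = 0\<close> all
      distances with \<open>j \<ge> 1\<close> exceed those for \<open>N = 1\<close>.\<close>
    case True
    have "summable (w 1)"
      using bound[of 1] by (intro summable_comparison_test'[OF sums_summable[OF dom[of 1]]]) auto
    show ?thesis
    proof (rule summable_comparison_test'[where N = 1])
      show "summable (w 1)" by fact
      fix j :: nat assume "j \<ge> 1"
      then show "norm (w N j) \<le> w 1 j"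
        using True by (auto simp: w_def intro!: divide_left_mono mult_left_mono mult_pos_pos)
    qed
  qed
  show "(\<lambda>N. \<Sum>j. w N j) \<longlonglongrightarrow> 0"
  proof (rule Lim_null_comparison)
    have "(\<lambda>N. (real N/2) powr (-1/4)) \<longlonglongrightarrow> 0"
      by real_asymp
    then show "(\<lambda>N. (real N/2) powr (-1/4) * (X + 2 * Z)) \<longlonglongrightarrow> 0"
      by (rule tendsto_mult_left_zero)
    show "\<forall>\<^sub>F N in sequentially. norm (\<Sum>j. w N j) \<le> (real N/2) powr (-1/4) * (X + 2 * Z)"
      using eventually_ge_at_top[of 1]
    proof eventually_elim
      case (elim N)
      have "norm (\<Sum>j. w N j) \<le> (\<Sum>j. (real N/2) powr (-1/4) * (real (Suc j) powr (-5/4) + y N j powr (-5/4)))"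
        using bound[OF elim] by (intro norm_suminf_le sums_summable[OF dom]) auto
      also have "\<dots> = (real N/2) powr (-1/4) * (X + (\<Sum>j. y N j powr (-5/4)))"
        using dom[of N] by (simp add: sums_iff)
      also have "\<dots> \<le> (real N/2) powr (-1/4) * (X + 2 * Z)"
        using y[of N] by (intro mult_left_mono add_left_mono) auto
      finally show ?case .
    qed
  qed
qed

text \<open>
  Taylor coefficients at \<open>n\<close> of the truncated kernel
  \<open>\<Sum>j<N. \<tau>\<^sup>j\<^sup>+\<^sup>1 / (j + 1/2 - s) + \<tau>\<^sup>j / (- (j + 1/2) - s)\<close>, whose limit is \<open>\<pi> tan (\<pi>s)\<close> for \<open>\<tau> = 1\<close> and
  \<open>- \<pi> / cos (\<pi>s)\<close> for \<open>\<tau> = -1\<close>.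
\<close>

definition kernel_coeff :: "real \<Rightarrow> nat \<Rightarrow> nat \<Rightarrow> nat \<Rightarrow> real" where
  "kernel_coeff \<tau> N n k = (\<Sum>j<N. \<tau> ^ Suc j * taylor_pole (real j + 1/2) n k
     + \<tau> ^ j * taylor_pole (- (real j + 1/2)) n k)"

text \<open>Finite form of \<open>K (s + 1) = \<tau> * K s\<close>: passing from \<open>n\<close> to
  \<open>n + 1\<close> shifts the block of poles by one, and everything cancels except the pole
  entering at one end and the pole leaving at the other.\<close>

lemma kernel_coeff_diff:
  assumes "\<tau> \<in> {1, -1}"
  shows "\<tau> ^ Suc n * kernel_coeff \<tau> N (Suc n) k - \<tau> ^ n * kernel_coeff \<tau> N n k
    = \<tau> ^ (n + N) * (1 / (- (real N + 1/2) - real n) ^ Suc k - 1 / (real N - 1/2 - real n) ^ Suc k)"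
proof (induction N)
  case 0
  have "- (0 + 1/2) - real n = 0 - 1/2 - real n" by simp
  then show ?case by (simp add: kernel_coeff_def)
next
  case (Suc N)
  have e: "real N + 1/2 - real (Suc n) = real N - 1/2 - real n"
    "- (real N + 1/2) - real (Suc n) = - (real (Suc N) + 1/2) - real n"
    "real (Suc N) - 1/2 - real n = real N + 1/2 - real n"
    by simp_all
  define A where "A = 1 / (real N - 1/2 - real n) ^ Suc k"
  define B where "B = 1 / (- (real (Suc N) + 1/2) - real n) ^ Suc k"
  define C where "C = 1 / (real N + 1/2 - real n) ^ Suc k"
  define D where "D = 1 / (- (real N + 1/2) - real n) ^ Suc k"
  have s: "kernel_coeff \<tau> (Suc N) (Suc n) k = kernel_coeff \<tau> N (Suc n) k + (\<tau> ^ Suc N * A + \<tau> ^ N * B)"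
    "kernel_coeff \<tau> (Suc N) n k = kernel_coeff \<tau> N n k + (\<tau> ^ Suc N * C + \<tau> ^ N * D)"
    unfolding kernel_coeff_def taylor_pole_def by (simp_all only: sum.lessThan_Suc e A_def B_def C_def D_def Suc_eq_plus1[symmetric])
  have "\<tau> ^ Suc n * kernel_coeff \<tau> (Suc N) (Suc n) k - \<tau> ^ n * kernel_coeff \<tau> (Suc N) n k
      = (\<tau> ^ Suc n * kernel_coeff \<tau> N (Suc n) k - \<tau> ^ n * kernel_coeff \<tau> N n k)
       + \<tau> ^ Suc n * (\<tau> ^ Suc N * A + \<tau> ^ N * B) - \<tau> ^ n * (\<tau> ^ Suc N * C + \<tau> ^ N * D)"
    unfolding s by (simp add: algebra_simps)
  also have "\<dots> = \<tau> ^ (n + N) * (D - A) + (\<tau> * \<tau>) * \<tau> ^ (n + N) * A + \<tau> ^ (n + Suc N) * B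
      - \<tau> ^ (n + Suc N) * C - \<tau> ^ (n + N) * D"
    unfolding Suc.IH A_def[symmetric] D_def[symmetric] by (simp add: algebra_simps power_add)
  also have "\<dots> = \<tau> ^ (n + Suc N) * (B - C)"
    unfolding sign_simps(2)[OF assms] by (simp add: algebra_simps)
  finally show ?case unfolding B_def C_def e .
qed

text \<open>Both end poles have distance at least \<open>d \<ge> 1/2\<close> from \<open>n\<close>.
  One factor keeps \<open>1 / d\<close>, each of the other \<open>k\<close> costs at most
  \<open>2\<close>.\<close>

lemma abs_kernel_coeff_diff_le:
  assumes "\<tau> \<in> {1, -1}"
  shows "\<bar>\<tau> ^ Suc n * kernel_coeff \<tau> N (Suc n) k - \<tau> ^ n * kernel_coeff \<tau> N n k\<bar>
    \<le> 2 ^ Suc k * (1 / \<bar>real N - 1/2 - real n\<bar>)"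
proof -
  define d where "d = \<bar>real N - 1/2 - real n\<bar>"
  have d: "d \<ge> 1/2" using half_integer_distance by (simp add: d_def)
  have gen: "\<bar>1 / z ^ Suc k\<bar> \<le> 2 ^ k * (1 / d)" if "\<bar>z\<bar> \<ge> d" for z
  proof -
    have "(1/2) ^ k * d \<le> \<bar>z\<bar> ^ k * \<bar>z\<bar>"
      using d that by (intro mult_mono power_mono) auto
    then have le: "(1/2) ^ k * d \<le> \<bar>z ^ Suc k\<bar>" by (simp add: power_abs abs_mult mult.commute)
    have "\<bar>1 / z ^ Suc k\<bar> = 1 / \<bar>z ^ Suc k\<bar>" by (simp only: abs_divide abs_one)
    also have "\<dots> \<le> 1 / ((1/2) ^ k * d)"
      using le d by (intro divide_left_mono mult_pos_pos) (use d that in auto)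
    finally show ?thesis by (simp add: power_one_over)
  qed
  have "\<bar>1 / (- (real N + 1/2) - real n) ^ Suc k\<bar> \<le> 2 ^ k * (1 / d)"
    by (rule gen) (simp add: d_def)
  moreover have "\<bar>1 / (real N - 1/2 - real n) ^ Suc k\<bar> \<le> 2 ^ k * (1 / d)"
    by (rule gen) (simp add: d_def)
  ultimately have "\<bar>1 / (- (real N + 1/2) - real n) ^ Suc k - 1 / (real N - 1/2 - real n) ^ Suc k\<bar> \<le> 2 ^ Suc k * (1 / d)"
    unfolding power_Suc[of 2] by linarith
  then show ?thesis
    unfolding kernel_coeff_diff[OF assms] abs_mult sign_simps(3)[OF assms] d_def by simp
qed

text \<open>In the divergent case \<open>1 / (i + 1/2) - 1 / (i + 1)\<close> is twice a pair of
  consecutive terms of the alternating harmonic series; this is where \<open>2 * ln 2\<close> comes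
  from.\<close>

lemma sum_t_sgn_tendsto:
  assumes "\<sigma> \<in> {1, -1}" "m \<ge> 1"
  shows "(\<lambda>J. (\<Sum>i<J. \<sigma> ^ Suc i / (real i + 1/2) ^ m) - harm_corr m \<sigma> J) \<longlonglongrightarrow> t_sgn m \<sigma>"
proof (cases "m = 1 \<and> \<sigma> = 1")
  case True
  have "(\<Sum>i<J. \<sigma> ^ Suc i / (real i + 1/2) ^ m) - harm_corr m \<sigma> J = 2 * (\<Sum>k<2*J. (-1) ^ k / real (Suc k))" for J
    using True
  proof (induction J)
    case (Suc J)
    then have "(\<Sum>i<J. \<sigma> ^ Suc i / (real i + 1/2) ^ m) = 2 * (\<Sum>k<2*J. (-1) ^ k / real (Suc k)) + harm J"
      by (simp add: harm_corr_def)
    moreover have "1 / (real J + 1/2) - 1 / real (Suc J) = 2 * (1 / real (Suc (2 * J)) - 1 / real (Suc (Suc (2 * J))))"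
      by (simp add: divide_simps) (simp add: algebra_simps)
    ultimately show ?case using True by (simp add: harm_corr_def harm_Suc inverse_eq_divide)
  qed (simp add: harm_corr_def harm_def)
  moreover have "(\<lambda>J. 2 * (\<Sum>k<2*J. (-1) ^ k / real (Suc k))) \<longlonglongrightarrow> 2 * ln 2"
    using alternating_harmonic_series_sums unfolding sums_def
    by (intro tendsto_mult tendsto_const filterlim_compose[of "\<lambda>J. \<Sum>k<J. (-1) ^ k / real (Suc k)" _ _ "\<lambda>J. 2 * J"])
      (auto intro!: filterlim_subseq simp: strict_mono_def)
  ultimately show ?thesis using True by (simp add: t_sgn_def)
next
  case False
  then have "tail_bounded (\<lambda>i. \<sigma> ^ i / (real i + 1/2) ^ m)"
    using assms by (intro tail_bounded_const) auto
  then have "summable (\<lambda>i. \<sigma> * (\<sigma> ^ i / (real i + 1/2) ^ m))"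
    by (intro summable_mult tail_bounded_summable)
  moreover have "(\<lambda>i. \<sigma> * (\<sigma> ^ i / (real i + 1/2) ^ m)) = (\<lambda>i. \<sigma> ^ Suc i / (real (Suc i) - 1/2) ^ m)"
  proof
    fix i
    have half: "real i + 1/2 = real (Suc i) - 1/2" by simp
    show "\<sigma> * (\<sigma> ^ i / (real i + 1/2) ^ m) = \<sigma> ^ Suc i / (real (Suc i) - 1/2) ^ m" unfolding half by simp
  qed
  ultimately have "summable (\<lambda>i. \<sigma> ^ Suc i / (real (Suc i) - 1/2) ^ m)" by (simp only:)
  from summable_LIMSEQ[OF this] have "(\<lambda>J. \<Sum>i<J. \<sigma> ^ Suc i / (real (Suc i) - 1/2) ^ m) \<longlonglongrightarrow> t_sgn m \<sigma>"
    using False by (simp only: t_sgn_def if_False)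
  moreover have "real (Suc i) - 1/2 = real i + 1/2" for i by simp
  ultimately have "(\<lambda>J. \<Sum>i<J. \<sigma> ^ Suc i / (real i + 1/2) ^ m) \<longlonglongrightarrow> t_sgn m \<sigma>"
    by (simp only:)
  moreover have "harm_corr m \<sigma> J = 0" for J using False by (simp only: harm_corr_def if_False)
  ultimately show ?thesis by simp
qed

lemma sum_zeta_sgn_tendsto:
  assumes "\<sigma> \<in> {1, -1}" "r \<ge> 1"
  shows "(\<lambda>J. (\<Sum>l<J. \<sigma> ^ Suc l / real (Suc l) ^ r) - harm_corr r \<sigma> J) \<longlonglongrightarrow> zeta_sgn r \<sigma>"
proof (cases "r = 1 \<and> \<sigma> = 1")
  case True
  then have "(\<Sum>l<J. \<sigma> ^ Suc l / real (Suc l) ^ r) - harm_corr r \<sigma> J = 0" for J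
    by (simp add: harm_corr_def harm_altdef inverse_eq_divide)
  then show ?thesis using True by (simp add: zeta_sgn_def)
next
  case False
  then have "tail_bounded (\<lambda>i. \<sigma> ^ i / (real i + 1) ^ r)"
    using assms by (intro tail_bounded_const) auto
  then have "summable (\<lambda>i. \<sigma> * (\<sigma> ^ i / (real i + 1) ^ r))"
    by (intro summable_mult tail_bounded_summable)
  then show ?thesis
    using False unfolding zeta_sgn_def by (auto simp: harm_corr_def add.commute dest!: summable_LIMSEQ)
qed

text \<open>The poles \<open>i + 1/2\<close> and \<open>- (i + 1/2)\<close> contribute terms equal
  up to sign, and \<open>delta \<tau> k\<close> records whether they double or cancel.\<close>

lemma kernel_coeff_0_tendsto:
  assumes "\<tau> \<in> {1, -1}"
  shows "(\<lambda>N. kernel_coeff \<tau> N 0 k) \<longlonglongrightarrow> delta \<tau> k * t_sgn (k + 1) \<tau>"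
proof -
  have "kernel_coeff \<tau> N 0 k = delta \<tau> k * ((\<Sum>i<N. \<tau> ^ Suc i / (real i + 1/2) ^ (k + 1)) - harm_corr (k + 1) \<tau> N)" for N
  proof -
    \<comment> \<open>The correction is nonzero at most for \<open>k = 0\<close> and
      \<open>\<tau> = 1\<close>, where \<open>delta\<close> vanishes, so it may be inserted
      freely.\<close>
    have "delta \<tau> k * harm_corr (k + 1) \<tau> N = 0"
      by (auto simp: delta_def harm_corr_def)
    moreover have "\<tau> ^ Suc i * taylor_pole (real i + 1/2) 0 k + \<tau> ^ i * taylor_pole (- (real i + 1/2)) 0 k
        = delta \<tau> k * (\<tau> ^ Suc i / (real i + 1/2) ^ (k + 1))" for i
    proof -
      have "\<tau> ^ i * taylor_pole (- (real i + 1/2)) 0 k = - ((-1) ^ k * \<tau> ^ i / (real i + 1/2) ^ (k + 1))"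
        by (simp only: taylor_pole_def of_nat_0 diff_zero power_minus[of "real i + 1/2"])
          (cases "even k"; simp)
      also have "\<dots> = - (\<tau> * (-1) ^ k) * (\<tau> ^ Suc i / (real i + 1/2) ^ (k + 1))"
        using sign_simps(5)[OF assms, of "\<tau> ^ i"] by (simp add: mult.left_commute)
      finally have f: "\<tau> ^ i * taylor_pole (- (real i + 1/2)) 0 k
        = - (\<tau> * (-1) ^ k) * (\<tau> ^ Suc i / (real i + 1/2) ^ (k + 1))" .
      show ?thesis
        unfolding delta_def f by (simp add: taylor_pole_def left_diff_distrib diff_divide_distrib)
    qed
    ultimately show ?thesis
      unfolding kernel_coeff_def by (simp only: right_diff_distrib sum_distrib_left) 
  qed
  then show ?thesis
    using sum_t_sgn_tendsto[OF assms, of "k + 1"] by (simp add: tendsto_mult_left)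
qed

lemma taylor_pole_le:
  obtains C where "C \<ge> 0" "\<And>n. \<bar>taylor_pole a n k\<bar> \<le> C / real (Suc n)"
proof -
  have "(\<lambda>n. (real n + 1) * (1 / (a - real n)) * (1 / (a - real n)) ^ k) \<longlonglongrightarrow> -1 * 0 ^ k"
    by (intro tendsto_mult tendsto_power) real_asymp+
  then have "Bseq (\<lambda>n. (real n + 1) * (1 / (a - real n)) * (1 / (a - real n)) ^ k)"
    by (intro convergent_imp_Bseq convergentI)
  then obtain C where C: "C > 0" "\<And>n. norm ((real n + 1) * (1 / (a - real n)) * (1 / (a - real n)) ^ k) \<le> C"
    by (auto elim: BseqE)
  show ?thesis
  proof (rule that)
    show "C \<ge> 0" using C by simp
    fix n
    have "real (Suc n) * \<bar>taylor_pole a n k\<bar> \<le> C"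
      using C(2)[of n] by (simp add: taylor_pole_def abs_mult power_one_over add.commute)
    then show "\<bar>taylor_pole a n k\<bar> \<le> C / real (Suc n)"
      by (simp add: field_simps)
  qed
qed

lemma taylor_pole_tendsto_0: "(\<lambda>n. taylor_pole a n k) \<longlonglongrightarrow> 0"
proof -
  obtain C where C: "C \<ge> 0" "\<And>n. \<bar>taylor_pole a n k\<bar> \<le> C / real (Suc n)" using taylor_pole_le[of a k] by blast
  have "(\<lambda>n. C / real (Suc n)) \<longlonglongrightarrow> 0" by real_asymp
  then show ?thesis by (rule Lim_null_comparison[rotated]) (use C in auto)
qed

lemma kernel_coeff_tendsto_0: "(\<lambda>n. kernel_coeff \<tau> N n k) \<longlonglongrightarrow> 0"
proof -
  have "(\<lambda>n. kernel_coeff \<tau> N n k) \<longlonglongrightarrow> (\<Sum>j<N. \<tau> ^ Suc j * 0 + \<tau> ^ j * 0)"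
    unfolding kernel_coeff_def by (intro tendsto_intros taylor_pole_tendsto_0)
  then show ?thesis by simp
qed

text \<open>
  Summation by parts moves the differences onto the kernel coefficients, whose increments are
  concentrated near the truncation index.
\<close>

lemma kernel_sum_tendsto:
  assumes \<tau>: "\<tau> \<in> {1, -1}" and v: "tail_bounded v"
  shows "(\<lambda>N. \<Sum>j. \<tau> ^ Suc j * kernel_coeff \<tau> N (Suc j) k * v j)
     \<longlonglongrightarrow> delta \<tau> k * t_sgn (k + 1) \<tau> * suminf v"
proof -
  \<comment> \<open>The tails of \<open>v\<close>; \<open>V 0\<close> is the whole sum. In the limit
    only \<open>c N 0 * V 0\<close> survives, hence the Taylor coefficient at \<open>0\<close> in
    the result.\<close>
  define V where "V j = (\<Sum>i. v (i + j))" for j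
  define c where "c N j = \<tau> ^ j * kernel_coeff \<tau> N j k" for N j
  obtain C where C: "\<And>j. \<bar>V j\<bar> \<le> C / sqrt (real (Suc j))" and sv: "summable v"
    using v by (auto simp: tail_bounded_def V_def)
  have C0: "C \<ge> 0" using C[of 0] by simp
  have vV: "v j = V j - V (Suc j)" for j
    using suminf_split_head[of "\<lambda>i. v (i + j)"] sv by (simp add: V_def summable_iff_shift)
  have VJ: "V \<longlonglongrightarrow> 0"
  proof (rule Lim_null_comparison)
    show "(\<lambda>j. C / sqrt (real (Suc j))) \<longlonglongrightarrow> 0" by real_asymp
  qed (use C in auto)
  have cJ: "c N \<longlonglongrightarrow> 0" for N
  proof -
    have "(\<lambda>j. norm (kernel_coeff \<tau> N j k)) \<longlonglongrightarrow> 0"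
      using kernel_coeff_tendsto_0 tendsto_norm_zero by blast
    moreover have "norm (c N j) = norm (kernel_coeff \<tau> N j k)" for j
      by (simp add: c_def abs_mult sign_simps[OF \<tau>])
    ultimately show ?thesis by (intro tendsto_norm_zero_cancel[of "c N"]) (simp only:)
  qed
  let ?w = "\<lambda>N j. 1 / (sqrt (real (Suc j)) * \<bar>real N - 1/2 - real j\<bar>)"
  have dw: "norm ((c N (Suc j) - c N j) * V j) \<le> 2 ^ Suc k * C * ?w N j" for N j
  proof -
    have "norm ((c N (Suc j) - c N j) * V j) \<le> (2 ^ Suc k * (1 / \<bar>real N - 1/2 - real j\<bar>)) * (C / sqrt (real (Suc j)))"
      unfolding c_def real_norm_def abs_mult[of _ "V j"]
      using abs_kernel_coeff_diff_le[OF \<tau>] C by (intro mult_mono) auto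
    then show ?thesis by (simp add: mult_ac)
  qed
  have sw: "summable (\<lambda>j. 2 ^ Suc k * C * ?w N j)" for N
    by (intro summable_mult convolution_tendsto_0)
  have sd: "summable (\<lambda>j. (c N (Suc j) - c N j) * V j)" for N
    using dw by (intro summable_comparison_test'[OF sw[of N], where N = 0])
  have "(\<lambda>j. c N (Suc j) * v j) sums (c N 0 * V 0 + (\<Sum>j. (c N (Suc j) - c N j) * V j))" for N
  proof -
    \<comment> \<open>Abel summation; the boundary term at \<open>J\<close> vanishes in the limit
      because both factors tend to zero.\<close>
    have part: "(\<Sum>j<J. c N (Suc j) * v j)
        = c N 0 * V 0 + (\<Sum>j<J. (c N (Suc j) - c N j) * V j) - c N J * V J" for J
      by (induction J) (simp_all add: vV algebra_simps)
    have "(\<lambda>J. c N 0 * V 0 + (\<Sum>j<J. (c N (Suc j) - c N j) * V j) - c N J * V J)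
        \<longlonglongrightarrow> c N 0 * V 0 + (\<Sum>j. (c N (Suc j) - c N j) * V j) - 0 * 0"
      by (intro tendsto_intros summable_LIMSEQ sd cJ VJ)
    then show ?thesis by (simp add: sums_def part)
  qed
  then have eq: "(\<Sum>j. c N (Suc j) * v j) = c N 0 * V 0 + (\<Sum>j. (c N (Suc j) - c N j) * V j)" for N
    by (simp add: sums_iff)
  have "(\<lambda>N. \<Sum>j. (c N (Suc j) - c N j) * V j) \<longlonglongrightarrow> 0"
  proof (rule Lim_null_comparison)
    show "(\<lambda>N. 2 ^ Suc k * C * (\<Sum>j. ?w N j)) \<longlonglongrightarrow> 0"
      by (intro tendsto_mult_right_zero convolution_tendsto_0)
    have "norm (\<Sum>j. (c N (Suc j) - c N j) * V j) \<le> (\<Sum>j. 2 ^ Suc k * C * ?w N j)" for N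
      by (intro norm_suminf_le dw sw)
    then have "norm (\<Sum>j. (c N (Suc j) - c N j) * V j) \<le> 2 ^ Suc k * C * (\<Sum>j. ?w N j)" for N
      by (simp only: suminf_mult[OF convolution_tendsto_0(1)])
    then show "\<forall>\<^sub>F N in sequentially. norm (\<Sum>j. (c N (Suc j) - c N j) * V j) \<le> 2 ^ Suc k * C * (\<Sum>j. ?w N j)"
      by (intro always_eventually allI)
  qed
  moreover have "(\<lambda>N. c N 0 * V 0) \<longlonglongrightarrow> delta \<tau> k * t_sgn (k + 1) \<tau> * suminf v"
    using kernel_coeff_0_tendsto[OF \<tau>, of k] by (auto simp: c_def V_def intro!: tendsto_intros)
  ultimately have "(\<lambda>N. c N 0 * V 0 + (\<Sum>j. (c N (Suc j) - c N j) * V j))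
     \<longlonglongrightarrow> delta \<tau> k * t_sgn (k + 1) \<tau> * suminf v + 0"
    by (intro tendsto_add)
  then show ?thesis unfolding eq[symmetric] by (simp add: c_def)
qed

section \<open>Limits of truncated pole sums\<close>

lemma H_num_lessThan: "H_num r \<sigma> n = (\<Sum>l<n. \<sigma> ^ l / real (Suc l) ^ r)"
  unfolding H_num_def One_nat_def sum.atLeast1_atMost_eq by simp

lemma h_num_lessThan: "h_num r \<sigma> n = (\<Sum>l<n. \<sigma> ^ l / (real l + 1/2) ^ r)"
proof -
  have "real (Suc l) - 1/2 = real l + 1/2" for l by simp
  then show ?thesis
    unfolding h_num_def One_nat_def sum.atLeast1_atMost_eq by (simp only:) simp
qed

lemma sign_power_diff:
  assumes "\<sigma> \<in> {1, -1::real}" "l \<le> n"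
  shows "\<sigma> ^ (n - l) = \<sigma> ^ n * \<sigma> ^ l"
proof -
  have "\<sigma> ^ n = \<sigma> ^ (n - l) * \<sigma> ^ l" using assms by (simp flip: power_add)
  then show ?thesis using sign_simps(4)[OF assms(1), of l] by (simp add: mult.assoc)
qed

lemma sign_harm_corr: "\<sigma> ^ n * harm_corr r \<sigma> M = harm_corr r \<sigma> M"
  by (auto simp: harm_corr_def)

text \<open>The terms below \<open>n\<close>, read downwards from \<open>n - 1\<close>, form
  \<open>H_num\<close>; those above \<open>n\<close> are a zeta series cut off at
  \<open>M - n\<close>. In the divergent case the latter needs the harmonic number of
  \<open>M - n\<close> instead of \<open>M\<close>, which accounts for the last difference.\<close>

lemma reg_sum_eq:
  assumes \<sigma>: "\<sigma> \<in> {1, -1}" and "n \<le> M"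
  shows "reg_sum r \<sigma> M n = \<sigma> ^ n * (((\<Sum>l<M - n. \<sigma> ^ Suc l / real (Suc l) ^ r) - harm_corr r \<sigma> (M - n))
      + (-1) ^ r * \<sigma> * H_num r \<sigma> n) + (harm_corr r \<sigma> (M - n) - harm_corr r \<sigma> M)"
proof -
  let ?f = "\<lambda>k. \<sigma> ^ k / (real k - real n) ^ r"
  have split: "{..M} - {n} = {..<n} \<union> {Suc n..<Suc M}" using assms(2) by auto
  have "sum ?f ({..M} - {n}) = sum ?f {..<n} + sum ?f {Suc n..<Suc M}"
    unfolding split by (rule sum.union_disjoint) auto
  also have "sum ?f {..<n} = (\<Sum>l<n. ?f (n - Suc l))" by (rule sum.nat_diff_reindex[symmetric])
  also have "\<dots> = (\<Sum>l<n. \<sigma> ^ n * ((-1) ^ r * \<sigma> * (\<sigma> ^ l / real (Suc l) ^ r)))"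
  proof (rule sum.cong)
    fix l assume "l \<in> {..<n}"
    then have l: "Suc l \<le> n" by simp
    then have "real (n - Suc l) - real n = - real (Suc l)" by (simp add: of_nat_diff)
    moreover have "1 / (- real (Suc l)) ^ r = (-1) ^ r * (1 / real (Suc l) ^ r)"
      unfolding power_minus[of "real (Suc l)"] by (cases "even r") simp_all
    moreover have "\<sigma> ^ (n - Suc l) / x = \<sigma> ^ n * (\<sigma> * \<sigma> ^ l) * (1 / x)" for x
      using sign_power_diff[OF \<sigma> l] by simp
    ultimately show "?f (n - Suc l) = \<sigma> ^ n * ((-1) ^ r * \<sigma> * (\<sigma> ^ l / real (Suc l) ^ r))"
      by (simp only:) simp
  qed simp
  also have "\<dots> = \<sigma> ^ n * ((-1) ^ r * \<sigma> * H_num r \<sigma> n)"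
    by (simp only: H_num_lessThan sum_distrib_left)
  also have "sum ?f {Suc n..<Suc M} = (\<Sum>l<M - n. ?f (l + Suc n))"
    using assms sum.shift_bounds_nat_ivl[of ?f 0 "Suc n" "M - n"] by (simp add: atLeast0LessThan)
  also have "\<dots> = (\<Sum>l<M - n. \<sigma> ^ n * (\<sigma> ^ Suc l / real (Suc l) ^ r))"
    by (rule sum.cong) (simp_all add: power_add)
  also have "\<dots> = \<sigma> ^ n * (\<Sum>l<M - n. \<sigma> ^ Suc l / real (Suc l) ^ r)"
    by (simp only: sum_distrib_left)
  finally show ?thesis
    by (simp add: reg_sum_def right_diff_distrib distrib_left sign_harm_corr)
qed

text \<open>Uniform in \<open>J\<close>, since \<open>1 / (J + n + 1) \<le> 1 / (n + 1)\<close>;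
  domination in the truncation index rests on this.\<close>

lemma harm_diff_bounds: "0 \<le> harm (J + n) - (harm J :: real) \<and> harm (J + n) - harm J \<le> 2 * sqrt (real n)"
proof (induction n)
  case (Suc n)
  have "1 / real (Suc (J + n)) \<le> 1 / real (Suc n)"
    by (intro divide_left_mono) auto
  moreover have "1 / real (Suc (J + n)) \<ge> 0" by simp
  moreover have "harm (J + Suc n) = harm (J + n) + 1 / real (Suc (J + n))"
    by (simp add: harm_Suc inverse_eq_divide)
  moreover have "0 \<le> x - z \<and> x - z \<le> 2 * t"
    if "a \<le> b" "0 \<le> a" "x = y + a" "0 \<le> y - z \<and> y - z \<le> 2 * s" "b \<le> 2 * (t - s)" for a b x y z s t :: real
    using that by auto
  ultimately show ?case
    using Suc inverse_le_sqrt_diff[of n] by blast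
qed simp

lemma abs_harm_corr_diff_le:
  assumes "n \<le> M"
  shows "\<bar>harm_corr r \<sigma> (M - n) - harm_corr r \<sigma> M\<bar> \<le> 2 * sqrt (real n)"
  using harm_diff_bounds[of "M - n" n] assms by (auto simp: harm_corr_def)

lemma harm_corr_diff_tendsto_0: "(\<lambda>J. harm_corr r \<sigma> J - harm_corr r \<sigma> (J + n)) \<longlonglongrightarrow> 0"
proof (induction n)
  case (Suc n)
  have "(\<lambda>J. 1 / real (Suc (J + n))) \<longlonglongrightarrow> 0" by real_asymp
  from tendsto_diff[OF Suc this] show ?case
    by (cases "r = 1 \<and> \<sigma> = 1")
      (auto simp: harm_corr_def harm_Suc inverse_eq_divide diff_diff_eq add.commute)
qed simp

text \<open>Limit of \<open>reg_sum\<close> for growing truncation.\<close>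

definition reg_lim :: "nat \<Rightarrow> real \<Rightarrow> nat \<Rightarrow> real" where
  "reg_lim r \<sigma> n = \<sigma> ^ n * (zeta_sgn r \<sigma> + (-1) ^ r * \<sigma> * H_num r \<sigma> n)"

lemma reg_sum_tendsto:
  assumes \<sigma>: "\<sigma> \<in> {1, -1}" and "r \<ge> 1"
  shows "(\<lambda>M. reg_sum r \<sigma> M n) \<longlonglongrightarrow> reg_lim r \<sigma> n"
proof (rule LIMSEQ_offset[of _ n])
  have "(\<lambda>J. \<sigma> ^ n * (((\<Sum>l<J. \<sigma> ^ Suc l / real (Suc l) ^ r) - harm_corr r \<sigma> J)
      + (-1) ^ r * \<sigma> * H_num r \<sigma> n) + (harm_corr r \<sigma> J - harm_corr r \<sigma> (J + n)))
      \<longlonglongrightarrow> \<sigma> ^ n * (zeta_sgn r \<sigma> + (-1) ^ r * \<sigma> * H_num r \<sigma> n) + 0"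
    by (intro tendsto_intros sum_zeta_sgn_tendsto harm_corr_diff_tendsto_0 assms)
  then show "(\<lambda>J. reg_sum r \<sigma> (J + n) n) \<longlonglongrightarrow> reg_lim r \<sigma> n"
    by (simp add: reg_sum_eq[OF \<sigma>] reg_lim_def)
qed

text \<open>The bound must not depend on \<open>M\<close>: the zeta part is a convergent, hence
  bounded, sequence taken at \<open>M - n\<close>, and the rest grows no faster than harmonic
  numbers.\<close>

lemma reg_sum_bounded:
  assumes \<sigma>: "\<sigma> \<in> {1, -1}" and r: "r \<ge> 1"
  obtains C where "\<And>M n. n \<le> M \<Longrightarrow> \<bar>reg_sum r \<sigma> M n\<bar> \<le> C * sqrt (real (Suc n))"
proof -
  define Z where "Z J = (\<Sum>l<J. \<sigma> ^ Suc l / real (Suc l) ^ r) - harm_corr r \<sigma> J" for J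
  have "Bseq Z"
    using sum_zeta_sgn_tendsto[OF assms] unfolding Z_def[symmetric] by (intro convergent_imp_Bseq convergentI)
  then obtain D where D: "D > 0" "\<And>J. norm (Z J) \<le> D" by (auto elim: BseqE)
  show ?thesis
  proof (rule that)
    fix M n :: nat assume "n \<le> M"
    have eq: "reg_sum r \<sigma> M n = \<sigma> ^ n * (Z (M - n) + (-1) ^ r * \<sigma> * H_num r \<sigma> n)
        + (harm_corr r \<sigma> (M - n) - harm_corr r \<sigma> M)"
      using reg_sum_eq[OF \<sigma> \<open>n \<le> M\<close>] by (simp only: Z_def)
    have "\<bar>reg_sum r \<sigma> M n\<bar> \<le> \<bar>\<sigma> ^ n * (Z (M - n) + (-1) ^ r * \<sigma> * H_num r \<sigma> n)\<bar>
        + \<bar>harm_corr r \<sigma> (M - n) - harm_corr r \<sigma> M\<bar>"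
      unfolding eq by (rule abs_triangle_ineq)
    also have "\<bar>\<sigma> ^ n * (Z (M - n) + (-1) ^ r * \<sigma> * H_num r \<sigma> n)\<bar> = \<bar>Z (M - n) + (-1) ^ r * \<sigma> * H_num r \<sigma> n\<bar>"
      by (simp add: abs_mult sign_simps[OF \<sigma>])
    also have "\<dots> \<le> \<bar>Z (M - n)\<bar> + \<bar>(-1) ^ r * \<sigma> * H_num r \<sigma> n\<bar>" by (rule abs_triangle_ineq)
    also have "\<bar>(-1) ^ r * \<sigma> * H_num r \<sigma> n\<bar> = \<bar>H_num r \<sigma> n\<bar>"
      by (simp add: abs_mult sign_simps[OF \<sigma>] power_abs)
    finally have "\<bar>reg_sum r \<sigma> M n\<bar> \<le> D + 2 * sqrt (real n) + 2 * sqrt (real n)"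
      using D(2)[of "M - n"] abs_H_num_le[OF assms, of n] abs_harm_corr_diff_le[OF \<open>n \<le> M\<close>, of r \<sigma>]
      by simp
    also have "\<dots> \<le> D * sqrt (real (Suc n)) + 2 * sqrt (real (Suc n)) + 2 * sqrt (real (Suc n))"
      using D(1) by (intro add_mono mult_left_mono) (auto simp: mult_le_cancel_left1)
    finally show "\<bar>reg_sum r \<sigma> M n\<bar> \<le> (D + 4) * sqrt (real (Suc n))"
      by (simp add: algebra_simps)
  qed
qed

text \<open>There are \<open>j + 1\<close> natural numbers below \<open>j + 1/2\<close>, hence
  \<open>Suc j\<close> here but \<open>j\<close> at the opposite point \<open>- (j + 1/2)\<close>.
  The surplus term of \<open>h_num\<close> later produces the linear sums of exponents
  \<open>p + q\<close> and \<open>m + q\<close>.\<close>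

lemma pole_sum_pos_tendsto:
  assumes \<sigma>: "\<sigma> \<in> {1, -1}" and m: "m \<ge> 1"
  shows "(\<lambda>M. pole_sum m \<sigma> M (real j + 1/2)) \<longlonglongrightarrow> \<sigma> ^ j * (t_sgn m \<sigma> + (-1) ^ m * h_num m \<sigma> (Suc j))"
proof (rule LIMSEQ_offset[of _ j])
  have eq: "pole_sum m \<sigma> (J + j) (real j + 1/2) = \<sigma> ^ j * (((\<Sum>i<J. \<sigma> ^ Suc i / (real i + 1/2) ^ m) - harm_corr m \<sigma> J)
      + (-1) ^ m * h_num m \<sigma> (Suc j)) + (harm_corr m \<sigma> J - harm_corr m \<sigma> (J + j))" for J
  proof -
    let ?f = "\<lambda>k. \<sigma> ^ k / (real k - (real j + 1/2)) ^ m"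
    have split: "{..J + j} = {..<Suc j} \<union> {Suc j..<Suc (J + j)}" by auto
    have "sum ?f {..J + j} = sum ?f {..<Suc j} + sum ?f {Suc j..<Suc (J + j)}"
      unfolding split by (rule sum.union_disjoint) auto
    also have "sum ?f {..<Suc j} = (\<Sum>l<Suc j. ?f (Suc j - Suc l))" by (rule sum.nat_diff_reindex[symmetric])
    also have "\<dots> = (\<Sum>l<Suc j. \<sigma> ^ j * ((-1) ^ m * (\<sigma> ^ l / (real l + 1/2) ^ m)))"
    proof (rule sum.cong)
      fix l assume "l \<in> {..<Suc j}"
      then have l: "l \<le> j" by simp
      then have "real (Suc j - Suc l) - (real j + 1/2) = - (real l + 1/2)" by (simp add: of_nat_diff)
      moreover have "1 / (- (real l + 1/2)) ^ m = (-1) ^ m * (1 / (real l + 1/2) ^ m)"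
        unfolding power_minus[of "real l + 1/2"] by (cases "even m") simp_all
      moreover have "\<sigma> ^ (Suc j - Suc l) / x = \<sigma> ^ j * \<sigma> ^ l * (1 / x)" for x
        using sign_power_diff[OF \<sigma> l] by simp
      ultimately show "?f (Suc j - Suc l) = \<sigma> ^ j * ((-1) ^ m * (\<sigma> ^ l / (real l + 1/2) ^ m))"
        by (simp only:) simp
    qed simp
    also have "\<dots> = \<sigma> ^ j * ((-1) ^ m * h_num m \<sigma> (Suc j))"
      by (simp only: h_num_lessThan sum_distrib_left)
    also have "sum ?f {Suc j..<Suc (J + j)} = (\<Sum>l<J. ?f (l + Suc j))"
      using sum.shift_bounds_nat_ivl[of ?f 0 "Suc j" J] by (simp add: atLeast0LessThan)
    also have "\<dots> = (\<Sum>l<J. \<sigma> ^ j * (\<sigma> ^ Suc l / (real l + 1/2) ^ m))"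
    proof (rule sum.cong)
      fix l
      have "real (l + Suc j) - (real j + 1/2) = real l + 1/2" by simp
      then show "?f (l + Suc j) = \<sigma> ^ j * (\<sigma> ^ Suc l / (real l + 1/2) ^ m)"
        by (simp only: power_add) simp
    qed simp
    also have "\<dots> = \<sigma> ^ j * (\<Sum>l<J. \<sigma> ^ Suc l / (real l + 1/2) ^ m)"
      by (simp only: sum_distrib_left)
    finally show ?thesis
      by (simp add: pole_sum_def right_diff_distrib distrib_left sign_harm_corr)
  qed
  have "(\<lambda>J. \<sigma> ^ j * (((\<Sum>i<J. \<sigma> ^ Suc i / (real i + 1/2) ^ m) - harm_corr m \<sigma> J)
      + (-1) ^ m * h_num m \<sigma> (Suc j)) + (harm_corr m \<sigma> J - harm_corr m \<sigma> (J + j)))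
    \<longlonglongrightarrow> \<sigma> ^ j * (t_sgn m \<sigma> + (-1) ^ m * h_num m \<sigma> (Suc j)) + 0"
    by (intro tendsto_intros sum_t_sgn_tendsto harm_corr_diff_tendsto_0 assms)
  then show "(\<lambda>J. pole_sum m \<sigma> (J + j) (real j + 1/2)) \<longlonglongrightarrow> \<sigma> ^ j * (t_sgn m \<sigma> + (-1) ^ m * h_num m \<sigma> (Suc j))"
    by (simp only: eq add_0_right)
qed

text \<open>All differences \<open>k + j + 1/2\<close> are positive: this is the full series without
  its first \<open>j\<close> terms. The extra \<open>\<sigma>\<close> arises because
  \<open>t_sgn\<close> starts with \<open>\<sigma> ^ 1\<close> and \<open>h_num\<close> with
  \<open>\<sigma> ^ 0\<close>.\<close>

lemma pole_sum_neg_tendsto: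
  assumes \<sigma>: "\<sigma> \<in> {1, -1}" and m: "m \<ge> 1"
  shows "(\<lambda>M. pole_sum m \<sigma> M (- (real j + 1/2))) \<longlonglongrightarrow> \<sigma> ^ j * (\<sigma> * t_sgn m \<sigma> - h_num m \<sigma> j)"
proof -
  have eq: "pole_sum m \<sigma> M (- (real j + 1/2)) = \<sigma> ^ j * (\<sigma> * ((\<Sum>i<M + Suc j. \<sigma> ^ Suc i / (real i + 1/2) ^ m)
      - harm_corr m \<sigma> (M + Suc j)) - h_num m \<sigma> j) - (harm_corr m \<sigma> M - harm_corr m \<sigma> (M + Suc j))" for M
  proof -
    let ?g = "\<lambda>i. \<sigma> ^ i / (real i + 1/2) ^ m"
    have "(\<Sum>k\<le>M. \<sigma> ^ k / (real k - - (real j + 1/2)) ^ m) = (\<Sum>k<Suc M. \<sigma> ^ j * ?g (k + j))"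
      unfolding lessThan_Suc_atMost
    proof (rule sum.cong)
      fix k
      have "real k - - (real j + 1/2) = real (k + j) + 1/2" by simp
      then show "\<sigma> ^ k / (real k - - (real j + 1/2)) ^ m = \<sigma> ^ j * ?g (k + j)"
        by (simp only: power_add) (simp add: mult.left_commute sign_simps[OF \<sigma>])
    qed simp
    also have "\<dots> = \<sigma> ^ j * (\<Sum>k<Suc M. ?g (k + j))" by (simp only: sum_distrib_left)
    also have "(\<Sum>k<Suc M. ?g (k + j)) = sum ?g {j..<M + Suc j}"
      using sum.shift_bounds_nat_ivl[of ?g 0 j "Suc M"] by (simp add: atLeast0LessThan)
    also have "\<dots> = sum ?g {..<M + Suc j} - sum ?g {..<j}"
      by (subst sum_diff[symmetric]) (auto intro!: sum.cong)
    also have "sum ?g {..<j} = h_num m \<sigma> j" by (simp only: h_num_lessThan)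
    also have "sum ?g {..<M + Suc j} = \<sigma> * (\<Sum>i<M + Suc j. \<sigma> ^ Suc i / (real i + 1/2) ^ m)"
      by (simp only: sum_distrib_left times_divide_eq_right power_Suc sign_simps(5)[OF \<sigma>])
    moreover have "\<sigma> ^ j * (\<sigma> * harm_corr m \<sigma> K) = harm_corr m \<sigma> K" for K
      using sign_harm_corr[of \<sigma> "Suc j"] by (simp add: mult_ac)
    ultimately show ?thesis
      by (simp add: pole_sum_def right_diff_distrib)
  qed
  have "(\<lambda>M. \<sigma> ^ j * (\<sigma> * ((\<Sum>i<M + Suc j. \<sigma> ^ Suc i / (real i + 1/2) ^ m)
      - harm_corr m \<sigma> (M + Suc j)) - h_num m \<sigma> j) - (harm_corr m \<sigma> M - harm_corr m \<sigma> (M + Suc j)))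
    \<longlonglongrightarrow> \<sigma> ^ j * (\<sigma> * t_sgn m \<sigma> - h_num m \<sigma> j) - 0"
    by (intro tendsto_intros harm_corr_diff_tendsto_0 LIMSEQ_ignore_initial_segment[OF sum_t_sgn_tendsto] assms)
  then show ?thesis by (simp only: eq diff_0_right)
qed

text \<open>Tannery's theorem. The growth \<open>sqrt j\<close> of the weights meets one power of
  decay from \<open>taylor_pole\<close> and one from \<open>e \<ge> 1\<close>, so
  \<open>j powr (-3/2)\<close> dominates.\<close>

lemma weighted_sum_tendsto:
  assumes e: "e \<ge> 1" and lim: "\<And>n. (\<lambda>M. w M n) \<longlonglongrightarrow> W n"
    and bound: "\<And>M n. n \<le> M \<Longrightarrow> \<bar>w M n\<bar> \<le> C * sqrt (real (Suc n))"
  shows "summable (\<lambda>j. W (Suc j) * taylor_pole a (Suc j) k / real (Suc j) ^ e)"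
    and "(\<lambda>M. \<Sum>n=1..M. w M n * taylor_pole a n k / real n ^ e)
      \<longlonglongrightarrow> (\<Sum>j. W (Suc j) * taylor_pole a (Suc j) k / real (Suc j) ^ e)"
proof -
  define f where "f j M = (if Suc j \<le> M then w M (Suc j) * taylor_pole a (Suc j) k / real (Suc j) ^ e else 0)" for j M
  obtain D where D: "D \<ge> 0" "\<And>n. \<bar>taylor_pole a n k\<bar> \<le> D / real (Suc n)"
    using taylor_pole_le[of a k] by blast
  have C: "C \<ge> 0" using bound[of 0 0] by simp
  have flim: "(\<lambda>M. f j M) \<longlonglongrightarrow> W (Suc j) * taylor_pole a (Suc j) k / real (Suc j) ^ e" for j
  proof (rule Lim_transform_eventually)
    show "(\<lambda>M. w M (Suc j) * taylor_pole a (Suc j) k / real (Suc j) ^ e)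
        \<longlonglongrightarrow> W (Suc j) * taylor_pole a (Suc j) k / real (Suc j) ^ e"
      by (intro tendsto_intros lim) auto
    show "\<forall>\<^sub>F M in sequentially. w M (Suc j) * taylor_pole a (Suc j) k / real (Suc j) ^ e = f j M"
      using eventually_ge_at_top[of "Suc j"] by eventually_elim (simp add: f_def)
  qed
  have fb: "norm (f j M) \<le> C * D / (real (Suc j) * sqrt (real (Suc j)))" for j M
  proof (cases "Suc j \<le> M")
    case True
    have "real (Suc j) \<le> real (Suc j) ^ e" using e by (intro self_le_power) auto
    then have "norm (f j M) \<le> (C * sqrt (real (Suc (Suc j)))) * (D / real (Suc (Suc j))) / real (Suc j)"
      using True bound[of "Suc j" M] D(2)[of "Suc j"] C D(1)
      by (simp only: f_def if_True real_norm_def abs_mult abs_divide)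
        (intro frac_le mult_mono mult_nonneg_nonneg divide_nonneg_nonneg; simp)
    also have "\<dots> = C * D / real (Suc j) * (sqrt (real (Suc (Suc j))) / real (Suc (Suc j)))"
      by (simp only: times_divide_eq_right times_divide_eq_left divide_divide_eq_left mult_ac)
    also have "sqrt (real (Suc (Suc j))) / real (Suc (Suc j)) = 1 / sqrt (real (Suc (Suc j)))"
      by (rule sqrt_divide_self_eq[THEN trans]) (auto simp: inverse_eq_divide)
    also have "C * D / real (Suc j) * (1 / sqrt (real (Suc (Suc j)))) \<le> C * D / real (Suc j) * (1 / sqrt (real (Suc j)))"
      using C D(1) by (intro mult_left_mono divide_left_mono) auto
    finally show ?thesis by simp
  next
    case False
    then show ?thesis using C D(1) by (simp add: f_def)
  qed
  have "tail_bounded (\<lambda>j. C * D / (real (Suc j) * sqrt (real (Suc j))))"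
    using C D(1) by (intro tail_bounded_powr[where C = "C * D"]) auto
  then have s: "summable (\<lambda>j. C * D / (real (Suc j) * sqrt (real (Suc j))))" by (rule tail_bounded_summable)
  have "eventually (\<lambda>(j, M). norm (f j M) \<le> C * D / (real (Suc j) * sqrt (real (Suc j)))) (at_top \<times>\<^sub>F at_top)"
    using fb by (intro always_eventually) auto
  from tannerys_theorem[OF flim this s]
  have T: "summable (\<lambda>j. norm (W (Suc j) * taylor_pole a (Suc j) k / real (Suc j) ^ e))"
    "(\<lambda>M. \<Sum>j. f j M) \<longlonglongrightarrow> (\<Sum>j. W (Suc j) * taylor_pole a (Suc j) k / real (Suc j) ^ e)"
    by auto
  show "summable (\<lambda>j. W (Suc j) * taylor_pole a (Suc j) k / real (Suc j) ^ e)"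
    using T(1) by (rule summable_norm_cancel)
  have "(\<Sum>j. f j M) = (\<Sum>n=1..M. w M n * taylor_pole a n k / real n ^ e)" for M
  proof -
    have "(\<Sum>j. f j M) = (\<Sum>j<M. f j M)"
      by (rule suminf_finite) (auto simp: f_def)
    also have "\<dots> = (\<Sum>j<M. w M (Suc j) * taylor_pole a (Suc j) k / real (Suc j) ^ e)"
      by (rule sum.cong) (auto simp: f_def)
    finally show ?thesis unfolding One_nat_def sum.atLeast1_atMost_eq .
  qed
  with T(2) show "(\<lambda>M. \<Sum>n=1..M. w M n * taylor_pole a n k / real n ^ e)
      \<longlonglongrightarrow> (\<Sum>j. W (Suc j) * taylor_pole a (Suc j) k / real (Suc j) ^ e)" by simp
qed

section \<open>Summation over the half-integers\<close>

text \<open>The coefficient \<open>taylor_pow\<close> without its power of \<open>n\<close>, which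
  moves into the series over \<open>n\<close>.\<close>

definition pow_coeff :: "nat \<Rightarrow> nat \<Rightarrow> real" where
  "pow_coeff q l = (-1) ^ l * real ((q + l - 1) choose l)"

text \<open>
  The sum over all \<open>n\<close> of the residues, linear in the contribution of the kernel: \<open>E\<close> holds its Taylor
  coefficients at \<open>0\<close>, while \<open>X\<close>, \<open>XB\<close> and \<open>XA\<close> hold the series over \<open>n \<ge> 1\<close> formed with its \<open>k\<close>-th Taylor
  coefficient at \<open>n\<close> and with \<open>n\<^sup>-\<^sup>e\<close>.
\<close>

definition residue_total ::
  "nat \<Rightarrow> nat \<Rightarrow> nat \<Rightarrow> (nat \<Rightarrow> real) \<Rightarrow> (nat \<Rightarrow> real) \<Rightarrow> (nat \<Rightarrow> real) \<Rightarrow>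
   (nat \<Rightarrow> nat \<Rightarrow> real) \<Rightarrow> (nat \<Rightarrow> nat \<Rightarrow> nat \<Rightarrow> real) \<Rightarrow> (nat \<Rightarrow> nat \<Rightarrow> nat \<Rightarrow> real) \<Rightarrow> real" where
  "residue_total m p q A B E X XB XA =
     (-1) ^ (m + p) * E (m + p + q - 1) + (-1) ^ m * conv2 B E (m + q - 1)
     + (-1) ^ p * conv2 A E (p + q - 1) + conv3 A B E (q - 1)
     + (-1) ^ (m + p) * (\<Sum>k=0..m + p - 1. pow_coeff q (m + p - 1 - k) * X k (q + (m + p - 1 - k)))
     + (-1) ^ m * (\<Sum>i=0..m - 1. \<Sum>k=0..m - 1 - i. real ((p + i - 1) choose i) *
         (pow_coeff q (m - 1 - i - k) * XB i k (q + (m - 1 - i - k))))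
     + (-1) ^ p * (\<Sum>i=0..p - 1. \<Sum>k=0..p - 1 - i. real ((m + i - 1) choose i) *
         (pow_coeff q (p - 1 - i - k) * XA i k (q + (p - 1 - i - k))))"

lemma residue_total_zero: "residue_total m p q A B (\<lambda>_. 0) (\<lambda>_ _. 0) (\<lambda>_ _ _. 0) (\<lambda>_ _ _. 0) = 0"
  by (simp add: residue_total_def conv2_def conv3_def)

lemma conv2_lincomb: "conv2 f (\<lambda>k. u k + c * v k + d * w k) n = conv2 f u n + c * conv2 f v n + d * conv2 f w n"
  by (simp add: conv2_def algebra_simps sum.distrib sum_distrib_left)

lemma conv3_lincomb:
  "conv3 f g (\<lambda>k. u k + c * v k + d * w k) n = conv3 f g u n + c * conv3 f g v n + d * conv3 f g w n"
  unfolding conv3_def conv2_lincomb by (simp add: algebra_simps sum.distrib sum_distrib_left)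

lemma residue_total_lincomb:
  "residue_total m p q A B (\<lambda>k. E k + c * E' k + d * E'' k) (\<lambda>k e. X k e + c * X' k e + d * X'' k e)
     (\<lambda>i k e. XB i k e + c * XB' i k e + d * XB'' i k e) (\<lambda>i k e. XA i k e + c * XA' i k e + d * XA'' i k e)
   = residue_total m p q A B E X XB XA + c * residue_total m p q A B E' X' XB' XA'
     + d * residue_total m p q A B E'' X'' XB'' XA''"
proof -
  have s: "(\<Sum>i\<in>I. z i * (x i + c * y i + d * w i)) = (\<Sum>i\<in>I. z i * x i) + c * (\<Sum>i\<in>I. z i * y i) + d * (\<Sum>i\<in>I. z i * w i)"
    for z x y w :: "nat \<Rightarrow> real" and I
    by (simp add: algebra_simps sum.distrib sum_distrib_left)
  have t: "(\<Sum>i\<in>I. x i + c * y i + d * w i) = (\<Sum>i\<in>I. x i) + c * (\<Sum>i\<in>I. y i) + d * (\<Sum>i\<in>I. w i)"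
    for x y w :: "nat \<Rightarrow> real" and I
    by (simp add: sum.distrib sum_distrib_left)
  show ?thesis
    unfolding residue_total_def conv2_lincomb conv3_lincomb mult.assoc[symmetric, of "real _" "pow_coeff _ _"] s t
    by (simp add: algebra_simps)
qed

lemma residue_total_sum:
  fixes N :: nat
  shows
  "(\<Sum>j<N. c j * residue_total m p q A B (E j) (X j) (XB j) (XA j) + d j * residue_total m p q A B (E' j) (X' j) (XB' j) (XA' j))
   = residue_total m p q A B (\<lambda>k. \<Sum>j<N. c j * E j k + d j * E' j k) (\<lambda>k e. \<Sum>j<N. c j * X j k e + d j * X' j k e)
     (\<lambda>i k e. \<Sum>j<N. c j * XB j i k e + d j * XB' j i k e) (\<lambda>i k e. \<Sum>j<N. c j * XA j i k e + d j * XA' j i k e)"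
proof (induction N)
  case 0
  then show ?case by (simp add: residue_total_zero)
next
  case (Suc N)
  then show ?case by (simp add: residue_total_lincomb flip: add.assoc)
qed

lemma residue_total_tendsto:
  assumes "\<And>i. (\<lambda>N. A N i) \<longlonglongrightarrow> A' i" "\<And>i. (\<lambda>N. B N i) \<longlonglongrightarrow> B' i" "\<And>k. (\<lambda>N. E N k) \<longlonglongrightarrow> E' k"
    "\<And>k e. e \<ge> q \<Longrightarrow> (\<lambda>N. X N k e) \<longlonglongrightarrow> X' k e"
    "\<And>i k e. e \<ge> q \<Longrightarrow> (\<lambda>N. XB N i k e) \<longlonglongrightarrow> XB' i k e"
    "\<And>i k e. e \<ge> q \<Longrightarrow> (\<lambda>N. XA N i k e) \<longlonglongrightarrow> XA' i k e"
  shows "(\<lambda>N. residue_total m p q (A N) (B N) (E N) (X N) (XB N) (XA N))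
    \<longlonglongrightarrow> residue_total m p q A' B' E' X' XB' XA'"
  unfolding residue_total_def conv2_def conv3_def by (intro tendsto_intros assms) auto

lemma residue_at_pos:
  assumes "n \<ge> 1"
  shows "residue_at m p q \<sigma>\<^sub>1 \<sigma>\<^sub>2 a M n =
     (-1) ^ (m + p) * (\<Sum>k=0..m + p - 1. pow_coeff q (m + p - 1 - k) *
        ((\<sigma>\<^sub>1 * \<sigma>\<^sub>2) ^ n * taylor_pole a n k / real n ^ (q + (m + p - 1 - k))))
     + (-1) ^ m * (\<Sum>i=0..m - 1. \<Sum>k=0..m - 1 - i. real ((p + i - 1) choose i) * (pow_coeff q (m - 1 - i - k) *
        (\<sigma>\<^sub>1 ^ n * reg_sum (p + i) \<sigma>\<^sub>2 M n * taylor_pole a n k / real n ^ (q + (m - 1 - i - k)))))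
     + (-1) ^ p * (\<Sum>i=0..p - 1. \<Sum>k=0..p - 1 - i. real ((m + i - 1) choose i) * (pow_coeff q (p - 1 - i - k) *
        (\<sigma>\<^sub>2 ^ n * reg_sum (m + i) \<sigma>\<^sub>1 M n * taylor_pole a n k / real n ^ (q + (p - 1 - i - k)))))"
proof -
  have c2: "x * conv2 (taylor_pole a n) (taylor_pow q n) d
      = (\<Sum>k=0..d. pow_coeff q (d - k) * (x * taylor_pole a n k / real n ^ (q + (d - k))))" for x d
    unfolding conv2_def sum_distrib_left by (rule sum.cong) (simp_all add: taylor_pow_def pow_coeff_def)
  have c3: "x * conv3 (taylor_reg r \<sigma> M n) (taylor_pole a n) (taylor_pow q n) d
      = (\<Sum>i=0..d. \<Sum>k=0..d - i. real ((r + i - 1) choose i) * (pow_coeff q (d - i - k) *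
        (x * reg_sum (r + i) \<sigma> M n * taylor_pole a n k / real n ^ (q + (d - i - k)))))" for x r \<sigma> d
    unfolding conv3_def c2 sum_distrib_left by (intro sum.cong refl) (simp add: taylor_reg_def)
  have "residue_at m p q \<sigma>\<^sub>1 \<sigma>\<^sub>2 a M n =
     (-1) ^ (m + p) * ((\<sigma>\<^sub>1 * \<sigma>\<^sub>2) ^ n * conv2 (taylor_pole a n) (taylor_pow q n) (m + p - 1))
     + (-1) ^ m * (\<sigma>\<^sub>1 ^ n * conv3 (taylor_reg p \<sigma>\<^sub>2 M n) (taylor_pole a n) (taylor_pow q n) (m - 1))
     + (-1) ^ p * (\<sigma>\<^sub>2 ^ n * conv3 (taylor_reg m \<sigma>\<^sub>1 M n) (taylor_pole a n) (taylor_pow q n) (p - 1))"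
    using assms by (simp add: residue_at_def Let_def)
  then show ?thesis unfolding c2 c3 .
qed

lemma sum_residue_at_eq_total:
  "(\<Sum>n\<le>M. residue_at m p q \<sigma>\<^sub>1 \<sigma>\<^sub>2 a M n) =
   residue_total m p q (taylor_reg m \<sigma>\<^sub>1 M 0) (taylor_reg p \<sigma>\<^sub>2 M 0) (taylor_pole a 0)
     (\<lambda>k e. \<Sum>n=1..M. (\<sigma>\<^sub>1 * \<sigma>\<^sub>2) ^ n * taylor_pole a n k / real n ^ e)
     (\<lambda>i k e. \<Sum>n=1..M. \<sigma>\<^sub>1 ^ n * reg_sum (p + i) \<sigma>\<^sub>2 M n * taylor_pole a n k / real n ^ e)
     (\<lambda>i k e. \<Sum>n=1..M. \<sigma>\<^sub>2 ^ n * reg_sum (m + i) \<sigma>\<^sub>1 M n * taylor_pole a n k / real n ^ e)"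
proof -
  let ?r = "residue_at m p q \<sigma>\<^sub>1 \<sigma>\<^sub>2 a M"
  have "(\<Sum>n\<le>M. ?r n) = ?r 0 + (\<Sum>n=1..M. ?r n)"
    by (simp add: sum.atLeast1_atMost_eq sum.atMost_shift lessThan_Suc_atMost[symmetric] sum.lessThan_Suc_shift del: sum.lessThan_Suc)
  also have "(\<Sum>n=1..M. ?r n) = 
     (-1) ^ (m + p) * (\<Sum>n=1..M. \<Sum>k=0..m + p - 1. pow_coeff q (m + p - 1 - k) *
        ((\<sigma>\<^sub>1 * \<sigma>\<^sub>2) ^ n * taylor_pole a n k / real n ^ (q + (m + p - 1 - k))))
     + (-1) ^ m * (\<Sum>n=1..M. \<Sum>i=0..m - 1. \<Sum>k=0..m - 1 - i. real ((p + i - 1) choose i) * (pow_coeff q (m - 1 - i - k) *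
        (\<sigma>\<^sub>1 ^ n * reg_sum (p + i) \<sigma>\<^sub>2 M n * taylor_pole a n k / real n ^ (q + (m - 1 - i - k)))))
     + (-1) ^ p * (\<Sum>n=1..M. \<Sum>i=0..p - 1. \<Sum>k=0..p - 1 - i. real ((m + i - 1) choose i) * (pow_coeff q (p - 1 - i - k) *
        (\<sigma>\<^sub>2 ^ n * reg_sum (m + i) \<sigma>\<^sub>1 M n * taylor_pole a n k / real n ^ (q + (p - 1 - i - k)))))"
    (is "_ = _ * ?S1 + _ * ?S2 + _ * ?S3")
    unfolding sum_distrib_left[of "(-1) ^ _" _ "{1..M}"] sum.distrib[symmetric]
    by (rule sum.cong[OF refl], rule residue_at_pos) simp
  also have "?S1 = (\<Sum>k=0..m + p - 1. pow_coeff q (m + p - 1 - k) *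
        (\<Sum>n=1..M. (\<sigma>\<^sub>1 * \<sigma>\<^sub>2) ^ n * taylor_pole a n k / real n ^ (q + (m + p - 1 - k))))"
    by (subst sum.swap) (simp only: sum_distrib_left)
  also have "?S2 = (\<Sum>i=0..m - 1. \<Sum>k=0..m - 1 - i. real ((p + i - 1) choose i) * (pow_coeff q (m - 1 - i - k) *
        (\<Sum>n=1..M. \<sigma>\<^sub>1 ^ n * reg_sum (p + i) \<sigma>\<^sub>2 M n * taylor_pole a n k / real n ^ (q + (m - 1 - i - k)))))"
    by (subst sum.swap, rule sum.cong[OF refl], subst sum.swap) (simp only: sum_distrib_left)
  also have "?S3 = (\<Sum>i=0..p - 1. \<Sum>k=0..p - 1 - i. real ((m + i - 1) choose i) * (pow_coeff q (p - 1 - i - k) *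
        (\<Sum>n=1..M. \<sigma>\<^sub>2 ^ n * reg_sum (m + i) \<sigma>\<^sub>1 M n * taylor_pole a n k / real n ^ (q + (p - 1 - i - k)))))"
    by (subst sum.swap, rule sum.cong[OF refl], subst sum.swap) (simp only: sum_distrib_left)
  moreover have "?r 0 = (-1) ^ (m + p) * taylor_pole a 0 (m + p + q - 1)
      + (-1) ^ m * conv2 (taylor_reg p \<sigma>\<^sub>2 M 0) (taylor_pole a 0) (m + q - 1)
      + (-1) ^ p * conv2 (taylor_reg m \<sigma>\<^sub>1 M 0) (taylor_pole a 0) (p + q - 1)
      + conv3 (taylor_reg m \<sigma>\<^sub>1 M 0) (taylor_reg p \<sigma>\<^sub>2 M 0) (taylor_pole a 0) (q - 1)"
    by (simp add: residue_at_def Let_def)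
  ultimately show ?thesis
    by (simp only: residue_total_def add.assoc)
qed

section \<open>Removal of the truncation, and summation of the kernel\<close>

definition pole_series :: "(nat \<Rightarrow> real) \<Rightarrow> real \<Rightarrow> nat \<Rightarrow> nat \<Rightarrow> real" where
  "pole_series W a k e = (\<Sum>j. W (Suc j) * taylor_pole a (Suc j) k / real (Suc j) ^ e)"

text \<open>Limit of \<open>taylor_reg\<close> at \<open>n = 0\<close>.\<close>

definition zeta_coeff :: "nat \<Rightarrow> real \<Rightarrow> nat \<Rightarrow> real" where
  "zeta_coeff m \<sigma> i = real ((m + i - 1) choose i) * zeta_sgn (m + i) \<sigma>"

lemma reg_lim_0: "reg_lim r \<sigma> 0 = zeta_sgn r \<sigma>"
  by (simp add: reg_lim_def H_num_def)

lemma sign_mult: "\<sigma>\<^sub>1 \<in> {1, -1::real} \<Longrightarrow> \<sigma>\<^sub>2 \<in> {1, -1} \<Longrightarrow> \<sigma>\<^sub>1 * \<sigma>\<^sub>2 \<in> {1, -1}"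
  by auto

lemma weighted_sign_tendsto:
  assumes "\<rho> \<in> {1, -1}" "e \<ge> 1"
  shows "summable (\<lambda>j. \<rho> ^ Suc j * taylor_pole a (Suc j) k / real (Suc j) ^ e)"
    and "(\<lambda>M. \<Sum>n=1..M. \<rho> ^ n * taylor_pole a n k / real n ^ e) \<longlonglongrightarrow> pole_series (\<lambda>n. \<rho> ^ n) a k e"
  using weighted_sum_tendsto[of e "\<lambda>M n. \<rho> ^ n" "\<lambda>n. \<rho> ^ n" 1 a k] assms
  by (simp_all add: pole_series_def sign_simps)

lemma weighted_reg_sum_tendsto:
  assumes \<rho>: "\<rho> \<in> {1, -1}" and \<sigma>: "\<sigma> \<in> {1, -1}" and "r \<ge> 1" "e \<ge> 1"
  shows "summable (\<lambda>j. \<rho> ^ Suc j * reg_lim r \<sigma> (Suc j) * taylor_pole a (Suc j) k / real (Suc j) ^ e)"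
    and "(\<lambda>M. \<Sum>n=1..M. \<rho> ^ n * reg_sum r \<sigma> M n * taylor_pole a n k / real n ^ e)
      \<longlonglongrightarrow> pole_series (\<lambda>n. \<rho> ^ n * reg_lim r \<sigma> n) a k e"
proof -
  obtain C where C: "\<And>M n. n \<le> M \<Longrightarrow> \<bar>reg_sum r \<sigma> M n\<bar> \<le> C * sqrt (real (Suc n))"
    using reg_sum_bounded[OF \<sigma> \<open>r \<ge> 1\<close>] by blast
  have b: "\<bar>\<rho> ^ n * reg_sum r \<sigma> M n\<bar> \<le> C * sqrt (real (Suc n))" if "n \<le> M" for M n
    using C[OF that] by (simp add: abs_mult sign_simps[OF \<rho>])
  have l: "(\<lambda>M. \<rho> ^ n * reg_sum r \<sigma> M n) \<longlonglongrightarrow> \<rho> ^ n * reg_lim r \<sigma> n" for n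
    by (intro tendsto_intros reg_sum_tendsto assms)
  show "summable (\<lambda>j. \<rho> ^ Suc j * reg_lim r \<sigma> (Suc j) * taylor_pole a (Suc j) k / real (Suc j) ^ e)"
    by (rule weighted_sum_tendsto(1)[OF \<open>e \<ge> 1\<close> l b])
  show "(\<lambda>M. \<Sum>n=1..M. \<rho> ^ n * reg_sum r \<sigma> M n * taylor_pole a n k / real n ^ e)
      \<longlonglongrightarrow> pole_series (\<lambda>n. \<rho> ^ n * reg_lim r \<sigma> n) a k e"
    unfolding pole_series_def by (rule weighted_sum_tendsto(2)[OF \<open>e \<ge> 1\<close> l b])
qed

text \<open>The finite residue identity for a single pole \<open>a\<close>, with the truncation of
  the pole sums removed.\<close>

lemma pole_product_expansion:
  fixes a :: real
  assumes mpq: "m \<ge> 1" "p \<ge> 1" "q \<ge> 1" and \<sigma>: "\<sigma>\<^sub>1 \<in> {1, -1}" "\<sigma>\<^sub>2 \<in> {1, -1}"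
    and a: "\<And>n. a \<noteq> real n"
    and \<alpha>: "(\<lambda>M. pole_sum m \<sigma>\<^sub>1 M a) \<longlonglongrightarrow> \<alpha>" and \<beta>: "(\<lambda>M. pole_sum p \<sigma>\<^sub>2 M a) \<longlonglongrightarrow> \<beta>"
  shows "\<alpha> * \<beta> / a ^ q = residue_total m p q (zeta_coeff m \<sigma>\<^sub>1) (zeta_coeff p \<sigma>\<^sub>2) (taylor_pole a 0)
     (pole_series (\<lambda>n. (\<sigma>\<^sub>1 * \<sigma>\<^sub>2) ^ n) a) (\<lambda>i. pole_series (\<lambda>n. \<sigma>\<^sub>1 ^ n * reg_lim (p + i) \<sigma>\<^sub>2 n) a)
     (\<lambda>i. pole_series (\<lambda>n. \<sigma>\<^sub>2 ^ n * reg_lim (m + i) \<sigma>\<^sub>1 n) a)"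
proof (rule LIMSEQ_unique)
  have "a ^ q \<noteq> 0" using a[of 0] by simp
  then show "(\<lambda>M. pole_sum m \<sigma>\<^sub>1 M a * pole_sum p \<sigma>\<^sub>2 M a / a ^ q) \<longlonglongrightarrow> \<alpha> * \<beta> / a ^ q"
    by (intro tendsto_intros \<alpha> \<beta>)
  have tr: "(\<lambda>M. taylor_reg r \<sigma> M 0 i) \<longlonglongrightarrow> zeta_coeff r \<sigma> i" if "r \<ge> 1" "\<sigma> \<in> {1, -1}" for r \<sigma> i
    unfolding taylor_reg_def zeta_coeff_def reg_lim_0[symmetric]
    by (intro tendsto_intros reg_sum_tendsto) (use that in auto)
  show "(\<lambda>M. pole_sum m \<sigma>\<^sub>1 M a * pole_sum p \<sigma>\<^sub>2 M a / a ^ q) \<longlonglongrightarrow>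
    residue_total m p q (zeta_coeff m \<sigma>\<^sub>1) (zeta_coeff p \<sigma>\<^sub>2) (taylor_pole a 0)
     (pole_series (\<lambda>n. (\<sigma>\<^sub>1 * \<sigma>\<^sub>2) ^ n) a) (\<lambda>i. pole_series (\<lambda>n. \<sigma>\<^sub>1 ^ n * reg_lim (p + i) \<sigma>\<^sub>2 n) a)
     (\<lambda>i. pole_series (\<lambda>n. \<sigma>\<^sub>2 ^ n * reg_lim (m + i) \<sigma>\<^sub>1 n) a)"
    unfolding sum_residue_at[OF mpq a, symmetric] sum_residue_at_eq_total
    by (intro residue_total_tendsto tr tendsto_const weighted_sign_tendsto(2) weighted_reg_sum_tendsto(2) sign_mult)
      (use mpq \<sigma> in auto)
qed

lemma pole_series_kernel_sum:
  assumes "\<And>a. summable (\<lambda>j. W (Suc j) * taylor_pole a (Suc j) k / real (Suc j) ^ e)"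
  shows "(\<Sum>j<N. \<tau> ^ Suc j * pole_series W (real j + 1/2) k e + \<tau> ^ j * pole_series W (- (real j + 1/2)) k e)
    = (\<Sum>n. W (Suc n) * kernel_coeff \<tau> N (Suc n) k / real (Suc n) ^ e)"
proof -
  let ?y = "\<lambda>a n. W (Suc n) * taylor_pole a (Suc n) k / real (Suc n) ^ e"
  have "(\<lambda>n. \<Sum>j<N. \<tau> ^ Suc j * ?y (real j + 1/2) n + \<tau> ^ j * ?y (- (real j + 1/2)) n) sums
    (\<Sum>j<N. \<tau> ^ Suc j * pole_series W (real j + 1/2) k e + \<tau> ^ j * pole_series W (- (real j + 1/2)) k e)"
    unfolding pole_series_def by (intro sums_sum sums_add sums_mult summable_sums assms)
  moreover have "(\<Sum>j<N. \<tau> ^ Suc j * ?y (real j + 1/2) n + \<tau> ^ j * ?y (- (real j + 1/2)) n)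
    = W (Suc n) * kernel_coeff \<tau> N (Suc n) k / real (Suc n) ^ e" for n
    unfolding kernel_coeff_def sum_distrib_left sum_divide_distrib
    by (rule sum.cong) (simp_all add: distrib_left add_divide_distrib mult_ac)
  ultimately show ?thesis by (simp add: sums_iff)
qed

text \<open>The factor \<open>\<tau> ^ Suc n\<close> is inserted twice, its square being
  \<open>1\<close>: once to steady the kernel coefficients, once to turn the weights into a series
  with controlled tails.\<close>

lemma pole_series_kernel_tendsto:
  assumes \<tau>: "\<tau> \<in> {1, -1}" and s: "\<And>a. summable (\<lambda>j. W (Suc j) * taylor_pole a (Suc j) k / real (Suc j) ^ e)"
    and tb: "tail_bounded (\<lambda>j. \<tau> ^ Suc j * W (Suc j) / real (Suc j) ^ e)"
    and L: "(\<lambda>j. \<tau> ^ Suc j * W (Suc j) / real (Suc j) ^ e) sums L"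
  shows "(\<lambda>N. \<Sum>j<N. \<tau> ^ Suc j * pole_series W (real j + 1/2) k e + \<tau> ^ j * pole_series W (- (real j + 1/2)) k e)
    \<longlonglongrightarrow> delta \<tau> k * t_sgn (k + 1) \<tau> * L"
proof -
  have "W (Suc n) * kernel_coeff \<tau> N (Suc n) k / real (Suc n) ^ e
    = \<tau> ^ Suc n * kernel_coeff \<tau> N (Suc n) k * (\<tau> ^ Suc n * W (Suc n) / real (Suc n) ^ e)" for n N
  proof -
    have "t * x * (t * y / z) = t * (t * (y * x / z))" for t x y z :: real
      by simp
    then show ?thesis by (simp only: sign_simps(6)[OF \<tau>])
  qed
  then show ?thesis
    using kernel_sum_tendsto[OF \<tau> tb, of k] L by (simp only: pole_series_kernel_sum[OF s] sums_iff)
qed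

text \<open>\<open>\<tau>\<close> times \<open>\<sigma>\<^sub>1 * \<sigma>\<^sub>2\<close> is
  \<open>\<sigma>\<^sub>3\<close>, so convergence depends on the pair
  \<open>(e, \<sigma>\<^sub>3)\<close> alone.\<close>

lemma sign_quotient_series:
  assumes \<sigma>: "\<sigma>\<^sub>1 \<in> {1, -1}" "\<sigma>\<^sub>2 \<in> {1, -1}" "\<sigma>\<^sub>3 \<in> {1, -1}" and e: "e \<ge> 1" "(e, \<sigma>\<^sub>3) \<noteq> (1, 1)"
    and \<tau>: "\<tau> = \<sigma>\<^sub>1 * \<sigma>\<^sub>2 * \<sigma>\<^sub>3"
  shows "tail_bounded (\<lambda>j. \<tau> ^ Suc j * (\<sigma>\<^sub>1 * \<sigma>\<^sub>2) ^ Suc j / real (Suc j) ^ e)"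
    and "(\<lambda>j. \<tau> ^ Suc j * (\<sigma>\<^sub>1 * \<sigma>\<^sub>2) ^ Suc j / real (Suc j) ^ e) sums zeta_sgn e \<sigma>\<^sub>3"
proof -
  have "\<tau> ^ Suc j * (\<sigma>\<^sub>1 * \<sigma>\<^sub>2) ^ Suc j = \<sigma>\<^sub>3 ^ Suc j" for j
    unfolding \<tau> power_mult_distrib[symmetric] using \<sigma> by auto
  then have eq: "\<tau> ^ Suc j * (\<sigma>\<^sub>1 * \<sigma>\<^sub>2) ^ Suc j / real (Suc j) ^ e = \<sigma>\<^sub>3 ^ j * \<sigma>\<^sub>3 / (real j + 1) ^ e" for j
    by (simp add: add.commute)
  have "tail_bounded (\<lambda>j. \<sigma>\<^sub>3 ^ j * \<sigma>\<^sub>3 / (real j + 1) ^ e)"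
    by (rule tail_bounded_sign_series[where C = 1]) (use \<sigma> e in auto)
  then show "tail_bounded (\<lambda>j. \<tau> ^ Suc j * (\<sigma>\<^sub>1 * \<sigma>\<^sub>2) ^ Suc j / real (Suc j) ^ e)"
    by (simp only: eq)
  then have "(\<lambda>j. \<tau> ^ Suc j * (\<sigma>\<^sub>1 * \<sigma>\<^sub>2) ^ Suc j / real (Suc j) ^ e) sums
     (\<Sum>j. \<tau> ^ Suc j * (\<sigma>\<^sub>1 * \<sigma>\<^sub>2) ^ Suc j / real (Suc j) ^ e)"
    by (intro summable_sums tail_bounded_summable)
  moreover have "zeta_sgn e \<sigma>\<^sub>3 = (\<Sum>j. \<sigma>\<^sub>3 ^ j * \<sigma>\<^sub>3 / (real j + 1) ^ e)"
    using e by (auto simp: zeta_sgn_def add.commute mult.commute)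
  ultimately show "(\<lambda>j. \<tau> ^ Suc j * (\<sigma>\<^sub>1 * \<sigma>\<^sub>2) ^ Suc j / real (Suc j) ^ e) sums zeta_sgn e \<sigma>\<^sub>3"
    by (simp only: eq)
qed

text \<open>The two parts of \<open>reg_lim\<close> yield a product of zeta values and an
  \<open>S_lin\<close>. The factor \<open>\<sigma>\<^sub>3\<close> adjusts the exponent:
  \<open>S_lin\<close> starts with \<open>\<sigma>\<^sub>3 ^ 0\<close>, the series with
  \<open>\<sigma>\<^sub>3 ^ 1\<close>.\<close>

lemma reg_lim_series:
  assumes \<sigma>: "\<sigma>\<^sub>1 \<in> {1, -1}" "\<sigma>\<^sub>2 \<in> {1, -1}" "\<sigma>\<^sub>3 \<in> {1, -1}" and e: "e \<ge> 1" "(e, \<sigma>\<^sub>3) \<noteq> (1, 1)"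
    and \<tau>: "\<tau> = \<sigma>\<^sub>1 * \<sigma>\<^sub>2 * \<sigma>\<^sub>3" and r: "r \<ge> 1"
  shows "tail_bounded (\<lambda>j. \<tau> ^ Suc j * (\<sigma>\<^sub>1 ^ Suc j * reg_lim r \<sigma>\<^sub>2 (Suc j)) / real (Suc j) ^ e)"
    and "(\<lambda>j. \<tau> ^ Suc j * (\<sigma>\<^sub>1 ^ Suc j * reg_lim r \<sigma>\<^sub>2 (Suc j)) / real (Suc j) ^ e)
      sums (zeta_sgn r \<sigma>\<^sub>2 * zeta_sgn e \<sigma>\<^sub>3 + (-1) ^ r * \<sigma>\<^sub>2 * \<sigma>\<^sub>3 * S_lin r e \<sigma>\<^sub>2 \<sigma>\<^sub>3)"
proof -
  let ?z = "\<lambda>j. \<tau> ^ Suc j * (\<sigma>\<^sub>1 * \<sigma>\<^sub>2) ^ Suc j / real (Suc j) ^ e"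
  let ?s = "\<lambda>j. \<sigma>\<^sub>3 ^ j * H_num r \<sigma>\<^sub>2 (Suc j) / real (Suc j) ^ e"
  let ?c = "(-1) ^ r * \<sigma>\<^sub>2 * \<sigma>\<^sub>3"
  have sg: "\<tau> ^ Suc j * (\<sigma>\<^sub>1 * \<sigma>\<^sub>2) ^ Suc j = \<sigma>\<^sub>3 ^ Suc j" for j
    unfolding \<tau> power_mult_distrib[symmetric] using \<sigma> by auto
  have eq: "\<tau> ^ Suc j * (\<sigma>\<^sub>1 ^ Suc j * reg_lim r \<sigma>\<^sub>2 (Suc j)) / real (Suc j) ^ e
      = zeta_sgn r \<sigma>\<^sub>2 * ?z j + ?c * ?s j" for j
  proof -
    have "\<tau> ^ Suc j * (\<sigma>\<^sub>1 ^ Suc j * reg_lim r \<sigma>\<^sub>2 (Suc j))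
      = (\<tau> ^ Suc j * (\<sigma>\<^sub>1 * \<sigma>\<^sub>2) ^ Suc j) * (zeta_sgn r \<sigma>\<^sub>2 + (-1) ^ r * \<sigma>\<^sub>2 * H_num r \<sigma>\<^sub>2 (Suc j))"
      by (simp only: reg_lim_def power_mult_distrib mult.assoc)
    also have "\<dots> = zeta_sgn r \<sigma>\<^sub>2 * (\<tau> ^ Suc j * (\<sigma>\<^sub>1 * \<sigma>\<^sub>2) ^ Suc j) + ?c * (\<sigma>\<^sub>3 ^ j * H_num r \<sigma>\<^sub>2 (Suc j))"
      unfolding sg by (simp add: algebra_simps)
    finally show ?thesis by (simp only: add_divide_distrib times_divide_eq_right)
  qed
  have ts: "tail_bounded ?s" by (rule tail_bounded_H_num) (use \<sigma> e r in auto)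
  show "tail_bounded (\<lambda>j. \<tau> ^ Suc j * (\<sigma>\<^sub>1 ^ Suc j * reg_lim r \<sigma>\<^sub>2 (Suc j)) / real (Suc j) ^ e)"
    unfolding eq by (intro tail_bounded_add tail_bounded_cmult ts sign_quotient_series(1)) fact+
  have "?s sums S_lin r e \<sigma>\<^sub>2 \<sigma>\<^sub>3"
    unfolding S_lin_def by (intro summable_sums tail_bounded_summable ts)
  from this show "(\<lambda>j. \<tau> ^ Suc j * (\<sigma>\<^sub>1 ^ Suc j * reg_lim r \<sigma>\<^sub>2 (Suc j)) / real (Suc j) ^ e)
      sums (zeta_sgn r \<sigma>\<^sub>2 * zeta_sgn e \<sigma>\<^sub>3 + (-1) ^ r * \<sigma>\<^sub>2 * \<sigma>\<^sub>3 * S_lin r e \<sigma>\<^sub>2 \<sigma>\<^sub>3)"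
    unfolding eq by (intro sums_add sums_mult sign_quotient_series(2)[OF \<sigma> e \<tau>])
qed

definition kernel_lim :: "real \<Rightarrow> nat \<Rightarrow> real" where
  "kernel_lim \<tau> k = delta \<tau> k * t_sgn (k + 1) \<tau>"

definition mixed_series :: "nat \<Rightarrow> real \<Rightarrow> real \<Rightarrow> nat \<Rightarrow> real" where
  "mixed_series r \<sigma> \<sigma>' e = zeta_sgn r \<sigma> * zeta_sgn e \<sigma>' + (-1) ^ r * \<sigma> * \<sigma>' * S_lin r e \<sigma> \<sigma>'"

lemma half_integer_neq_nat: "real j + 1/2 \<noteq> real n" "- (real j + 1/2) \<noteq> real n"
  using half_integer_distance[of "Suc j" n] unfolding of_nat_Suc by linarith+

text \<open>The single-pole identities at \<open>j + 1/2\<close> and \<open>- (j + 1/2)\<close>,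
  weighted with the residue signs of the kernel and added up. Linearity turns each finite sum into
  one \<open>residue_total\<close> of the truncated kernel, which then has a limit.\<close>

lemma half_integer_series_sums:
  assumes mpq: "m \<ge> 1" "p \<ge> 1" "q \<ge> 1"
    and \<sigma>: "\<sigma>\<^sub>1 \<in> {1, -1}" "\<sigma>\<^sub>2 \<in> {1, -1}" "\<sigma>\<^sub>3 \<in> {1, -1}" and q: "(q, \<sigma>\<^sub>3) \<noteq> (1, 1)"
    and \<tau>: "\<tau> = \<sigma>\<^sub>1 * \<sigma>\<^sub>2 * \<sigma>\<^sub>3"
  shows "(\<lambda>j. \<tau> ^ Suc j * ((\<sigma>\<^sub>1 ^ j * (t_sgn m \<sigma>\<^sub>1 + (-1) ^ m * h_num m \<sigma>\<^sub>1 (Suc j)))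
         * (\<sigma>\<^sub>2 ^ j * (t_sgn p \<sigma>\<^sub>2 + (-1) ^ p * h_num p \<sigma>\<^sub>2 (Suc j))) / (real j + 1/2) ^ q)
      + \<tau> ^ j * ((\<sigma>\<^sub>1 ^ j * (\<sigma>\<^sub>1 * t_sgn m \<sigma>\<^sub>1 - h_num m \<sigma>\<^sub>1 j))
         * (\<sigma>\<^sub>2 ^ j * (\<sigma>\<^sub>2 * t_sgn p \<sigma>\<^sub>2 - h_num p \<sigma>\<^sub>2 j)) / (- (real j + 1/2)) ^ q))
    sums residue_total m p q (zeta_coeff m \<sigma>\<^sub>1) (zeta_coeff p \<sigma>\<^sub>2) (kernel_lim \<tau>)
      (\<lambda>k e. kernel_lim \<tau> k * zeta_sgn e \<sigma>\<^sub>3)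
      (\<lambda>i k e. kernel_lim \<tau> k * mixed_series (p + i) \<sigma>\<^sub>2 \<sigma>\<^sub>3 e)
      (\<lambda>i k e. kernel_lim \<tau> k * mixed_series (m + i) \<sigma>\<^sub>1 \<sigma>\<^sub>3 e)"
proof -
  have \<tau>s: "\<tau> \<in> {1, -1}" unfolding \<tau> by (intro sign_mult \<sigma>)
  have \<tau>': "\<tau> = \<sigma>\<^sub>2 * \<sigma>\<^sub>1 * \<sigma>\<^sub>3" by (simp add: \<tau>)
  have e: "e \<ge> 1" "(e, \<sigma>\<^sub>3) \<noteq> (1, 1)" if "e \<ge> q" for e
    using that mpq q by auto
  have kl: "(\<lambda>N. \<Sum>j<N. \<tau> ^ Suc j * taylor_pole (real j + 1/2) 0 k + \<tau> ^ j * taylor_pole (- (real j + 1/2)) 0 k)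
      \<longlonglongrightarrow> kernel_lim \<tau> k" for k
    using kernel_coeff_0_tendsto[OF \<tau>s, of k] by (simp only: kernel_coeff_def kernel_lim_def)
  show ?thesis
    unfolding sums_def
      pole_product_expansion[OF mpq \<sigma>(1,2) half_integer_neq_nat(1)
        pole_sum_pos_tendsto[OF \<sigma>(1) mpq(1)] pole_sum_pos_tendsto[OF \<sigma>(2) mpq(2)]]
      pole_product_expansion[OF mpq \<sigma>(1,2) half_integer_neq_nat(2)
        pole_sum_neg_tendsto[OF \<sigma>(1) mpq(1)] pole_sum_neg_tendsto[OF \<sigma>(2) mpq(2)]]
      residue_total_sum
  proof (intro residue_total_tendsto tendsto_const kl)
    fix k e assume "e \<ge> q"
    note e = e[OF this]
    show "(\<lambda>N. \<Sum>j<N. \<tau> ^ Suc j * pole_series (\<lambda>n. (\<sigma>\<^sub>1 * \<sigma>\<^sub>2) ^ n) (real j + 1/2) k e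
        + \<tau> ^ j * pole_series (\<lambda>n. (\<sigma>\<^sub>1 * \<sigma>\<^sub>2) ^ n) (- (real j + 1/2)) k e) \<longlonglongrightarrow> kernel_lim \<tau> k * zeta_sgn e \<sigma>\<^sub>3"
      unfolding kernel_lim_def
      by (intro pole_series_kernel_tendsto[OF \<tau>s weighted_sign_tendsto(1)] sign_mult sign_quotient_series[OF \<sigma> e \<tau>] e \<sigma>)
    fix i
    have r: "p + i \<ge> 1" "m + i \<ge> 1" using mpq by auto
    show "(\<lambda>N. \<Sum>j<N. \<tau> ^ Suc j * pole_series (\<lambda>n. \<sigma>\<^sub>1 ^ n * reg_lim (p + i) \<sigma>\<^sub>2 n) (real j + 1/2) k e
        + \<tau> ^ j * pole_series (\<lambda>n. \<sigma>\<^sub>1 ^ n * reg_lim (p + i) \<sigma>\<^sub>2 n) (- (real j + 1/2)) k e)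
        \<longlonglongrightarrow> kernel_lim \<tau> k * mixed_series (p + i) \<sigma>\<^sub>2 \<sigma>\<^sub>3 e"
      unfolding kernel_lim_def mixed_series_def
      by (intro pole_series_kernel_tendsto[OF \<tau>s weighted_reg_sum_tendsto(1)] reg_lim_series[OF \<sigma> e \<tau>] e \<sigma> r)
    show "(\<lambda>N. \<Sum>j<N. \<tau> ^ Suc j * pole_series (\<lambda>n. \<sigma>\<^sub>2 ^ n * reg_lim (m + i) \<sigma>\<^sub>1 n) (real j + 1/2) k e
        + \<tau> ^ j * pole_series (\<lambda>n. \<sigma>\<^sub>2 ^ n * reg_lim (m + i) \<sigma>\<^sub>1 n) (- (real j + 1/2)) k e)
        \<longlonglongrightarrow> kernel_lim \<tau> k * mixed_series (m + i) \<sigma>\<^sub>1 \<sigma>\<^sub>3 e"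
      unfolding kernel_lim_def mixed_series_def
      by (intro pole_series_kernel_tendsto[OF \<tau>s weighted_reg_sum_tendsto(1)] reg_lim_series[OF \<sigma>(2,1,3) e \<tau>'] e \<sigma> r)
  qed
qed

section \<open>The quadratic sums\<close>

lemma sum_from_1: "n \<ge> 1 \<Longrightarrow> (\<Sum>j=1..n. f j) = (\<Sum>i=0..n - 1. f (Suc i))" for n :: nat
  by (cases n) (simp_all only: One_nat_def sum.shift_bounds_cl_Suc_ivl diff_Suc_1, simp)

lemma choose_pred: "r \<ge> 1 \<Longrightarrow> (r + i - 1) choose (r - 1) = (r + i - 1) choose i"
  by (subst binomial_symmetric) auto

text \<open>The kernel coefficient vanishes unless \<open>(-1) ^ k = - \<tau>\<close>.\<close>

lemma kernel_lim_sign: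
  assumes "\<tau> \<in> {1, -1}" "k \<le> d"
  shows "(-1) ^ (d - k) * kernel_lim \<tau> k = - \<tau> * (-1) ^ d * kernel_lim \<tau> k"
proof -
  have "(-1) ^ (d - k) = (-1) ^ d * (-1::real) ^ k"
    using assms(2) by (intro sign_power_diff) auto
  moreover have "(-1) ^ k * kernel_lim \<tau> k = - \<tau> * kernel_lim \<tau> k"
    using assms(1) by (cases "even k") (auto simp: kernel_lim_def delta_def)
  ultimately show ?thesis by (simp add: mult.assoc)
qed

text \<open>The alternating sign in \<open>pow_coeff\<close> depends on \<open>k\<close>, but on the
  support of the kernel coefficients it is the constant
  \<open>\<tau> * (-1) ^ (m + p)\<close>.\<close>

lemma G3_eq:
  assumes "m \<ge> 1" "p \<ge> 1" "q \<ge> 1" and \<tau>: "\<tau> \<in> {1, -1}" "\<tau> = \<sigma>\<^sub>1 * \<sigma>\<^sub>2 * \<sigma>\<^sub>3"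
  shows "(\<Sum>k=0..m + p - 1. pow_coeff q (m + p - 1 - k) * (kernel_lim \<tau> k * zeta_sgn (q + (m + p - 1 - k)) \<sigma>\<^sub>3))
    = G3 m p q \<sigma>\<^sub>1 \<sigma>\<^sub>2 \<sigma>\<^sub>3"
  unfolding G3_def Let_def \<tau>(2)[symmetric] sum_distrib_left
proof (rule sum.cong[OF refl])
  fix k assume "k \<in> {0..m + p - 1}"
  then have k: "k \<le> m + p - 1" by simp
  have e: "q + (m + p - 1 - k) = m + p + q - k - 1" "m + p + q - k - 1 - 1 = m + p + q - k - 2"
    using k assms by simp_all
  have "pow_coeff q (m + p - 1 - k) * (kernel_lim \<tau> k * zeta_sgn (q + (m + p - 1 - k)) \<sigma>\<^sub>3)
    = real ((q + (m + p - 1 - k) - 1) choose (q - 1)) * ((-1) ^ (m + p - 1 - k) * kernel_lim \<tau> k)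
      * zeta_sgn (q + (m + p - 1 - k)) \<sigma>\<^sub>3"
    unfolding choose_pred[OF assms(3)] by (simp add: pow_coeff_def)
  also have "(-1) ^ (m + p - 1 - k) * kernel_lim \<tau> k = - \<tau> * (-1) ^ (m + p - 1) * kernel_lim \<tau> k"
    by (rule kernel_lim_sign[OF \<tau>(1) k])
  also have "- \<tau> * (-1) ^ (m + p - 1) = \<tau> * (-1) ^ (m + p)"
    using assms by (cases "m + p") auto
  finally show "pow_coeff q (m + p - 1 - k) * (kernel_lim \<tau> k * zeta_sgn (q + (m + p - 1 - k)) \<sigma>\<^sub>3) =
      \<tau> * (-1) ^ (m + p) * (real (m + p + q - k - 2 choose (q - 1)) * delta \<tau> k * t_sgn (k + 1) \<tau> *
         zeta_sgn (m + p + q - k - 1) \<sigma>\<^sub>3)"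
    by (simp only: e kernel_lim_def mult_ac)
qed

text \<open>The parity of the kernel coefficients trades the alternating sign for
  \<open>\<tau> * (-1) ^ (m + i)\<close>, and \<open>\<tau> * \<sigma>\<^sub>2 * \<sigma>\<^sub>3 =
  \<sigma>\<^sub>1\<close> gives the coefficient of \<open>S_lin\<close>. The other half of
  \<open>G4\<close> follows by exchanging \<open>m\<close> with \<open>p\<close> and
  \<open>\<sigma>\<^sub>1\<close> with \<open>\<sigma>\<^sub>2\<close>.\<close>

lemma G4_half_eq:
  assumes "m \<ge> 1" "p \<ge> 1" "q \<ge> 1" and \<sigma>: "\<sigma>\<^sub>1 \<in> {1, -1}" "\<sigma>\<^sub>2 \<in> {1, -1}" "\<sigma>\<^sub>3 \<in> {1, -1}"
    and \<tau>: "\<tau> = \<sigma>\<^sub>1 * \<sigma>\<^sub>2 * \<sigma>\<^sub>3"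
  shows "(-1) ^ p * (\<Sum>i=0..m - 1. \<Sum>k=0..m - 1 - i. real ((p + i - 1) choose i) *
         (pow_coeff q (m - 1 - i - k) * (kernel_lim \<tau> k * mixed_series (p + i) \<sigma>\<^sub>2 \<sigma>\<^sub>3 (q + (m - 1 - i - k)))))
    = (-1) ^ m * (\<Sum>j=1..m. \<Sum>k=0..m - j.
          real ((p + j - 2) choose (p - 1)) * real ((m + q - j - k - 1) choose (q - 1)) *
          delta \<tau> k * t_sgn (k + 1) \<tau> *
          (\<sigma>\<^sub>1 * S_lin (p + j - 1) (m + q - j - k) \<sigma>\<^sub>2 \<sigma>\<^sub>3
           - \<tau> * (-1) ^ (p + j) * zeta_sgn (p + j - 1) \<sigma>\<^sub>2 * zeta_sgn (m + q - j - k) \<sigma>\<^sub>3))"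
  unfolding sum_from_1[OF assms(1)] sum_distrib_left
proof (rule sum.cong[OF refl])
  fix i assume "i \<in> {0..m - 1}"
  then have i: "i \<le> m - 1" by simp
  have ms: "m - 1 - i = m - Suc i" by simp
  show "(\<Sum>k=0..m - 1 - i. (-1) ^ p * (real ((p + i - 1) choose i) *
         (pow_coeff q (m - 1 - i - k) * (kernel_lim \<tau> k * mixed_series (p + i) \<sigma>\<^sub>2 \<sigma>\<^sub>3 (q + (m - 1 - i - k))))))
    = (\<Sum>k=0..m - Suc i. (-1) ^ m * (real ((p + Suc i - 2) choose (p - 1)) * real ((m + q - Suc i - k - 1) choose (q - 1)) *
          delta \<tau> k * t_sgn (k + 1) \<tau> *
          (\<sigma>\<^sub>1 * S_lin (p + Suc i - 1) (m + q - Suc i - k) \<sigma>\<^sub>2 \<sigma>\<^sub>3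
           - \<tau> * (-1) ^ (p + Suc i) * zeta_sgn (p + Suc i - 1) \<sigma>\<^sub>2 * zeta_sgn (m + q - Suc i - k) \<sigma>\<^sub>3)))"
    unfolding ms
  proof (rule sum.cong[OF refl])
    fix k assume "k \<in> {0..m - Suc i}"
    then have k: "k \<le> m - Suc i" by simp
    define e where "e = q + (m - Suc i - k)"
    have e: "m + q - Suc i - k = e" using k i assms by (simp add: e_def)
    have c1: "(p + Suc i - 2) choose (p - 1) = (p + i - 1) choose i"
      using choose_pred[OF assms(2), of i] by simp
    have c2: "(e - 1) choose (q - 1) = (q + (m - Suc i - k) - 1) choose (m - Suc i - k)"
      unfolding e_def by (rule choose_pred[OF assms(3)])
    have pi: "p + Suc i - 1 = p + i" by simp
    let ?K = "kernel_lim \<tau> k"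
    let ?C = "real ((p + i - 1) choose i) * real ((e - 1) choose (q - 1))"
    have "\<tau> \<in> {1, -1}" unfolding \<tau> by (intro sign_mult \<sigma>)
    then have sg: "(-1) ^ (m - Suc i - k) * ?K = - \<tau> * (-1) ^ (m - Suc i) * ?K"
      by (rule kernel_lim_sign[OF _ k])
    have "(-1) ^ (m - Suc i) = (-1) ^ m * (-1::real) ^ Suc i"
      using i assms(1) by (intro sign_power_diff) auto
    then have sg': "(-1) ^ (m - Suc i - k) * ?K = \<tau> * (-1) ^ m * (-1) ^ i * ?K"
      unfolding sg by simp
    have "(-1) ^ p * (real ((p + i - 1) choose i) *
         (pow_coeff q (m - Suc i - k) * (?K * mixed_series (p + i) \<sigma>\<^sub>2 \<sigma>\<^sub>3 (q + (m - Suc i - k)))))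
       = (-1) ^ p * ?C * ((-1) ^ (m - Suc i - k) * ?K) * mixed_series (p + i) \<sigma>\<^sub>2 \<sigma>\<^sub>3 e"
      unfolding c2 by (simp add: pow_coeff_def e_def)
    also have "\<dots> = (-1) ^ m * (?C * ?K * (\<tau> * (-1) ^ (p + i) * mixed_series (p + i) \<sigma>\<^sub>2 \<sigma>\<^sub>3 e))"
      unfolding sg' by (simp add: power_add)
    also have "\<tau> * (-1) ^ (p + i) * mixed_series (p + i) \<sigma>\<^sub>2 \<sigma>\<^sub>3 e
       = \<sigma>\<^sub>1 * S_lin (p + i) e \<sigma>\<^sub>2 \<sigma>\<^sub>3 - \<tau> * (-1) ^ (p + Suc i) * zeta_sgn (p + i) \<sigma>\<^sub>2 * zeta_sgn e \<sigma>\<^sub>3"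
    proof -
      have "\<tau> * (-1) ^ (p + i) * mixed_series (p + i) \<sigma>\<^sub>2 \<sigma>\<^sub>3 e = \<tau> * (-1) ^ (p + i) * zeta_sgn (p + i) \<sigma>\<^sub>2 * zeta_sgn e \<sigma>\<^sub>3
         + (((-1) ^ (p + i) * (-1) ^ (p + i)) * (\<sigma>\<^sub>2 * \<sigma>\<^sub>2) * (\<sigma>\<^sub>3 * \<sigma>\<^sub>3)) * (\<sigma>\<^sub>1 * S_lin (p + i) e \<sigma>\<^sub>2 \<sigma>\<^sub>3)"
        unfolding mixed_series_def \<tau> by (simp only: distrib_left mult_ac)
      then show ?thesis
        using sign_simps(2)[OF \<sigma>(2)] sign_simps(2)[OF \<sigma>(3)] sign_simps(4)[of "-1" "p + i"] by simp
    qed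
    finally show "(-1) ^ p * (real ((p + i - 1) choose i) *
         (pow_coeff q (m - Suc i - k) * (?K * mixed_series (p + i) \<sigma>\<^sub>2 \<sigma>\<^sub>3 (q + (m - Suc i - k)))))
       = (-1) ^ m * (real ((p + Suc i - 2) choose (p - 1)) * real ((m + q - Suc i - k - 1) choose (q - 1)) *
          delta \<tau> k * t_sgn (k + 1) \<tau> *
          (\<sigma>\<^sub>1 * S_lin (p + Suc i - 1) (m + q - Suc i - k) \<sigma>\<^sub>2 \<sigma>\<^sub>3
           - \<tau> * (-1) ^ (p + Suc i) * zeta_sgn (p + Suc i - 1) \<sigma>\<^sub>2 * zeta_sgn (m + q - Suc i - k) \<sigma>\<^sub>3))"
      by (simp only: e c1 pi kernel_lim_def mult.assoc)
  qed
qed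

lemma G5_half_eq:
  assumes "p \<ge> 1" "r \<ge> 1"
  shows "conv2 (zeta_coeff p \<sigma>) (kernel_lim \<tau>) (r - 1)
    = (\<Sum>j=1..r. real ((p + j - 2) choose (p - 1)) * delta \<tau> (r - j) * t_sgn (r - j + 1) \<tau> * zeta_sgn (p + j - 1) \<sigma>)"
  unfolding sum_from_1[OF assms(2)] conv2_def
proof (rule sum.cong[OF refl])
  fix i
  have "(p + Suc i - 2) choose (p - 1) = (p + i - 1) choose i"
    using choose_pred[OF assms(1), of i] by simp
  then show "zeta_coeff p \<sigma> i * kernel_lim \<tau> (r - 1 - i)
    = real ((p + Suc i - 2) choose (p - 1)) * delta \<tau> (r - Suc i) * t_sgn (r - Suc i + 1) \<tau> * zeta_sgn (p + Suc i - 1) \<sigma>"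
    by (simp add: zeta_coeff_def kernel_lim_def)
qed

lemma G6_eq:
  assumes "m \<ge> 1" "p \<ge> 1" "q \<ge> 1" and \<tau>: "\<tau> = \<sigma>\<^sub>1 * \<sigma>\<^sub>2 * \<sigma>\<^sub>3"
  shows "(-1) ^ (m + p) * conv3 (zeta_coeff m \<sigma>\<^sub>1) (zeta_coeff p \<sigma>\<^sub>2) (kernel_lim \<tau>) (q - 1) = G6 m p q \<sigma>\<^sub>1 \<sigma>\<^sub>2 \<sigma>\<^sub>3"
proof -
  let ?f = "\<lambda>i k. zeta_coeff m \<sigma>\<^sub>1 i * (zeta_coeff p \<sigma>\<^sub>2 k * kernel_lim \<tau> (q - 1 - i - k))"
  have "conv3 (zeta_coeff m \<sigma>\<^sub>1) (zeta_coeff p \<sigma>\<^sub>2) (kernel_lim \<tau>) (q - 1)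
    = (\<Sum>(i, k)\<in>(SIGMA i:{0..q - 1}. {0..q - 1 - i}). ?f i k)"
    unfolding conv3_def conv2_def sum_distrib_left by (rule sum.Sigma) auto
  also have "\<dots> = (\<Sum>(j\<^sub>1, j\<^sub>2, j\<^sub>3) \<in> {(j\<^sub>1, j\<^sub>2, j\<^sub>3). j\<^sub>1 + j\<^sub>2 + j\<^sub>3 = q + 2 \<and> j\<^sub>1 \<ge> 1 \<and> j\<^sub>2 \<ge> 1 \<and> j\<^sub>3 \<ge> 1}.
          real ((m + j\<^sub>1 - 2) choose (m - 1)) * real ((p + j\<^sub>2 - 2) choose (p - 1)) *
          zeta_sgn (m + j\<^sub>1 - 1) \<sigma>\<^sub>1 * zeta_sgn (p + j\<^sub>2 - 1) \<sigma>\<^sub>2 *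
          delta \<tau> (j\<^sub>3 - 1) * t_sgn j\<^sub>3 \<tau>)"
  proof (rule sum.reindex_bij_witness[where i = "\<lambda>(j\<^sub>1, j\<^sub>2, j\<^sub>3). (j\<^sub>1 - 1, j\<^sub>2 - 1)"
        and j = "\<lambda>(i, k). (Suc i, Suc k, q - i - k)"])
    fix x assume "x \<in> (SIGMA i:{0..q - 1}. {0..q - 1 - i})"
    then obtain i k where x: "x = (i, k)" and ik: "i + k \<le> q - 1" by auto
    show "(case x of (i, k) \<Rightarrow> (Suc i, Suc k, q - i - k)) \<in> {(j\<^sub>1, j\<^sub>2, j\<^sub>3). j\<^sub>1 + j\<^sub>2 + j\<^sub>3 = q + 2 \<and> j\<^sub>1 \<ge> 1 \<and> j\<^sub>2 \<ge> 1 \<and> j\<^sub>3 \<ge> 1}"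
      using x ik assms by auto
    have c: "(m + Suc i - 2) choose (m - 1) = (m + i - 1) choose i" "(p + Suc k - 2) choose (p - 1) = (p + k - 1) choose k"
      using choose_pred[OF assms(1), of i] choose_pred[OF assms(2), of k] by simp_all
    have "q - 1 - i - k = q - i - k - 1" "q - i - k - 1 + 1 = q - i - k" using ik assms by auto
    then show "(case case x of (i, k) \<Rightarrow> (Suc i, Suc k, q - i - k) of (j\<^sub>1, j\<^sub>2, j\<^sub>3) \<Rightarrow>
          real ((m + j\<^sub>1 - 2) choose (m - 1)) * real ((p + j\<^sub>2 - 2) choose (p - 1)) *
          zeta_sgn (m + j\<^sub>1 - 1) \<sigma>\<^sub>1 * zeta_sgn (p + j\<^sub>2 - 1) \<sigma>\<^sub>2 *
          delta \<tau> (j\<^sub>3 - 1) * t_sgn j\<^sub>3 \<tau>) = (case x of (i, k) \<Rightarrow> ?f i k)"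
      unfolding x prod.case c by (simp only: zeta_coeff_def kernel_lim_def mult_ac add_Suc_right diff_Suc_1)
  qed auto
  finally show ?thesis by (simp only: G6_def Let_def \<tau>)
qed

section \<open>Matching the half-integer series with the \<open>T\<close>-sums\<close>

lemma t_sgn_sums:
  assumes "\<sigma> \<in> {1, -1}" "s \<ge> 1" "(s, \<sigma>) \<noteq> (1, 1)"
  shows "(\<lambda>j. \<sigma> ^ Suc j / (real j + 1/2) ^ s) sums t_sgn s \<sigma>"
proof -
  have "harm_corr s \<sigma> J = 0" for J using assms(3) by (auto simp: harm_corr_def)
  then show ?thesis
    using sum_t_sgn_tendsto[OF assms(1,2)] by (simp add: sums_def)
qed

lemma T_lin_sums:
  assumes "\<sigma>\<^sub>1 \<in> {1, -1}" "p \<ge> 1" "e \<ge> 1" "\<sigma> \<in> {1, -1}" "(e, \<sigma>) \<noteq> (1, 1)"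
  shows "(\<lambda>j. \<sigma> ^ j * h_num p \<sigma>\<^sub>1 j / (real j + 1/2) ^ e) sums T_lin p e \<sigma>\<^sub>1 \<sigma>"
proof -
  have "real (Suc j) - 1/2 = real j + 1/2" for j by simp
  moreover have "(\<lambda>j. \<sigma> ^ j * h_num p \<sigma>\<^sub>1 j / (real (Suc j) - 1/2) ^ e) sums T_lin p e \<sigma>\<^sub>1 \<sigma>"
    unfolding T_lin_def by (intro summable_sums tail_bounded_summable tail_bounded_h_num assms)
  ultimately show ?thesis by (simp only:)
qed

text \<open>With powers and harmonic sums replaced by free variables this is a polynomial identity,
  checked for each of the eight choices of signs. Here \<open>em\<close>, \<open>ep\<close>,
  \<open>eq\<close> stand for powers of \<open>-1\<close>, \<open>s1\<close>, \<open>s2\<close>,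
  \<open>s3\<close> for \<open>j\<close>-th powers of the signs, and \<open>u\<close>,
  \<open>v\<close>, \<open>w\<close> for inverse powers of \<open>j + 1/2\<close>.\<close>

lemma half_integer_term_bracket:
  fixes \<sigma>\<^sub>1 \<sigma>\<^sub>2 \<sigma>\<^sub>3 t1 t2 h k u v w em ep eq s1 s2 s3 :: real
  assumes "\<sigma>\<^sub>1 \<in> {1, -1}" "\<sigma>\<^sub>2 \<in> {1, -1}" "\<sigma>\<^sub>3 \<in> {1, -1}" and \<tau>: "\<tau> = \<sigma>\<^sub>1 * \<sigma>\<^sub>2 * \<sigma>\<^sub>3"
  shows "s3 * w * (\<tau> * (em * t1 + (h + s1 * u)) * (ep * t2 + (k + s2 * v))
       + em * ep * eq * (\<sigma>\<^sub>1 * t1 - h) * (\<sigma>\<^sub>2 * t2 - k))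
    = \<tau> * (1 + \<tau> * (em * ep * eq)) * (s3 * (h * k) * w)
    + (\<tau> * (em * (1 - \<sigma>\<^sub>2 * \<sigma>\<^sub>3 * (ep * eq)) * t1 * (s3 * k * w)
         + ep * (1 - \<sigma>\<^sub>1 * \<sigma>\<^sub>3 * (em * eq)) * t2 * (s3 * h * w)
         + s2 * s3 * h * (v * w) + s1 * s3 * k * (u * w))
     + \<sigma>\<^sub>1 * em * t1 * (\<sigma>\<^sub>2 * \<sigma>\<^sub>3 * (s2 * s3) * (v * w))
     + \<sigma>\<^sub>2 * ep * t2 * (\<sigma>\<^sub>1 * \<sigma>\<^sub>3 * (s1 * s3) * (u * w))
     + \<sigma>\<^sub>1 * \<sigma>\<^sub>2 * (em * ep) * (1 + \<sigma>\<^sub>3 * eq) * t1 * t2 * (\<sigma>\<^sub>3 * s3 * w)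
     + \<tau> * (s1 * s2 * s3) * (u * v * w))"
  using assms(1-3) unfolding \<tau> by (elim insertE emptyE) (simp_all add: algebra_simps)

text \<open>The products \<open>h_num m \<sigma>\<^sub>1 j * h_num p \<sigma>\<^sub>2 j\<close> from
  the two opposite points merge into the factor \<open>delta \<tau> (m + p + q - 1)\<close>; the
  surplus term in \<open>h_num (Suc j)\<close> yields the higher exponents of
  \<open>b\<close>.\<close>

lemma half_integer_term_eq:
  fixes m p q j :: nat
  assumes mpq: "m \<ge> 1" "p \<ge> 1" "q \<ge> 1"
    and \<sigma>: "\<sigma>\<^sub>1 \<in> {1, -1}" "\<sigma>\<^sub>2 \<in> {1, -1}" "\<sigma>\<^sub>3 \<in> {1, -1}" and \<tau>: "\<tau> = \<sigma>\<^sub>1 * \<sigma>\<^sub>2 * \<sigma>\<^sub>3"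
  defines "b \<equiv> real j + 1/2"
  shows "(-1) ^ (m + p) * (\<tau> ^ Suc j * ((\<sigma>\<^sub>1 ^ j * (t1 + (-1) ^ m * h_num m \<sigma>\<^sub>1 (Suc j)))
         * (\<sigma>\<^sub>2 ^ j * (t2 + (-1) ^ p * h_num p \<sigma>\<^sub>2 (Suc j))) / b ^ q)
      + \<tau> ^ j * ((\<sigma>\<^sub>1 ^ j * (\<sigma>\<^sub>1 * t1 - h_num m \<sigma>\<^sub>1 j))
         * (\<sigma>\<^sub>2 ^ j * (\<sigma>\<^sub>2 * t2 - h_num p \<sigma>\<^sub>2 j)) / (- b) ^ q))
    = \<tau> * delta \<tau> (m + p + q - 1) * (\<sigma>\<^sub>3 ^ j * (h_num m \<sigma>\<^sub>1 j * h_num p \<sigma>\<^sub>2 j) / b ^ q)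
    + (\<tau> * ((-1) ^ m * delta (\<sigma>\<^sub>2 * \<sigma>\<^sub>3) (p + q) * t1 * (\<sigma>\<^sub>3 ^ j * h_num p \<sigma>\<^sub>2 j / b ^ q)
         + (-1) ^ p * delta (\<sigma>\<^sub>1 * \<sigma>\<^sub>3) (m + q) * t2 * (\<sigma>\<^sub>3 ^ j * h_num m \<sigma>\<^sub>1 j / b ^ q)
         + (\<sigma>\<^sub>2 * \<sigma>\<^sub>3) ^ j * h_num m \<sigma>\<^sub>1 j / b ^ (p + q) + (\<sigma>\<^sub>1 * \<sigma>\<^sub>3) ^ j * h_num p \<sigma>\<^sub>2 j / b ^ (m + q))
     + \<sigma>\<^sub>1 * (-1) ^ m * t1 * ((\<sigma>\<^sub>2 * \<sigma>\<^sub>3) ^ Suc j / b ^ (p + q))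
     + \<sigma>\<^sub>2 * (-1) ^ p * t2 * ((\<sigma>\<^sub>1 * \<sigma>\<^sub>3) ^ Suc j / b ^ (m + q))
     + \<sigma>\<^sub>1 * \<sigma>\<^sub>2 * (-1) ^ (m + p) * delta \<sigma>\<^sub>3 (q - 1) * t1 * t2 * (\<sigma>\<^sub>3 ^ Suc j / b ^ q)
     + \<tau> ^ Suc j / b ^ (m + p + q))"
proof -
  define s1 s2 s3 where "s1 = \<sigma>\<^sub>1 ^ j" and "s2 = \<sigma>\<^sub>2 ^ j" and "s3 = \<sigma>\<^sub>3 ^ j"
  define em ep eq where "em = (-1::real) ^ m" and "ep = (-1::real) ^ p" and "eq = (-1::real) ^ q"
  define h k where "h = h_num m \<sigma>\<^sub>1 j" and "k = h_num p \<sigma>\<^sub>2 j"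
  define u v w where "u = 1 / b ^ m" and "v = 1 / b ^ p" and "w = 1 / b ^ q"
  have hS: "h_num m \<sigma>\<^sub>1 (Suc j) = h + s1 * u" "h_num p \<sigma>\<^sub>2 (Suc j) = k + s2 * v"
    by (simp_all add: h_num_lessThan h_def k_def s1_def s2_def u_def v_def b_def)
  have sq: "s1 * s1 = 1" "s2 * s2 = 1" "em * em = 1" "ep * ep = 1"
    unfolding s1_def s2_def em_def ep_def using \<sigma> by (simp_all add: sign_simps)
  have \<tau>j: "\<tau> ^ j = s1 * s2 * s3" by (simp add: \<tau> s1_def s2_def s3_def power_mult_distrib)
  have dv: "x / b ^ q = x * w" "x / b ^ (p + q) = x * (v * w)" "x / b ^ (m + q) = x * (u * w)"
    "x / b ^ (m + p + q) = x * (u * v * w)" for x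
    by (simp_all add: u_def v_def w_def power_add)
  have nb: "x / (- b) ^ q = x * (eq * w)" for x
    unfolding power_minus[of b] eq_def w_def by (cases "even q") simp_all
  have dl: "delta \<tau> (m + p + q - 1) = 1 + \<tau> * (em * ep * eq)" "delta (\<sigma>\<^sub>2 * \<sigma>\<^sub>3) (p + q) = 1 - \<sigma>\<^sub>2 * \<sigma>\<^sub>3 * (ep * eq)"
    "delta (\<sigma>\<^sub>1 * \<sigma>\<^sub>3) (m + q) = 1 - \<sigma>\<^sub>1 * \<sigma>\<^sub>3 * (em * eq)" "delta \<sigma>\<^sub>3 (q - 1) = 1 + \<sigma>\<^sub>3 * eq"
  proof -
    have "(-1) ^ (n - 1) = - ((-1::real) ^ n)" if "n \<ge> 1" for n using that by (cases n) auto
    then show "delta \<tau> (m + p + q - 1) = 1 + \<tau> * (em * ep * eq)" "delta \<sigma>\<^sub>3 (q - 1) = 1 + \<sigma>\<^sub>3 * eq"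
      using mpq by (simp_all add: delta_def em_def ep_def eq_def power_add)
  qed (simp_all add: delta_def em_def ep_def eq_def power_add)
  have "(em * ep) * (\<tau> * (s1 * s2 * s3) * ((s1 * (t1 + em * (h + s1 * u))) * (s2 * (t2 + ep * (k + s2 * v))) * w)
      + s1 * s2 * s3 * ((s1 * (\<sigma>\<^sub>1 * t1 - h)) * (s2 * (\<sigma>\<^sub>2 * t2 - k)) * (eq * w)))
    = (s1 * s1) * (s2 * s2) * (s3 * w * (\<tau> * (em * t1 + (em * em) * (h + s1 * u)) * (ep * t2 + (ep * ep) * (k + s2 * v))
       + em * ep * eq * (\<sigma>\<^sub>1 * t1 - h) * (\<sigma>\<^sub>2 * t2 - k)))"
    by (simp add: distrib_left distrib_right left_diff_distrib right_diff_distrib mult_ac)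
  also have "\<dots> = s3 * w * (\<tau> * (em * t1 + (h + s1 * u)) * (ep * t2 + (k + s2 * v))
       + em * ep * eq * (\<sigma>\<^sub>1 * t1 - h) * (\<sigma>\<^sub>2 * t2 - k))"
    unfolding sq by simp
  also note half_integer_term_bracket[OF \<sigma> \<tau>]
  finally show ?thesis
    unfolding dl dv nb hS power_Suc \<tau>j power_add[of "-1"] power_mult_distrib
      em_def[symmetric] ep_def[symmetric] eq_def[symmetric] s1_def[symmetric] s2_def[symmetric] s3_def[symmetric]
      h_def[symmetric] k_def[symmetric] .
qed

theorem theorem4p2:
  fixes m p q :: nat and \<sigma>\<^sub>1 \<sigma>\<^sub>2 \<sigma>\<^sub>3 :: real
  assumes "m \<ge> 1" and "p \<ge> 1" and "q \<ge> 1"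
    and "\<sigma>\<^sub>1 \<in> {1, -1}" and "\<sigma>\<^sub>2 \<in> {1, -1}" and "\<sigma>\<^sub>3 \<in> {1, -1}"
    and "(q, \<sigma>\<^sub>3) \<noteq> (1, 1)"
  shows "let \<tau> = \<sigma>\<^sub>1 * \<sigma>\<^sub>2 * \<sigma>\<^sub>3 in
    \<tau> * delta \<tau> (m + p + q - 1) * T_quad m p q \<sigma>\<^sub>1 \<sigma>\<^sub>2 \<sigma>\<^sub>3 =
      G1 m p q \<sigma>\<^sub>1 \<sigma>\<^sub>2 \<sigma>\<^sub>3 + G2 m p q \<sigma>\<^sub>1 \<sigma>\<^sub>2 \<sigma>\<^sub>3 + G3 m p q \<sigma>\<^sub>1 \<sigma>\<^sub>2 \<sigma>\<^sub>3
      + G4 m p q \<sigma>\<^sub>1 \<sigma>\<^sub>2 \<sigma>\<^sub>3 + G5 m p q \<sigma>\<^sub>1 \<sigma>\<^sub>2 \<sigma>\<^sub>3 + G6 m p q \<sigma>\<^sub>1 \<sigma>\<^sub>2 \<sigma>\<^sub>3"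
proof -
  define \<tau> where \<tau>: "\<tau> = \<sigma>\<^sub>1 * \<sigma>\<^sub>2 * \<sigma>\<^sub>3"
  have \<tau>': "\<tau> = \<sigma>\<^sub>2 * \<sigma>\<^sub>1 * \<sigma>\<^sub>3" by (simp add: \<tau>)
  note mpq = assms(1-3) and \<sigma> = assms(4-6)
  have \<tau>s: "\<tau> \<in> {1, -1}" unfolding \<tau> by (intro sign_mult \<sigma>)
  define t1 t2 where "t1 = t_sgn m \<sigma>\<^sub>1" and "t2 = t_sgn p \<sigma>\<^sub>2"
  define L where "L = residue_total m p q (zeta_coeff m \<sigma>\<^sub>1) (zeta_coeff p \<sigma>\<^sub>2) (kernel_lim \<tau>)
      (\<lambda>k e. kernel_lim \<tau> k * zeta_sgn e \<sigma>\<^sub>3)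
      (\<lambda>i k e. kernel_lim \<tau> k * mixed_series (p + i) \<sigma>\<^sub>2 \<sigma>\<^sub>3 e)
      (\<lambda>i k e. kernel_lim \<tau> k * mixed_series (m + i) \<sigma>\<^sub>1 \<sigma>\<^sub>3 e)"
  define R where "R = \<tau> * ((-1) ^ m * delta (\<sigma>\<^sub>2 * \<sigma>\<^sub>3) (p + q) * t1 * T_lin p q \<sigma>\<^sub>2 \<sigma>\<^sub>3
         + (-1) ^ p * delta (\<sigma>\<^sub>1 * \<sigma>\<^sub>3) (m + q) * t2 * T_lin m q \<sigma>\<^sub>1 \<sigma>\<^sub>3
         + T_lin m (p + q) \<sigma>\<^sub>1 (\<sigma>\<^sub>2 * \<sigma>\<^sub>3) + T_lin p (m + q) \<sigma>\<^sub>2 (\<sigma>\<^sub>1 * \<sigma>\<^sub>3))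
     + \<sigma>\<^sub>1 * (-1) ^ m * t1 * t_sgn (p + q) (\<sigma>\<^sub>2 * \<sigma>\<^sub>3)
     + \<sigma>\<^sub>2 * (-1) ^ p * t2 * t_sgn (m + q) (\<sigma>\<^sub>1 * \<sigma>\<^sub>3)
     + \<sigma>\<^sub>1 * \<sigma>\<^sub>2 * (-1) ^ (m + p) * delta \<sigma>\<^sub>3 (q - 1) * t1 * t2 * t_sgn q \<sigma>\<^sub>3
     + t_sgn (m + p + q) \<tau>"
  define c where "c = \<tau> * delta \<tau> (m + p + q - 1)"
  define T where "T j = \<sigma>\<^sub>3 ^ j * (h_num m \<sigma>\<^sub>1 j * h_num p \<sigma>\<^sub>2 j) / (real j + 1/2) ^ q" for j
  let ?rest = "\<lambda>j. \<tau> * ((-1) ^ m * delta (\<sigma>\<^sub>2 * \<sigma>\<^sub>3) (p + q) * t1 * (\<sigma>\<^sub>3 ^ j * h_num p \<sigma>\<^sub>2 j / (real j + 1/2) ^ q)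
         + (-1) ^ p * delta (\<sigma>\<^sub>1 * \<sigma>\<^sub>3) (m + q) * t2 * (\<sigma>\<^sub>3 ^ j * h_num m \<sigma>\<^sub>1 j / (real j + 1/2) ^ q)
         + (\<sigma>\<^sub>2 * \<sigma>\<^sub>3) ^ j * h_num m \<sigma>\<^sub>1 j / (real j + 1/2) ^ (p + q) + (\<sigma>\<^sub>1 * \<sigma>\<^sub>3) ^ j * h_num p \<sigma>\<^sub>2 j / (real j + 1/2) ^ (m + q))
     + \<sigma>\<^sub>1 * (-1) ^ m * t1 * ((\<sigma>\<^sub>2 * \<sigma>\<^sub>3) ^ Suc j / (real j + 1/2) ^ (p + q))
     + \<sigma>\<^sub>2 * (-1) ^ p * t2 * ((\<sigma>\<^sub>1 * \<sigma>\<^sub>3) ^ Suc j / (real j + 1/2) ^ (m + q))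
     + \<sigma>\<^sub>1 * \<sigma>\<^sub>2 * (-1) ^ (m + p) * delta \<sigma>\<^sub>3 (q - 1) * t1 * t2 * (\<sigma>\<^sub>3 ^ Suc j / (real j + 1/2) ^ q)
     + \<tau> ^ Suc j / (real j + 1/2) ^ (m + p + q)"
  \<comment> \<open>All series except the quadratic one are known to converge, so convergence of the
    latter, times \<open>c\<close>, follows by subtraction.\<close>
  have "?rest sums R"
    unfolding R_def
    by (intro sums_add sums_mult T_lin_sums t_sgn_sums sign_mult \<sigma> \<tau>s) (use mpq assms(7) in auto)
  moreover have "(\<lambda>j. c * T j + ?rest j) sums ((-1) ^ (m + p) * L)"
    using sums_mult[OF half_integer_series_sums[OF mpq \<sigma> assms(7) \<tau>], of "(-1) ^ (m + p)"]
    unfolding half_integer_term_eq[OF mpq \<sigma> \<tau>] L_def[symmetric] t1_def[symmetric] t2_def[symmetric] c_def T_def .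
  ultimately have "(\<lambda>j. (c * T j + ?rest j) - ?rest j) sums ((-1) ^ (m + p) * L - R)"
    by (intro sums_diff)
  then have cT: "(\<lambda>j. c * T j) sums ((-1) ^ (m + p) * L - R)" by simp
  have "real (Suc j) - 1/2 = real j + 1/2" for j by simp
  then have T_quad: "T_quad m p q \<sigma>\<^sub>1 \<sigma>\<^sub>2 \<sigma>\<^sub>3 = suminf T"
    by (simp only: T_quad_def T_def[abs_def])
  have main: "c * T_quad m p q \<sigma>\<^sub>1 \<sigma>\<^sub>2 \<sigma>\<^sub>3 = (-1) ^ (m + p) * L - R"
  \<comment> \<open>For \<open>c = 0\<close> the zero series determines the right-hand side;
    otherwise division by \<open>c\<close> also shows that the quadratic series converges.\<close>
  proof (cases "c = 0")
    case True
    then show ?thesis using cT sums_unique2[OF _ sums_zero] by force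
  next
    case False
    from sums_mult_D[OF cT False] show ?thesis
      using False by (simp add: T_quad sums_iff)
  qed
  \<comment> \<open>The global factor exchanges \<open>(-1) ^ m\<close> and \<open>(-1) ^ p\<close>,
    so the residue terms with the polar part of the first pole sum acquire
    \<open>(-1) ^ p\<close>.\<close>
  have sq: "(-1) ^ (m + p) * ((-1) ^ (m + p) * x) = x" "(-1) ^ (m + p) * ((-1) ^ m * x) = (-1) ^ p * x"
    "(-1) ^ (m + p) * ((-1) ^ p * x) = (-1) ^ m * x" for x :: real
    using sign_simps(6)[of "-1" m] sign_simps(6)[of "-1" p] by (simp_all add: power_add mult.left_commute)
  have "(-1) ^ (m + p) * L = kernel_lim \<tau> (m + p + q - 1) + G3 m p q \<sigma>\<^sub>1 \<sigma>\<^sub>2 \<sigma>\<^sub>3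
      + G4 m p q \<sigma>\<^sub>1 \<sigma>\<^sub>2 \<sigma>\<^sub>3 + G5 m p q \<sigma>\<^sub>1 \<sigma>\<^sub>2 \<sigma>\<^sub>3 + G6 m p q \<sigma>\<^sub>1 \<sigma>\<^sub>2 \<sigma>\<^sub>3"
  proof -
    have pq: "p + q \<ge> 1" "m + q \<ge> 1" using mpq by auto
    show ?thesis
      unfolding L_def residue_total_def distrib_left sq G6_eq[OF mpq \<tau>] G3_eq[OF mpq \<tau>s \<tau>]
        G4_half_eq[OF mpq \<sigma> \<tau>] G4_half_eq[OF mpq(2,1,3) \<sigma>(2,1,3) \<tau>']
        G5_half_eq[OF mpq(2) pq(2)] G5_half_eq[OF mpq(1) pq(1)]
        G4_def G5_def Let_def \<tau>[symmetric]
      by (simp only: add_ac)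
  qed
  \<comment> \<open>The leading residue at \<open>0\<close> equals
    \<open>t_sgn (m + p + q) \<tau>\<close> times \<open>1 + \<tau> * (-1) ^ (m + p + q)\<close>:
    the first part cancels the last term of \<open>R\<close>, the second is the last term of
    \<open>G2\<close>.\<close>
  moreover have "G1 m p q \<sigma>\<^sub>1 \<sigma>\<^sub>2 \<sigma>\<^sub>3 + G2 m p q \<sigma>\<^sub>1 \<sigma>\<^sub>2 \<sigma>\<^sub>3 = kernel_lim \<tau> (m + p + q - 1) - R"
  proof -
    have "kernel_lim \<tau> (m + p + q - 1) = t_sgn (m + p + q) \<tau> + \<tau> * (-1) ^ (m + p + q) * t_sgn (m + p + q) \<tau>"
      using mpq by (cases "m + p + q") (auto simp: kernel_lim_def delta_def algebra_simps)
    then show ?thesis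
      unfolding G1_def G2_def R_def Let_def \<tau>[symmetric] t1_def[symmetric] t2_def[symmetric] by simp
  qed
  ultimately show ?thesis
    using main unfolding Let_def \<tau>[symmetric] c_def by simp
qed

end
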